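(* Let $\mathfrak{a}$ be an ideal of the commutative Noetherian ring $R$ and $Q$ a Gorenstein flat $R$-module. (i) $Q$ is $\Lambda^{\mathfrak{a}}$-acyclic, i.e. $H^{\mathfrak{a}}_i(Q)=0$ for all $i>0$. (ii) There is a natural $R$-isomorphism $H^{\mathfrak{a}}_0(Q)\cong\Lambda^{\mathfrak{a}}(Q)$.
   Context: $\Lambda^{\mathfrak{a}}(-)=\varprojlim_n(R/\mathfrak{a}^n\otimes_R-)$ is the $\mathfrak{a}$-adic completion functor on $R$-modules, applied degreewise to complexes. For an $R$-module $M$ with projective resolution $P$, the local homology modules are $H_i^{\mathfrak{a}}(M):=H_i(\Lambda^{\mathfrak{a}}(P))$. There is a natural transformation $\xi:H_0^{\mathfrak{a}}(-)\to\Lambda^{\mathfrak{a}}(-)$, where $\xi_M:H_0(\Lambda^{\mathfrak{a}}(P))=\operatorname{coker}(\Lambda^{\mathfrak{a}}(P_1)\to\Lambda^{\mathfrak{a}}(P_0))\to\Lambda^{\mathfrak{a}}(M)$ is induced by the augmentation $P_0\to M$; "natural isomorphism" in (ii) refers to this map. An $R$-module $T$ is Gorenstein flat if there is an exact complex $F=\cdots\to F_1\to F_0\to F_{-1}\to\cdots$ of flat $R$-modules with $T\cong\operatorname{im}(F_0\to F_{-1})$ and such that $F\otimes_RI$ is exact for every injective $R$-module $I$. *)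

theory Defs
  imports "HOL-Algebra.Module" "HOL-Algebra.Ideal_Product" "HOL-Algebra.Ring_Divisibility" "HOL.Hull"
begin

text \<open>
  The \<open>mult\<close> and \<open>one\<close> fields of a module record play no role in the locale
  \<^locale>\<open>module\<close>; they are left \<^term>\<open>undefined\<close> in the constructions below.

  A definition that quantifies over ``all modules'' has to name the type of their
  elements. Where this happens, a comment says why the chosen type already gives the
  usual notion.
\<close>

section \<open>Homomorphisms, quotients, exactness\<close>

definition mod_hom ::
  "('a, 'c) ring_scheme \<Rightarrow> ('a, 'm) module \<Rightarrow> ('a, 'n) module \<Rightarrow> ('m \<Rightarrow> 'n) set" where
  "mod_hom R M N = {f \<in> hom (add_monoid M) (add_monoid N).
     \<forall>r\<in>carrier R. \<forall>x\<in>carrier M. f (r \<odot>\<^bsub>M\<^esub> x) = r \<odot>\<^bsub>N\<^esub> f x}"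

definition mod_iso ::
  "('a, 'c) ring_scheme \<Rightarrow> ('a, 'm) module \<Rightarrow> ('a, 'n) module \<Rightarrow> ('m \<Rightarrow> 'n) set" where
  "mod_iso R M N = {f \<in> mod_hom R M N. bij_betw f (carrier M) (carrier N)}"

definition exact_at ::
  "('a, 'l) module \<Rightarrow> ('l \<Rightarrow> 'm) \<Rightarrow> ('a, 'm) module \<Rightarrow> ('m \<Rightarrow> 'n) \<Rightarrow> ('a, 'n) module \<Rightarrow> bool" where
  "exact_at L f M g N \<longleftrightarrow> f ` carrier L = a_kernel M N g"

definition quot_module :: "('a, 'm) module \<Rightarrow> 'm set \<Rightarrow> ('a, 'm set) module" where
  "quot_module M H =
     \<lparr>carrier = a_rcosets\<^bsub>M\<^esub> H, monoid.mult = undefined, one = undefined,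
      zero = H, add = set_add M, smult = (\<lambda>r Y. H <+>\<^bsub>M\<^esub> ((\<lambda>x. r \<odot>\<^bsub>M\<^esub> x) ` Y))\<rparr>"

definition regular_module :: "('a, 'c) ring_scheme \<Rightarrow> ('a, 'a) module" where
  "regular_module R =
     \<lparr>carrier = carrier R, monoid.mult = undefined, one = undefined,
      zero = \<zero>\<^bsub>R\<^esub>, add = add R, smult = monoid.mult R\<rparr>"


section \<open>Tensor products\<close>

definition free_module :: "('a, 'c) ring_scheme \<Rightarrow> 's set \<Rightarrow> ('a, 's \<Rightarrow> 'a) module" where
  "free_module R S =
     \<lparr>carrier = {u. (\<forall>s. u s \<in> carrier R) \<and> (\<forall>s. s \<notin> S \<longrightarrow> u s = \<zero>\<^bsub>R\<^esub>) \<and>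
                    finite {s. u s \<noteq> \<zero>\<^bsub>R\<^esub>}},
      monoid.mult = undefined, one = undefined,
      zero = (\<lambda>s. \<zero>\<^bsub>R\<^esub>), add = (\<lambda>u v s. u s \<oplus>\<^bsub>R\<^esub> v s), smult = (\<lambda>r u s. r \<otimes>\<^bsub>R\<^esub> u s)\<rparr>"

definition free_gen :: "('a, 'c) ring_scheme \<Rightarrow> 's \<Rightarrow> 's \<Rightarrow> 'a" where
  "free_gen R s = (\<lambda>t. if t = s then \<one>\<^bsub>R\<^esub> else \<zero>\<^bsub>R\<^esub>)"

definition free_lift ::
  "('a, 'c) ring_scheme \<Rightarrow> ('a, 'n) module \<Rightarrow> ('s \<Rightarrow> 'n) \<Rightarrow> ('s \<Rightarrow> 'a) \<Rightarrow> 'n" where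
  "free_lift R N \<phi> u = (\<Oplus>\<^bsub>N\<^esub>s\<in>{s. u s \<noteq> \<zero>\<^bsub>R\<^esub>}. u s \<odot>\<^bsub>N\<^esub> \<phi> s)"

definition tensor_relators ::
  "('a, 'c) ring_scheme \<Rightarrow> ('a, 'm) module \<Rightarrow> ('a, 'n) module \<Rightarrow> ('m \<times> 'n \<Rightarrow> 'a) set" where
  "tensor_relators R M N =
     (let F = free_module R (carrier M \<times> carrier N); g = (\<lambda>x y. free_gen R (x, y)) in
       {g (x \<oplus>\<^bsub>M\<^esub> x') y \<ominus>\<^bsub>F\<^esub> (g x y \<oplus>\<^bsub>F\<^esub> g x' y) | x x' y.
          x \<in> carrier M \<and> x' \<in> carrier M \<and> y \<in> carrier N}
     \<union> {g x (y \<oplus>\<^bsub>N\<^esub> y') \<ominus>\<^bsub>F\<^esub> (g x y \<oplus>\<^bsub>F\<^esub> g x y') | x y y'.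
          x \<in> carrier M \<and> y \<in> carrier N \<and> y' \<in> carrier N}
     \<union> {g (r \<odot>\<^bsub>M\<^esub> x) y \<ominus>\<^bsub>F\<^esub> (r \<odot>\<^bsub>F\<^esub> g x y) | r x y.
          r \<in> carrier R \<and> x \<in> carrier M \<and> y \<in> carrier N}
     \<union> {g x (r \<odot>\<^bsub>N\<^esub> y) \<ominus>\<^bsub>F\<^esub> (r \<odot>\<^bsub>F\<^esub> g x y) | r x y.
          r \<in> carrier R \<and> x \<in> carrier M \<and> y \<in> carrier N})"

definition tensor_rels ::
  "('a, 'c) ring_scheme \<Rightarrow> ('a, 'm) module \<Rightarrow> ('a, 'n) module \<Rightarrow> ('m \<times> 'n \<Rightarrow> 'a) set" where
  "tensor_rels R M N =
     (\<lambda>H. submodule H R (free_module R (carrier M \<times> carrier N))) hull tensor_relators R M N"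

definition tensor ::
  "('a, 'c) ring_scheme \<Rightarrow> ('a, 'm) module \<Rightarrow> ('a, 'n) module
    \<Rightarrow> ('a, ('m \<times> 'n \<Rightarrow> 'a) set) module" where
  "tensor R M N = quot_module (free_module R (carrier M \<times> carrier N)) (tensor_rels R M N)"

definition pure_tensor ::
  "('a, 'c) ring_scheme \<Rightarrow> ('a, 'm) module \<Rightarrow> ('a, 'n) module
    \<Rightarrow> 'm \<Rightarrow> 'n \<Rightarrow> ('m \<times> 'n \<Rightarrow> 'a) set" where
  "pure_tensor R M N x y =
     tensor_rels R M N +>\<^bsub>free_module R (carrier M \<times> carrier N)\<^esub> free_gen R (x, y)"

text \<open>
  \<open>f \<otimes> g : M \<otimes> N \<rightarrow> M' \<otimes> N'\<close>. The class of \<open>\<Sum> r\<^sub>i (x\<^sub>i, y\<^sub>i)\<close> goes to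
  \<open>\<Sum> r\<^sub>i (f x\<^sub>i \<otimes> g y\<^sub>i)\<close>, the common value at all representatives of the class.
\<close>

definition tensor_map ::
  "('a, 'c) ring_scheme \<Rightarrow> ('a, 'm) module \<Rightarrow> ('a, 'n) module
    \<Rightarrow> ('a, 'k) module \<Rightarrow> ('a, 'l) module \<Rightarrow> ('m \<Rightarrow> 'k) \<Rightarrow> ('n \<Rightarrow> 'l)
    \<Rightarrow> ('m \<times> 'n \<Rightarrow> 'a) set \<Rightarrow> ('k \<times> 'l \<Rightarrow> 'a) set" where
  "tensor_map R M N M' N' f g Y =
     the_elem (free_lift R (tensor R M' N') (\<lambda>(x, y). pure_tensor R M' N' (f x) (g y)) ` Y)"


section \<open>Flat, injective, projective and Gorenstein flat modules\<close>

text \<open>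
  For flatness and injectivity it is enough to test on monomorphisms \<open>A \<rightarrow> B\<close> of modules
  whose elements have the type of the ring elements, because these include the inclusions
  of the ideals into \<open>R\<close> (ideal criterion for flatness, Baer's criterion for injectivity).
\<close>

definition flat_module :: "('a, 'c) ring_scheme \<Rightarrow> ('a, 'm) module \<Rightarrow> bool" where
  "flat_module R M \<longleftrightarrow> module R M \<and>
     (\<forall>(A :: ('a, 'a) module) (B :: ('a, 'a) module). \<forall>f\<in>mod_hom R A B.
        module R A \<and> module R B \<and> inj_on f (carrier A) \<longrightarrow>
        inj_on (tensor_map R A M B M f id) (carrier (tensor R A M)))"

definition injective_module :: "('a, 'c) ring_scheme \<Rightarrow> ('a, 'm) module \<Rightarrow> bool" where
  "injective_module R E \<longleftrightarrow> module R E \<and>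
     (\<forall>(A :: ('a, 'a) module) (B :: ('a, 'a) module). \<forall>f\<in>mod_hom R A B. \<forall>g\<in>mod_hom R A E.
        module R A \<and> module R B \<and> inj_on f (carrier A) \<longrightarrow>
        (\<exists>h\<in>mod_hom R B E. \<forall>x\<in>carrier A. h (f x) = g x))"

text \<open>
  For projectivity of \<open>P\<close>, with elements of type \<open>'p\<close>, the test epimorphisms \<open>A \<rightarrow> B\<close>
  include the canonical map onto \<open>P\<close> from the free module on the set \<open>P\<close>, whose elements
  have type \<open>'p \<Rightarrow> 'a\<close>. Lifting the identity of \<open>P\<close> along it makes \<open>P\<close> a direct summand
  of a free module, so lifts exist along all epimorphisms.
\<close>

definition projective_module :: "('a, 'c) ring_scheme \<Rightarrow> ('a, 'p) module \<Rightarrow> bool" where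
  "projective_module R P \<longleftrightarrow> module R P \<and>
     (\<forall>(A :: ('a, 'p \<Rightarrow> 'a) module) (B :: ('a, 'p) module).
        \<forall>f\<in>mod_hom R A B. \<forall>g\<in>mod_hom R P B.
        module R A \<and> module R B \<and> f ` carrier A = carrier B \<longrightarrow>
        (\<exists>h\<in>mod_hom R P A. \<forall>x\<in>carrier P. f (h x) = g x))"

text \<open>
  The complex is \<open>d n : F n \<rightarrow> F (n - 1)\<close> for \<open>n :: int\<close>. The type \<open>'f\<close> of the elements of
  its terms is a parameter, so that a theorem about \<open>gorenstein_flat TYPE('f) R T\<close> with
  \<open>'f\<close> a type variable covers complexes of any type. It is no restriction that all terms
  have elements of one type, as one can take a sum type.

  The test modules \<open>E\<close> have elements of type \<open>'a \<times> nat\<close>. Over a Noetherian ring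
  (the only case used) this amounts to all injective modules: each is a direct sum of
  injective hulls of \<open>R/\<pp>\<close> with \<open>\<pp>\<close> prime (Matlis), tensor products and exactness
  are compatible with direct sums, and the injective hull of \<open>R/\<pp>\<close> has a
  countable filtration by finite-dimensional vector spaces over the residue field at
  \<open>\<pp>\<close>, so it has at most \<open>max |R| \<aleph>\<^sub>0\<close> elements.
\<close>

definition gorenstein_flat ::
  "'f itself \<Rightarrow> ('a, 'c) ring_scheme \<Rightarrow> ('a, 't) module \<Rightarrow> bool" where
  "gorenstein_flat _ R T \<longleftrightarrow> module R T \<and>
     (\<exists>(F :: int \<Rightarrow> ('a, 'f) module) (d :: int \<Rightarrow> 'f \<Rightarrow> 'f).
        (\<forall>n. flat_module R (F n)) \<and>
        (\<forall>n. d n \<in> mod_hom R (F n) (F (n - 1))) \<and>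
        (\<forall>n. exact_at (F (n + 1)) (d (n + 1)) (F n) (d n) (F (n - 1))) \<and>
        (\<exists>\<theta>. \<theta> \<in> mod_iso R T ((F (- 1))\<lparr>carrier := d 0 ` carrier (F 0)\<rparr>)) \<and>
        (\<forall>E :: ('a, 'a \<times> nat) module. injective_module R E \<longrightarrow>
           (\<forall>n. exact_at (tensor R (F (n + 1)) E)
                   (tensor_map R (F (n + 1)) E (F n) E (d (n + 1)) id)
                 (tensor R (F n) E)
                   (tensor_map R (F n) E (F (n - 1)) E (d n) id)
                 (tensor R (F (n - 1)) E))))"


section \<open>Adic completion\<close>

definition inverse_limit ::
  "(nat \<Rightarrow> ('a, 'm) module) \<Rightarrow> (nat \<Rightarrow> 'm \<Rightarrow> 'm) \<Rightarrow> ('a, nat \<Rightarrow> 'm) module" where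
  "inverse_limit M p =
     \<lparr>carrier = {x. (\<forall>n. x n \<in> carrier (M n)) \<and> (\<forall>n. p n (x (Suc n)) = x n)},
      monoid.mult = undefined, one = undefined,
      zero = (\<lambda>n. \<zero>\<^bsub>M n\<^esub>), add = (\<lambda>x y n. x n \<oplus>\<^bsub>M n\<^esub> y n), smult = (\<lambda>r x n. r \<odot>\<^bsub>M n\<^esub> x n)\<rparr>"

abbreviation ideal_power :: "('a, 'c) ring_scheme \<Rightarrow> 'a set \<Rightarrow> nat \<Rightarrow> 'a set" where
  "ideal_power R I n \<equiv> I [^]\<^bsub>ideals_set R\<^esub> n"

definition mod_power :: "('a, 'c) ring_scheme \<Rightarrow> 'a set \<Rightarrow> nat \<Rightarrow> ('a, 'a set) module" where
  "mod_power R I n = quot_module (regular_module R) (ideal_power R I n)"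

text \<open>
  The transition maps are induced by \<open>R/I\<^sup>n\<^sup>+\<^sup>1 \<rightarrow> R/I\<^sup>n\<close>, which sends a coset \<open>Y\<close> to
  \<open>I\<^sup>n + Y\<close>.
\<close>

definition completion ::
  "('a, 'c) ring_scheme \<Rightarrow> 'a set \<Rightarrow> ('a, 'm) module
    \<Rightarrow> ('a, nat \<Rightarrow> ('a set \<times> 'm \<Rightarrow> 'a) set) module" where
  "completion R I M =
     inverse_limit (\<lambda>n. tensor R (mod_power R I n) M)
       (\<lambda>n. tensor_map R (mod_power R I (Suc n)) M (mod_power R I n) M
              (\<lambda>Y. ideal_power R I n <+>\<^bsub>R\<^esub> Y) id)"

definition completion_map ::
  "('a, 'c) ring_scheme \<Rightarrow> 'a set \<Rightarrow> ('a, 'm) module \<Rightarrow> ('a, 'n) module \<Rightarrow> ('m \<Rightarrow> 'n)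
    \<Rightarrow> (nat \<Rightarrow> ('a set \<times> 'm \<Rightarrow> 'a) set) \<Rightarrow> (nat \<Rightarrow> ('a set \<times> 'n \<Rightarrow> 'a) set)" where
  "completion_map R I M N f x =
     (\<lambda>n. tensor_map R (mod_power R I n) M (mod_power R I n) N id f (x n))"


section \<open>Local homology\<close>

text \<open>
  Complexes \<open>\<cdots> \<rightarrow> C 1 \<rightarrow> C 0 \<rightarrow> 0\<close> are indexed so that \<open>d n : C (n + 1) \<rightarrow> C n\<close>.
\<close>

definition cycles :: "(nat \<Rightarrow> ('a, 'm) module) \<Rightarrow> (nat \<Rightarrow> 'm \<Rightarrow> 'm) \<Rightarrow> nat \<Rightarrow> 'm set" where
  "cycles C d n = (case n of 0 \<Rightarrow> carrier (C 0) | Suc k \<Rightarrow> a_kernel (C (Suc k)) (C k) (d k))"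

definition homology ::
  "(nat \<Rightarrow> ('a, 'm) module) \<Rightarrow> (nat \<Rightarrow> 'm \<Rightarrow> 'm) \<Rightarrow> nat \<Rightarrow> ('a, 'm set) module" where
  "homology C d n =
     quot_module ((C n)\<lparr>carrier := cycles C d n\<rparr>) (d n ` carrier (C (Suc n)))"

definition projective_resolution ::
  "('a, 'c) ring_scheme \<Rightarrow> (nat \<Rightarrow> ('a, 'p) module) \<Rightarrow> (nat \<Rightarrow> 'p \<Rightarrow> 'p) \<Rightarrow> ('p \<Rightarrow> 'm)
    \<Rightarrow> ('a, 'm) module \<Rightarrow> bool" where
  "projective_resolution R P d \<epsilon> M \<longleftrightarrow> module R M \<and>
     (\<forall>n. projective_module R (P n)) \<and>
     (\<forall>n. d n \<in> mod_hom R (P (Suc n)) (P n)) \<and>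
     (\<forall>n. exact_at (P (Suc (Suc n))) (d (Suc n)) (P (Suc n)) (d n) (P n)) \<and>
     \<epsilon> \<in> mod_hom R (P 0) M \<and>
     exact_at (P (Suc 0)) (d 0) (P 0) \<epsilon> M \<and>
     \<epsilon> ` carrier (P 0) = carrier M"

text \<open>
  \<open>H\<^sub>i\<^sup>I(M)\<close>, computed from a projective resolution \<open>P\<close>, \<open>d\<close> of \<open>M\<close>.
\<close>

definition local_homology ::
  "('a, 'c) ring_scheme \<Rightarrow> 'a set \<Rightarrow> (nat \<Rightarrow> ('a, 'p) module) \<Rightarrow> (nat \<Rightarrow> 'p \<Rightarrow> 'p) \<Rightarrow> nat
    \<Rightarrow> ('a, (nat \<Rightarrow> ('a set \<times> 'p \<Rightarrow> 'a) set) set) module" where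
  "local_homology R I P d i =
     homology (\<lambda>n. completion R I (P n)) (\<lambda>n. completion_map R I (P (Suc n)) (P n) (d n)) i"

text \<open>
  \<open>\<xi>\<^sub>M : H\<^sub>0\<^sup>I(M) \<rightarrow> \<Lambda>\<^sup>I(M)\<close> induced by the augmentation \<open>\<epsilon> : P 0 \<rightarrow> M\<close>: the completion of
  \<open>\<epsilon>\<close> is constant on the elements of \<open>H\<^sub>0\<^sup>I(M)\<close>, which are cosets of the image of
  \<open>\<Lambda>\<^sup>I(P 1)\<close> in \<open>\<Lambda>\<^sup>I(P 0)\<close>.
\<close>

definition xi ::
  "('a, 'c) ring_scheme \<Rightarrow> 'a set \<Rightarrow> (nat \<Rightarrow> ('a, 'p) module) \<Rightarrow> ('p \<Rightarrow> 'm) \<Rightarrow> ('a, 'm) module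
    \<Rightarrow> (nat \<Rightarrow> ('a set \<times> 'p \<Rightarrow> 'a) set) set \<Rightarrow> (nat \<Rightarrow> ('a set \<times> 'm \<Rightarrow> 'a) set)" where
  "xi R I P \<epsilon> M Y = the_elem (completion_map R I (P 0) M \<epsilon> ` Y)"

end

theory Submission
  imports Defs
begin

text \<open>
  The right half of the complex \<open>F\<close> makes \<open>Q\<close> an iterated syzygy, of any length, of flat
  modules. So \<open>\<cdots> \<rightarrow> P\<^sub>1 \<rightarrow> P\<^sub>0 \<rightarrow> F\<^sub>-\<^sub>1 \<rightarrow> F\<^sub>-\<^sub>2 \<rightarrow> \<cdots>\<close>, spliced at \<open>Q\<close>, is an exact complex \<open>C\<close> of
  flat modules. For such a complex the homology of \<open>C/\<aa>\<^sup>n C\<close> is pro-zero: for every \<open>n\<close> there is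
  \<open>m \<ge> n\<close> such that \<open>d z \<in> \<aa>\<^sup>m C\<close> implies \<open>z \<in> d C + \<aa>\<^sup>n C\<close>. If \<open>\<aa> = (x\<^sub>1, \<dots>, x\<^sub>s)\<close>, the ideals
  \<open>(x\<^sub>1\<^sup>n, \<dots>, x\<^sub>s\<^sup>n)\<close> are cofinal with the powers of \<open>\<aa>\<close>, and the generators can be adjoined one at
  a time, starting from the exactness of \<open>C\<close>. To pass from a tower \<open>J\<^sub>n\<close> to \<open>J\<^sub>n + (x\<^sup>n)\<close>, write
  \<open>d z = u + x\<^sup>m w\<close> with \<open>u \<in> J\<^sub>m C\<close>. Then \<open>x\<^sup>m d w \<in> J\<^sub>m C\<close>, so \<open>d w \<in> (J\<^sub>p : x\<^sup>m) C\<close> by flatness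
  for \<open>p \<le> m\<close>. The ideals \<open>(J\<^sub>p : x\<^sup>m)\<close> stabilise as \<open>m\<close> grows, hence \<open>d (x\<^sup>m\<^sup>-\<^sup>n w) \<in> J\<^sub>p C\<close> and
  \<open>x\<^sup>m\<^sup>-\<^sup>n w = d v + t\<close> with \<open>t \<in> J\<^sub>q C\<close>. Now \<open>d (z - x\<^sup>n v) = u + x\<^sup>n t \<in> J\<^sub>q C\<close>, and the
  pro-vanishing for \<open>J\<close> applies to \<open>z - x\<^sup>n v\<close>.

  A Mittag-Leffler argument turns pro-vanishing in two consecutive degrees into exactness of
  the completed complex. In positive degrees of \<open>P\<close> this is (i), and at \<open>P\<^sub>0 \<rightarrow> F\<^sub>-\<^sub>1\<close> it is
  the injectivity of \<open>\<xi>\<close>. Surjectivity holds for every module.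
\<close>

section \<open>Homomorphisms and multiples by ideals\<close>

lemma (in abelian_group) diff_add_diff:
  assumes "x \<in> carrier G" "y \<in> carrier G" "z \<in> carrier G"
  shows "(x \<ominus> y) \<oplus> (y \<ominus> z) = x \<ominus> z"
  using assms by (simp add: a_minus_def a_assoc r_neg1)

lemma (in abelian_group) add_diff_cancel:
  assumes "x \<in> carrier G" "y \<in> carrier G"
  shows "x \<oplus> (y \<ominus> x) = y" and "(x \<oplus> y) \<ominus> x = y"
proof -
  have "x \<oplus> (y \<oplus> \<ominus> x) = y \<oplus> (x \<oplus> \<ominus> x)" using assms by (simp only: a_lcomm a_inv_closed)
  then show *: "x \<oplus> (y \<ominus> x) = y" using assms by (simp add: a_minus_def r_neg)
  then show "(x \<oplus> y) \<ominus> x = y" using assms by (simp add: a_minus_def a_assoc)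
qed

lemma (in abelian_group) diff_diff_diff:
  assumes "x \<in> carrier G" "y \<in> carrier G" "s \<in> carrier G" "w \<in> carrier G"
  shows "(x \<ominus> (s \<oplus> w)) \<ominus> (y \<ominus> s) = (x \<ominus> y) \<ominus> w"
proof -
  have "s \<oplus> (\<ominus> y \<oplus> (\<ominus> s \<oplus> \<ominus> w)) = \<ominus> y \<oplus> (s \<oplus> (\<ominus> s \<oplus> \<ominus> w))"
    using assms by (intro a_lcomm) auto
  also have "\<dots> = \<ominus> y \<oplus> \<ominus> w" using assms by (simp add: r_neg2)
  finally show ?thesis using assms by (simp add: a_minus_def minus_add a_ac)
qed

lemma (in abelian_group) diff_eq_zero_iff:
  assumes "x \<in> carrier G" and "y \<in> carrier G"
  shows "x \<ominus> y = \<zero> \<longleftrightarrow> x = y"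
proof
  assume "x \<ominus> y = \<zero>"
  then have "\<ominus> (\<ominus> y) = x" using assms by (intro minus_equality) (simp_all add: a_minus_def)
  then show "x = y" using assms by simp
qed (use assms in \<open>simp add: a_minus_def r_neg\<close>)

section \<open>Module homomorphisms\<close>

lemma mod_homD:
  assumes "f \<in> mod_hom R M N"
  shows "x \<in> carrier M \<Longrightarrow> f x \<in> carrier N"
    and "x \<in> carrier M \<Longrightarrow> y \<in> carrier M \<Longrightarrow> f (x \<oplus>\<^bsub>M\<^esub> y) = f x \<oplus>\<^bsub>N\<^esub> f y"
    and "r \<in> carrier R \<Longrightarrow> x \<in> carrier M \<Longrightarrow> f (r \<odot>\<^bsub>M\<^esub> x) = r \<odot>\<^bsub>N\<^esub> f x"
  using assms by (auto simp: mod_hom_def hom_def)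

lemma mod_homI:
  assumes "\<And>x. x \<in> carrier M \<Longrightarrow> f x \<in> carrier N"
    and "\<And>x y. x \<in> carrier M \<Longrightarrow> y \<in> carrier M \<Longrightarrow> f (x \<oplus>\<^bsub>M\<^esub> y) = f x \<oplus>\<^bsub>N\<^esub> f y"
    and "\<And>r x. r \<in> carrier R \<Longrightarrow> x \<in> carrier M \<Longrightarrow> f (r \<odot>\<^bsub>M\<^esub> x) = r \<odot>\<^bsub>N\<^esub> f x"
  shows "f \<in> mod_hom R M N"
  using assms by (auto simp: mod_hom_def hom_def)

lemma mod_hom_zero:
  assumes "f \<in> mod_hom R M N" and "module R M" and "module R N"
  shows "f \<zero>\<^bsub>M\<^esub> = \<zero>\<^bsub>N\<^esub>"
proof -
  interpret M: module R M by fact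
  interpret N: module R N by fact
  have "f \<zero>\<^bsub>M\<^esub> = f (\<zero>\<^bsub>R\<^esub> \<odot>\<^bsub>M\<^esub> \<zero>\<^bsub>M\<^esub>)" by simp
  also have "\<dots> = \<zero>\<^bsub>N\<^esub>"
    using mod_homD[OF assms(1)] M.M.zero_closed M.R.zero_closed N.smult_l_null by metis
  finally show ?thesis .
qed

lemma mod_hom_minus:
  assumes "f \<in> mod_hom R M N" and "module R M" and "module R N" and "x \<in> carrier M"
  shows "f (\<ominus>\<^bsub>M\<^esub> x) = \<ominus>\<^bsub>N\<^esub> f x"
proof -
  interpret M: module R M by fact
  interpret N: module R N by fact
  have "f (\<ominus>\<^bsub>M\<^esub> x) \<oplus>\<^bsub>N\<^esub> f x = f (\<ominus>\<^bsub>M\<^esub> x \<oplus>\<^bsub>M\<^esub> x)"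
    using mod_homD(2)[OF assms(1), of "\<ominus>\<^bsub>M\<^esub> x" x] assms(4) by simp
  also have "\<dots> = \<zero>\<^bsub>N\<^esub>"
    using assms(4) mod_hom_zero[OF assms(1-3)] by (simp add: M.M.l_neg)
  finally show ?thesis
    using mod_homD(1)[OF assms(1)] assms(4) N.M.minus_equality by simp
qed

lemma mod_hom_diff:
  assumes "f \<in> mod_hom R M N" and "module R M" and "module R N"
    and "x \<in> carrier M" and "y \<in> carrier M"
  shows "f (x \<ominus>\<^bsub>M\<^esub> y) = f x \<ominus>\<^bsub>N\<^esub> f y"
proof -
  interpret M: module R M by fact
  show ?thesis
    using assms mod_homD(2)[OF assms(1), of x "\<ominus>\<^bsub>M\<^esub> y"] mod_hom_minus[OF assms(1-3)]
    by (simp add: a_minus_def)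
qed

lemma mod_hom_comp:
  assumes "f \<in> mod_hom R L M" and "g \<in> mod_hom R M N"
  shows "(\<lambda>x. g (f x)) \<in> mod_hom R L N"
  using assms by (intro mod_homI) (simp_all add: mod_homD[OF assms(1)] mod_homD[OF assms(2)])

section \<open>The submodule of multiples by an ideal\<close>

text \<open>This is J M, the set of finite sums of multiples j c. Generating it from zero by adding
  one multiple at a time gives induction on the number of summands and avoids index sets; closure
  under addition then becomes a lemma.\<close>

inductive_set ideal_smult :: "'a set \<Rightarrow> ('a, 'm, 'z) module_scheme \<Rightarrow> 'm set"
  for J M where
    zero: "\<zero>\<^bsub>M\<^esub> \<in> ideal_smult J M"
  | add: "j \<in> J \<Longrightarrow> c \<in> carrier M \<Longrightarrow> x \<in> ideal_smult J M \<Longrightarrow> j \<odot>\<^bsub>M\<^esub> c \<oplus>\<^bsub>M\<^esub> x \<in> ideal_smult J M"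

lemma ideal_smult_mono:
  assumes "J \<subseteq> K" and "x \<in> ideal_smult J M"
  shows "x \<in> ideal_smult K M"
  using assms(2) by induction (use assms(1) in \<open>auto intro: ideal_smult.intros\<close>)

context module
begin

lemma ideal_smult_carrier:
  assumes "J \<subseteq> carrier R" and "x \<in> ideal_smult J M"
  shows "x \<in> carrier M"
  using assms(2) by induction (use assms(1) in auto)

lemma ideal_smult_sum:
  assumes J: "J \<subseteq> carrier R" and x: "x \<in> ideal_smult J M" and y: "y \<in> ideal_smult J M"
  shows "x \<oplus>\<^bsub>M\<^esub> y \<in> ideal_smult J M"
  using x
proof induction
  case zero
  then show ?case using y ideal_smult_carrier[OF J] by simp
next
  case (add j c x)
  moreover have "x \<in> carrier M" "y \<in> carrier M" using add y ideal_smult_carrier[OF J] by auto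
  moreover have "j \<in> carrier R" using add J by auto
  ultimately show ?case by (simp add: M.a_assoc ideal_smult.add)
qed

lemma smult_in_ideal_smult:
  assumes "J \<subseteq> carrier R" and "j \<in> J" and "c \<in> carrier M"
  shows "j \<odot>\<^bsub>M\<^esub> c \<in> ideal_smult J M"
  using ideal_smult.add[OF assms(2,3) ideal_smult.zero] assms by auto

text \<open>Two sets of scalars K and J are kept apart because the lemma serves both for K = J,
  where it gives a submodule, and for a colon ideal K = (J : x^m) that a power of x multiplies into
  J.\<close>

lemma smult_ideal_smult:
  assumes r: "r \<in> carrier R" and K: "K \<subseteq> carrier R" and J: "J \<subseteq> carrier R"
    and rK: "\<And>k. k \<in> K \<Longrightarrow> r \<otimes> k \<in> J" and x: "x \<in> ideal_smult K M"
  shows "r \<odot>\<^bsub>M\<^esub> x \<in> ideal_smult J M"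
  using x
proof induction
  case zero
  then show ?case using r ideal_smult.zero by auto
next
  case (add j c x)
  have "x \<in> carrier M" using add ideal_smult_carrier[OF K] by auto
  hence "r \<odot>\<^bsub>M\<^esub> (j \<odot>\<^bsub>M\<^esub> c \<oplus>\<^bsub>M\<^esub> x) = (r \<otimes> j) \<odot>\<^bsub>M\<^esub> c \<oplus>\<^bsub>M\<^esub> r \<odot>\<^bsub>M\<^esub> x"
    using add(1,2) r K by (auto simp: smult_r_distr smult_assoc1)
  then show ?case using add rK by (auto intro: ideal_smult.intros)
qed

lemma submodule_ideal_smult:
  assumes "ideal J R"
  shows "submodule (ideal_smult J M) R M"
proof -
  interpret J: ideal J R by fact
  have J: "J \<subseteq> carrier R" using J.a_subset .
  have sm: "r \<odot>\<^bsub>M\<^esub> x \<in> ideal_smult J M" if "r \<in> carrier R" "x \<in> ideal_smult J M" for r x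
    using smult_ideal_smult[OF that(1) J J _ that(2)] J.I_l_closed that(1) by blast
  show ?thesis
  proof (rule submoduleI)
    show "ideal_smult J M \<subseteq> carrier M" using ideal_smult_carrier[OF J] by blast
    show "\<zero>\<^bsub>M\<^esub> \<in> ideal_smult J M" by (rule ideal_smult.zero)
    fix a assume a: "a \<in> ideal_smult J M"
    have "(\<ominus> \<one>) \<odot>\<^bsub>M\<^esub> a = \<ominus>\<^bsub>M\<^esub> a"
      using ideal_smult_carrier[OF J a] by (simp add: smult_l_minus)
    then show "\<ominus>\<^bsub>M\<^esub> a \<in> ideal_smult J M" using sm[OF _ a, of "\<ominus> \<one>"] by simp
  qed (rule sm ideal_smult_sum[OF J]; assumption)+
qed

lemma ideal_smult_diff:
  assumes "ideal J R" and "x \<in> ideal_smult J M" and "y \<in> ideal_smult J M"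
  shows "x \<ominus>\<^bsub>M\<^esub> y \<in> ideal_smult J M"
  using submoduleE[OF submodule_ideal_smult[OF assms(1)]] assms(2,3)
  by (simp add: a_minus_def)

lemma ideal_smult_zero: "ideal_smult {\<zero>} M = {\<zero>\<^bsub>M\<^esub>}"
proof -
  have "x = \<zero>\<^bsub>M\<^esub>" if "x \<in> ideal_smult {\<zero>} M" for x
    using that by induction auto
  then show ?thesis by (auto intro: ideal_smult.intros)
qed

text \<open>Flatness enters the argument only through this consequence, \<open>J M : x = (J : x) M\<close>.\<close>

definition colon_compatible :: bool where
  "colon_compatible \<longleftrightarrow> (\<forall>J x w. ideal J R \<longrightarrow> x \<in> carrier R \<longrightarrow> w \<in> carrier M \<longrightarrow>
     x \<odot>\<^bsub>M\<^esub> w \<in> ideal_smult J M \<longrightarrow> w \<in> ideal_smult {r \<in> carrier R. r \<otimes> x \<in> J} M)"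

end

section \<open>Congruence modulo J M and its behaviour under homomorphisms\<close>

lemma (in module) ideal_smult_cong_trans:
  assumes "J \<subseteq> carrier R" and "x \<in> carrier M" "y \<in> carrier M" "z \<in> carrier M"
    and "x \<ominus>\<^bsub>M\<^esub> y \<in> ideal_smult J M" and "y \<ominus>\<^bsub>M\<^esub> z \<in> ideal_smult J M"
  shows "x \<ominus>\<^bsub>M\<^esub> z \<in> ideal_smult J M"
  using ideal_smult_sum[OF assms(1) assms(5,6)] M.diff_add_diff[OF assms(2-4)] by simp

lemma (in module) ideal_smult_cong_sym:
  assumes "ideal J R" and "x \<in> carrier M" "y \<in> carrier M"
    and "x \<ominus>\<^bsub>M\<^esub> y \<in> ideal_smult J M"
  shows "y \<ominus>\<^bsub>M\<^esub> x \<in> ideal_smult J M"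
proof -
  have "\<ominus>\<^bsub>M\<^esub> (x \<ominus>\<^bsub>M\<^esub> y) = y \<ominus>\<^bsub>M\<^esub> x"
    using assms(2,3) by (simp add: a_minus_def M.minus_add M.a_comm)
  then show ?thesis
    using submoduleE(3)[OF submodule_ideal_smult[OF assms(1)] assms(4)] by simp
qed

lemma mod_hom_ideal_smult:
  assumes f: "f \<in> mod_hom R M N" and "module R M" and "module R N" and J: "J \<subseteq> carrier R"
    and x: "x \<in> ideal_smult J M"
  shows "f x \<in> ideal_smult J N"
  using x
proof induction
  case zero
  show ?case unfolding mod_hom_zero[OF f assms(2,3)] by (rule ideal_smult.zero)
next
  case (add j c x)
  interpret M: module R M by fact
  have "x \<in> carrier M" using M.ideal_smult_carrier[OF J] add by auto
  then show ?case
    using add subsetD[OF J add(1)] by (simp add: mod_homD[OF f] ideal_smult.add)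
qed

text \<open>In a sum of multiples j c the scalars are kept and the vectors c are lifted one by one.
  This is what later makes the completion of a surjection surjective.\<close>

lemma mod_hom_ideal_smult_lift:
  assumes f: "f \<in> mod_hom R M N" and "module R M" and "module R N" and J: "J \<subseteq> carrier R"
    and surj: "f ` carrier M = carrier N" and y: "y \<in> ideal_smult J N"
  shows "\<exists>x\<in>ideal_smult J M. f x = y"
  using y
proof induction
  case zero
  show ?case using mod_hom_zero[OF f assms(2,3)] ideal_smult.zero by blast
next
  case (add j c y)
  interpret M: module R M by fact
  obtain x where x: "x \<in> ideal_smult J M" "f x = y" using add by blast
  obtain b where b: "b \<in> carrier M" "f b = c" using add(2) unfolding surj[symmetric] by auto
  have "x \<in> carrier M" using M.ideal_smult_carrier[OF J] x by auto
  then have "f (j \<odot>\<^bsub>M\<^esub> b \<oplus>\<^bsub>M\<^esub> x) = j \<odot>\<^bsub>N\<^esub> c \<oplus>\<^bsub>N\<^esub> y"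
    using subsetD[OF J add(1)] b x by (simp add: mod_homD[OF f])
  then show ?case by (rule bexI) (rule ideal_smult.add[OF add(1) b(1) x(1)])
qed

section \<open>Pro-exactness along towers of ideals\<close>

lemma (in cring) colon_ideal:
  assumes "ideal J R" and a: "a \<in> carrier R"
  shows "ideal {r \<in> carrier R. r \<otimes> a \<in> J} R"
proof -
  interpret J: ideal J R by fact
  show ?thesis
  proof (rule idealI[OF ring_axioms])
    show "subgroup {r \<in> carrier R. r \<otimes> a \<in> J} (add_monoid R)"
    proof (rule add.subgroupI)
      show "{r \<in> carrier R. r \<otimes> a \<in> J} \<noteq> {}" using a by (auto intro!: exI[of _ \<zero>])
      fix r assume "r \<in> {r \<in> carrier R. r \<otimes> a \<in> J}"
      then show "\<ominus> r \<in> {r \<in> carrier R. r \<otimes> a \<in> J}" using a by (simp add: l_minus)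
    qed (use a in \<open>auto simp: l_distr\<close>)
  next
    fix r x assume r: "r \<in> {r \<in> carrier R. r \<otimes> a \<in> J}" and x: "x \<in> carrier R"
    then have "x \<otimes> r \<otimes> a \<in> J" using a J.I_l_closed[of "r \<otimes> a" x] by (simp add: m_assoc)
    then show "x \<otimes> r \<in> {r \<in> carrier R. r \<otimes> a \<in> J}"
      and "r \<otimes> x \<in> {r \<in> carrier R. r \<otimes> a \<in> J}"
      using r x by (auto simp: m_comm)
  qed
qed

text \<open>The ideals (J : x^k) ascend with k, and in a Noetherian ring the ascending chain ends at
  some exponent c.\<close>

lemma colon_power_stable:
  assumes "cring R" and "noetherian_ring R" and J: "ideal J R" and x: "x \<in> carrier R"
  obtains c :: nat where
    "\<And>k r. r \<in> carrier R \<Longrightarrow> r \<otimes>\<^bsub>R\<^esub> x [^]\<^bsub>R\<^esub> (k::nat) \<in> J \<Longrightarrow> r \<otimes>\<^bsub>R\<^esub> x [^]\<^bsub>R\<^esub> c \<in> J"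
proof -
  interpret cring R by fact
  interpret J: ideal J R by fact
  define K where "K k = {r \<in> carrier R. r \<otimes>\<^bsub>R\<^esub> x [^]\<^bsub>R\<^esub> k \<in> J}" for k :: nat
  have step: "K k \<subseteq> K (Suc k)" for k
  proof
    fix r assume r: "r \<in> K k"
    then have "r \<otimes>\<^bsub>R\<^esub> x [^]\<^bsub>R\<^esub> k \<otimes>\<^bsub>R\<^esub> x \<in> J" using J.I_r_closed x unfolding K_def by blast
    then show "r \<in> K (Suc k)" using r x unfolding K_def by (simp add: m_assoc)
  qed
  have mono: "K i \<subseteq> K j" if "i \<le> j" for i j
    using lift_Suc_mono_le[of K, OF step that] .
  \<comment> \<open>The Noetherian property is used in the form that a nonempty chain of ideals
    contains its own union.\<close>
  have "subset.chain {I. ideal I R} (range K)"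
    unfolding subset_chain_def
  proof (intro conjI ballI)
    show "range K \<subseteq> {I. ideal I R}"
      using colon_ideal[OF J] x unfolding K_def by auto
    fix A B assume "A \<in> range K" "B \<in> range K"
    then obtain i j where "A = K i" "B = K j" by auto
    then show "A \<subseteq> B \<or> B \<subseteq> A" using mono[of i j] mono[of j i] by (metis nle_le)
  qed
  then obtain c where c: "\<Union>(range K) = K c"
    using noetherian_ring.ideal_chain_is_trivial[OF assms(2), of "range K"] by auto
  show ?thesis
  proof
    fix k :: nat and r
    assume "r \<in> carrier R" "r \<otimes>\<^bsub>R\<^esub> x [^]\<^bsub>R\<^esub> k \<in> J"
    then have "r \<in> K k" unfolding K_def by simp
    then have "r \<in> K c" using c by blast
    then show "r \<otimes>\<^bsub>R\<^esub> x [^]\<^bsub>R\<^esub> c \<in> J" unfolding K_def by simp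
  qed
qed

section \<open>Pro-vanishing of homology and change of tower\<close>

text \<open>For a complex \<open>L \<rightarrow> M \<rightarrow> N\<close>: the inverse system of the homology groups of
  \<open>L/J\<^sub>n L \<rightarrow> M/J\<^sub>n M \<rightarrow> N/J\<^sub>n N\<close> is pro-zero.\<close>

definition pro_exact ::
  "(nat \<Rightarrow> 'a set) \<Rightarrow> ('a, 'l) module \<Rightarrow> ('l \<Rightarrow> 'm) \<Rightarrow> ('a, 'm) module \<Rightarrow> ('m \<Rightarrow> 'n)
    \<Rightarrow> ('a, 'n) module \<Rightarrow> bool" where
  "pro_exact J L f M g N \<longleftrightarrow> (\<forall>n. \<exists>m\<ge>n. \<forall>z\<in>carrier M. g z \<in> ideal_smult (J m) N \<longrightarrow>
     (\<exists>v\<in>carrier L. z \<ominus>\<^bsub>M\<^esub> f v \<in> ideal_smult (J n) M))"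

lemma pro_exactE:
  assumes "pro_exact J L f M g N"
  obtains m where "m \<ge> n"
    and "\<And>z. z \<in> carrier M \<Longrightarrow> g z \<in> ideal_smult (J m) N \<Longrightarrow>
      \<exists>v\<in>carrier L. z \<ominus>\<^bsub>M\<^esub> f v \<in> ideal_smult (J n) M"
  using assms unfolding pro_exact_def by blast

text \<open>A level of J inside \<open>K n\<close> sharpens the approximation that is asked for, and
  a level of K inside \<open>J m\<close> weakens the hypothesis on z. The bound k \<ge> n matches
  the m \<ge> n in \<open>pro_exact\<close>.\<close>

lemma pro_exact_cofinal:
  assumes "pro_exact J L f M g N"
    and "\<And>n. \<exists>m. J m \<subseteq> K n" and "\<And>m n. \<exists>k\<ge>n. K k \<subseteq> J m"
  shows "pro_exact K L f M g N"
  unfolding pro_exact_def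
proof
  fix n
  obtain a where a: "J a \<subseteq> K n" using assms(2) by blast
  obtain b where b: "\<And>z. z \<in> carrier M \<Longrightarrow> g z \<in> ideal_smult (J b) N \<Longrightarrow>
      \<exists>v\<in>carrier L. z \<ominus>\<^bsub>M\<^esub> f v \<in> ideal_smult (J a) M"
    using pro_exactE[OF assms(1), of a] by metis
  obtain c where c: "c \<ge> n" "K c \<subseteq> J b" using assms(3) by blast
  have "\<exists>v\<in>carrier L. z \<ominus>\<^bsub>M\<^esub> f v \<in> ideal_smult (K n) M"
    if "z \<in> carrier M" "g z \<in> ideal_smult (K c) N" for z
    using b[OF that(1) ideal_smult_mono[OF c(2) that(2)]]
    by (metis ideal_smult_mono[OF a])
  then show "\<exists>m\<ge>n. \<forall>z\<in>carrier M. g z \<in> ideal_smult (K m) N \<longrightarrow>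
     (\<exists>v\<in>carrier L. z \<ominus>\<^bsub>M\<^esub> f v \<in> ideal_smult (K n) M)"
    using c(1) by blast
qed

section \<open>Towers of ideals and the adjunction of a generator\<close>

definition ideal_tower :: "('a, 'c) ring_scheme \<Rightarrow> (nat \<Rightarrow> 'a set) \<Rightarrow> bool" where
  "ideal_tower R J \<longleftrightarrow> (\<forall>n. ideal (J n) R) \<and> (\<forall>m n. m \<le> n \<longrightarrow> J n \<subseteq> J m)"

lemma ideal_towerD:
  assumes "ideal_tower R K"
  shows "ideal (K n) R" and "K n \<subseteq> carrier R" and "m \<le> n \<Longrightarrow> K n \<subseteq> K m"
  using assms additive_subgroup.a_subset[OF ideal.axioms(1), of "K n" R]
  unfolding ideal_tower_def by blast+

definition add_power ::
  "('a, 'c) ring_scheme \<Rightarrow> 'a \<Rightarrow> (nat \<Rightarrow> 'a set) \<Rightarrow> nat \<Rightarrow> 'a set" where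
  "add_power R x J n = J n <+>\<^bsub>R\<^esub> PIdl\<^bsub>R\<^esub> (x [^]\<^bsub>R\<^esub> n)"

lemma mem_add_power:
  "k \<in> add_power R x J n \<longleftrightarrow> (\<exists>u\<in>J n. \<exists>r\<in>carrier R. k = u \<oplus>\<^bsub>R\<^esub> r \<otimes>\<^bsub>R\<^esub> x [^]\<^bsub>R\<^esub> n)"
  unfolding add_power_def set_add_def' cgenideal_def by auto

lemma subset_add_power:
  assumes "cring R" and "x \<in> carrier R" and "J n \<subseteq> carrier R"
  shows "J n \<subseteq> add_power R x J n"
proof
  interpret cring R by fact
  fix j assume j: "j \<in> J n"
  then have "j = j \<oplus>\<^bsub>R\<^esub> \<zero>\<^bsub>R\<^esub> \<otimes>\<^bsub>R\<^esub> x [^]\<^bsub>R\<^esub> n" using assms by auto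
  then show "j \<in> add_power R x J n" unfolding mem_add_power using j by blast
qed

lemma nat_pow_in_add_power:
  assumes "cring R" and "x \<in> carrier R" and "ideal (J n) R"
  shows "x [^]\<^bsub>R\<^esub> n \<in> add_power R x J n"
proof -
  interpret cring R by fact
  have "x [^]\<^bsub>R\<^esub> n = \<zero>\<^bsub>R\<^esub> \<oplus>\<^bsub>R\<^esub> \<one>\<^bsub>R\<^esub> \<otimes>\<^bsub>R\<^esub> x [^]\<^bsub>R\<^esub> n" using assms(2) by simp
  moreover have "\<zero>\<^bsub>R\<^esub> \<in> J n"
    using additive_subgroup.zero_closed[OF ideal.axioms(1)[OF assms(3)]] .
  ultimately show ?thesis unfolding mem_add_power using one_closed by blast
qed

lemma ideal_tower_add_power:
  assumes "cring R" and J: "ideal_tower R J" and x: "x \<in> carrier R"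
  shows "ideal_tower R (add_power R x J)"
proof -
  interpret cring R by fact
  have "add_power R x J n \<subseteq> add_power R x J m" if "m \<le> n" for m n
  proof
    fix k assume "k \<in> add_power R x J n"
    then obtain u r where u: "u \<in> J n" and r: "r \<in> carrier R"
      and k: "k = u \<oplus>\<^bsub>R\<^esub> r \<otimes>\<^bsub>R\<^esub> x [^]\<^bsub>R\<^esub> n" unfolding mem_add_power by auto
    have "x [^]\<^bsub>R\<^esub> n = x [^]\<^bsub>R\<^esub> (n - m) \<otimes>\<^bsub>R\<^esub> x [^]\<^bsub>R\<^esub> m"
      using x that by (simp add: nat_pow_mult)
    then have "k = u \<oplus>\<^bsub>R\<^esub> (r \<otimes>\<^bsub>R\<^esub> x [^]\<^bsub>R\<^esub> (n - m)) \<otimes>\<^bsub>R\<^esub> x [^]\<^bsub>R\<^esub> m"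
      using r x k by (simp add: m_assoc)
    moreover have "u \<in> J m" using J u that unfolding ideal_tower_def by blast
    ultimately show "k \<in> add_power R x J m" using r x unfolding mem_add_power by blast
  qed
  moreover have "ideal (add_power R x J n) R" for n
    unfolding add_power_def using J x
    by (intro add_ideals cgenideal_ideal) (auto simp: ideal_tower_def)
  ultimately show ?thesis unfolding ideal_tower_def by blast
qed

text \<open>The adjoined ideal is principal, so all multiples of x^n in a sum can be collected into
  a single one. This provides the decomposition d z = u + x^m w.\<close>

lemma (in module) ideal_smult_add_power:
  assumes J: "J n \<subseteq> carrier R" and x: "x \<in> carrier R"
    and y: "y \<in> ideal_smult (add_power R x J n) M"
  shows "\<exists>u\<in>ideal_smult (J n) M. \<exists>w\<in>carrier M. y = u \<oplus>\<^bsub>M\<^esub> x [^] n \<odot>\<^bsub>M\<^esub> w"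
  using y
proof induction
  case zero
  show ?case
    using x by (intro bexI[of _ "\<zero>\<^bsub>M\<^esub>"] ideal_smult.zero) auto
next
  case (add j c y)
  obtain u w where u: "u \<in> ideal_smult (J n) M" and w: "w \<in> carrier M"
    and y: "y = u \<oplus>\<^bsub>M\<^esub> x [^] n \<odot>\<^bsub>M\<^esub> w" using add.IH by auto
  obtain v r where v: "v \<in> J n" and r: "r \<in> carrier R" and j: "j = v \<oplus> r \<otimes> x [^] n"
    using add(1) unfolding mem_add_power by auto
  have v': "v \<in> carrier R" using v J by blast
  have u': "u \<in> carrier M" using ideal_smult_carrier[OF J u] .
  have "(r \<otimes> x [^] n) \<odot>\<^bsub>M\<^esub> c = x [^] n \<odot>\<^bsub>M\<^esub> (r \<odot>\<^bsub>M\<^esub> c)"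
    using r x add(2) by (simp add: smult_assoc1[symmetric] R.m_comm)
  then have "j \<odot>\<^bsub>M\<^esub> c = v \<odot>\<^bsub>M\<^esub> c \<oplus>\<^bsub>M\<^esub> x [^] n \<odot>\<^bsub>M\<^esub> (r \<odot>\<^bsub>M\<^esub> c)"
    unfolding j using v' r x add(2) by (simp add: smult_l_distr)
  then have "j \<odot>\<^bsub>M\<^esub> c \<oplus>\<^bsub>M\<^esub> y
    = (v \<odot>\<^bsub>M\<^esub> c \<oplus>\<^bsub>M\<^esub> u) \<oplus>\<^bsub>M\<^esub> x [^] n \<odot>\<^bsub>M\<^esub> (r \<odot>\<^bsub>M\<^esub> c \<oplus>\<^bsub>M\<^esub> w)"
    unfolding y using v' u' r w x add(2) by (simp add: smult_r_distr M.a_ac)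
  moreover have "v \<odot>\<^bsub>M\<^esub> c \<oplus>\<^bsub>M\<^esub> u \<in> ideal_smult (J n) M"
    by (rule ideal_smult.add[OF v add(2) u])
  ultimately show ?case using r w add(2) by blast
qed

text \<open>The step that adjoins one generator. Pro-exactness for J enters at \<open>C2\<close> and
  at \<open>C1\<close>, while the conclusion concerns \<open>C2\<close> only: each generator draws
  on one more degree to the right. Colon compatibility is asked of \<open>C0\<close>, where h w
  lives.\<close>

lemma pro_exact_add_power:
  assumes R: "cring R" "noetherian_ring R"
    and mods: "module R C3" "module R C2" "module R C1" "module R C0"
    and f: "f \<in> mod_hom R C3 C2" and g: "g \<in> mod_hom R C2 C1" and h: "h \<in> mod_hom R C1 C0"
    and hg: "\<And>z. z \<in> carrier C2 \<Longrightarrow> h (g z) = \<zero>\<^bsub>C0\<^esub>"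
    and colon: "module.colon_compatible R C0"
    and J: "ideal_tower R J" and x: "x \<in> carrier R"
    and ex2: "pro_exact J C3 f C2 g C1" and ex1: "pro_exact J C2 g C1 h C0"
  shows "pro_exact (add_power R x J) C3 f C2 g C1"
  unfolding pro_exact_def
proof
  fix n
  interpret R: cring R by fact
  interpret C3: module R C3 by fact
  interpret C2: module R C2 by fact
  interpret C1: module R C1 by fact
  interpret C0: module R C0 by fact
  note J_ideal = ideal_towerD(1)[OF J] and JR = ideal_towerD(2)[OF J] and J_dec = ideal_towerD(3)[OF J]
  \<comment> \<open>The levels are chosen backwards: q serves level n at \<open>C2\<close>, p serves
    level q at \<open>C1\<close>, and c is an exponent at which the ideals (J_p : x^k) have become
    stable.\<close>
  obtain q where q: "q \<ge> n" "\<And>z. z \<in> carrier C2 \<Longrightarrow> g z \<in> ideal_smult (J q) C1 \<Longrightarrow>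
      \<exists>v\<in>carrier C3. z \<ominus>\<^bsub>C2\<^esub> f v \<in> ideal_smult (J n) C2"
    using pro_exactE[OF ex2, of n] by blast
  obtain p where p: "p \<ge> q" "\<And>z. z \<in> carrier C1 \<Longrightarrow> h z \<in> ideal_smult (J p) C0 \<Longrightarrow>
      \<exists>v\<in>carrier C2. z \<ominus>\<^bsub>C1\<^esub> g v \<in> ideal_smult (J q) C1"
    using pro_exactE[OF ex1, of q] by blast
  obtain c where c: "\<And>k r. r \<in> carrier R \<Longrightarrow> r \<otimes>\<^bsub>R\<^esub> x [^]\<^bsub>R\<^esub> (k::nat) \<in> J p \<Longrightarrow>
      r \<otimes>\<^bsub>R\<^esub> x [^]\<^bsub>R\<^esub> (c::nat) \<in> J p"
    using colon_power_stable[OF R J_ideal x] by blast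
  \<comment> \<open>With m \<ge> p the term u, and hence h u, lies in level p. With m - n \<ge> c
    the ideal (J_p : x^m) is contained in (J_p : x^(m - n)).\<close>
  define m where "m = max p (n + c)"
  have m: "m \<ge> n" "m \<ge> q" "m \<ge> p" "m - n \<ge> c" using p(1) q(1) unfolding m_def by auto
  have "\<exists>v\<in>carrier C3. z \<ominus>\<^bsub>C2\<^esub> f v \<in> ideal_smult (add_power R x J n) C2"
    if z: "z \<in> carrier C2" and gz: "g z \<in> ideal_smult (add_power R x J m) C1" for z
  proof -
    have xm [simp]: "x [^]\<^bsub>R\<^esub> k \<in> carrier R" for k :: nat using x by simp
    obtain u w where u: "u \<in> ideal_smult (J m) C1" and w: "w \<in> carrier C1"
      and dz: "g z = u \<oplus>\<^bsub>C1\<^esub> x [^]\<^bsub>R\<^esub> m \<odot>\<^bsub>C1\<^esub> w"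
      using C1.ideal_smult_add_power[of J, OF JR x gz] by blast
    have u': "u \<in> carrier C1" using C1.ideal_smult_carrier[OF JR u] .
    have hu: "h u \<in> ideal_smult (J p) C0"
      by (rule ideal_smult_mono[OF J_dec[OF m(3)] mod_hom_ideal_smult[OF h mods(3,4) JR u]])
    have hu': "h u \<in> carrier C0" and hw: "h w \<in> carrier C0"
      using u' w by (simp_all add: mod_homD[OF h])
    have "h u \<oplus>\<^bsub>C0\<^esub> x [^]\<^bsub>R\<^esub> m \<odot>\<^bsub>C0\<^esub> h w = \<zero>\<^bsub>C0\<^esub>"
      using hg[OF z] u' w unfolding dz by (simp add: mod_homD[OF h])
    then have "x [^]\<^bsub>R\<^esub> m \<odot>\<^bsub>C0\<^esub> h w = \<zero>\<^bsub>C0\<^esub> \<ominus>\<^bsub>C0\<^esub> h u"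
      using hu' hw by (metis C0.M.add.inv_closed C0.M.add.m_comm C0.M.l_zero C0.M.minus_equality
          C0.smult_closed a_minus_def xm)
    then have "x [^]\<^bsub>R\<^esub> m \<odot>\<^bsub>C0\<^esub> h w \<in> ideal_smult (J p) C0"
      using C0.ideal_smult_diff[OF J_ideal ideal_smult.zero hu] by simp
    then have "h w \<in> ideal_smult {r \<in> carrier R. r \<otimes>\<^bsub>R\<^esub> x [^]\<^bsub>R\<^esub> m \<in> J p} C0"
      using colon J_ideal xm hw unfolding C0.colon_compatible_def by blast
    \<comment> \<open>Stability of the colon ideals lowers the exponent from m to m - n. The n
      factors x gained here put the later correction of z into the new level n.\<close>
    then have "x [^]\<^bsub>R\<^esub> (m - n) \<odot>\<^bsub>C0\<^esub> h w \<in> ideal_smult (J p) C0"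
    proof (rule C0.smult_ideal_smult[OF xm _ JR, rotated -1])
      fix r assume "r \<in> {r \<in> carrier R. r \<otimes>\<^bsub>R\<^esub> x [^]\<^bsub>R\<^esub> m \<in> J p}"
      then have r: "r \<in> carrier R" and "r \<otimes>\<^bsub>R\<^esub> x [^]\<^bsub>R\<^esub> c \<in> J p" using c by auto
      then have "x [^]\<^bsub>R\<^esub> (m - n - c) \<otimes>\<^bsub>R\<^esub> (r \<otimes>\<^bsub>R\<^esub> x [^]\<^bsub>R\<^esub> c) \<in> J p"
        using ideal.I_l_closed[OF J_ideal _ xm] by blast
      moreover have "x [^]\<^bsub>R\<^esub> (m - n) = x [^]\<^bsub>R\<^esub> (m - n - c) \<otimes>\<^bsub>R\<^esub> x [^]\<^bsub>R\<^esub> c"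
        using m(4) x by (simp add: R.nat_pow_mult del: diff_diff_left)
      ultimately show "x [^]\<^bsub>R\<^esub> (m - n) \<otimes>\<^bsub>R\<^esub> r \<in> J p"
        using r by (simp add: R.m_ac)
    qed auto
    then have "h (x [^]\<^bsub>R\<^esub> (m - n) \<odot>\<^bsub>C1\<^esub> w) \<in> ideal_smult (J p) C0"
      using w by (simp add: mod_homD[OF h])
    then obtain v where v: "v \<in> carrier C2"
      and t: "x [^]\<^bsub>R\<^esub> (m - n) \<odot>\<^bsub>C1\<^esub> w \<ominus>\<^bsub>C1\<^esub> g v \<in> ideal_smult (J q) C1" (is "?t \<in> _")
      using p(2)[of "x [^]\<^bsub>R\<^esub> (m - n) \<odot>\<^bsub>C1\<^esub> w"] w by auto
    have gv: "g v \<in> carrier C1" using v by (simp add: mod_homD[OF g])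
    \<comment> \<open>The correction x^n v lies in the new level n of \<open>C2\<close>, so it can
      be absorbed at the end. In the image under g it replaces x^m w by x^n times \<open>?t\<close>,
      which lies in level q of the old tower.\<close>
    define z' where "z' = z \<ominus>\<^bsub>C2\<^esub> x [^]\<^bsub>R\<^esub> n \<odot>\<^bsub>C2\<^esub> v"
    have z': "z' \<in> carrier C2" unfolding z'_def using z v by simp
    have "x [^]\<^bsub>R\<^esub> m \<odot>\<^bsub>C1\<^esub> w = x [^]\<^bsub>R\<^esub> n \<odot>\<^bsub>C1\<^esub> (x [^]\<^bsub>R\<^esub> (m - n) \<odot>\<^bsub>C1\<^esub> w)"
      using w x m(1) by (simp add: C1.smult_assoc1[symmetric] R.nat_pow_mult)
    then have "x [^]\<^bsub>R\<^esub> m \<odot>\<^bsub>C1\<^esub> w \<ominus>\<^bsub>C1\<^esub> x [^]\<^bsub>R\<^esub> n \<odot>\<^bsub>C1\<^esub> g v = x [^]\<^bsub>R\<^esub> n \<odot>\<^bsub>C1\<^esub> ?t"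
      using w gv by (simp add: a_minus_def C1.smult_r_distr C1.smult_r_minus)
    moreover have "g z' = u \<oplus>\<^bsub>C1\<^esub> (x [^]\<^bsub>R\<^esub> m \<odot>\<^bsub>C1\<^esub> w \<ominus>\<^bsub>C1\<^esub> x [^]\<^bsub>R\<^esub> n \<odot>\<^bsub>C1\<^esub> g v)"
      unfolding z'_def using z v u' w gv dz
      by (simp add: mod_hom_minus[OF g mods(2,3)] mod_homD[OF g] a_minus_def C1.M.a_assoc)
    moreover have "u \<in> ideal_smult (J q) C1" using ideal_smult_mono[OF J_dec[OF m(2)] u] .
    moreover have "x [^]\<^bsub>R\<^esub> n \<odot>\<^bsub>C1\<^esub> ?t \<in> ideal_smult (J q) C1"
      using C1.submoduleE(4)[OF C1.submodule_ideal_smult[OF J_ideal] xm t] .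
    ultimately have "g z' \<in> ideal_smult (J q) C1"
      using C1.ideal_smult_sum[OF JR] by simp
    then obtain v' where v': "v' \<in> carrier C3" "z' \<ominus>\<^bsub>C2\<^esub> f v' \<in> ideal_smult (J n) C2"
      using q(2)[OF z'] by blast
    have fv': "f v' \<in> carrier C2" using v' by (simp add: mod_homD[OF f])
    have tR: "add_power R x J n \<subseteq> carrier R"
      by (rule ideal_towerD(2)[OF ideal_tower_add_power[OF R(1) J x]])
    have "x [^]\<^bsub>R\<^esub> n \<in> add_power R x J n" by (rule nat_pow_in_add_power[OF R(1) x J_ideal])
    then have "x [^]\<^bsub>R\<^esub> n \<odot>\<^bsub>C2\<^esub> v \<in> ideal_smult (add_power R x J n) C2"
      using C2.smult_in_ideal_smult[OF tR _ v] by blast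
    then have "x [^]\<^bsub>R\<^esub> n \<odot>\<^bsub>C2\<^esub> v \<oplus>\<^bsub>C2\<^esub> (z' \<ominus>\<^bsub>C2\<^esub> f v') \<in> ideal_smult (add_power R x J n) C2"
      using C2.ideal_smult_sum[OF tR] ideal_smult_mono[OF subset_add_power[of R x J n, OF R(1) x JR] v'(2)] by blast
    moreover have "x [^]\<^bsub>R\<^esub> n \<odot>\<^bsub>C2\<^esub> v \<oplus>\<^bsub>C2\<^esub> (z' \<ominus>\<^bsub>C2\<^esub> f v') = z \<ominus>\<^bsub>C2\<^esub> f v'"
    proof -
      have "x [^]\<^bsub>R\<^esub> n \<odot>\<^bsub>C2\<^esub> v \<oplus>\<^bsub>C2\<^esub> z' = z"
        unfolding z'_def using z v by (simp add: a_minus_def C2.M.a_ac C2.M.r_neg)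
      then show ?thesis using z' fv' v z by (simp add: a_minus_def C2.M.a_assoc[symmetric])
    qed
    ultimately show ?thesis using v'(1) by auto
  qed
  then show "\<exists>m\<ge>n. \<forall>z\<in>carrier C2. g z \<in> ideal_smult (add_power R x J m) C1 \<longrightarrow>
     (\<exists>v\<in>carrier C3. z \<ominus>\<^bsub>C2\<^esub> f v \<in> ideal_smult (add_power R x J n) C2)"
    using m(1) by blast
qed

section \<open>Cofinality of the powers of an ideal with the ideals generated by powers\<close>

context cring
begin

lemma ideals_set_simps [simp]:
  "\<one>\<^bsub>ideals_set R\<^esub> = carrier R"
  "I \<otimes>\<^bsub>ideals_set R\<^esub> J = I \<cdot> J"
  by (simp_all add: ideals_set_def)

lemma ideal_power_Suc: "ideal_power R I (Suc n) = ideal_power R I n \<cdot> I"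
  by simp

lemma ideal_ideal_power:
  assumes "ideal I R"
  shows "ideal (ideal_power R I n) R"
  by (induction n) (simp_all add: oneideal ideal_power_Suc ideal_prod_is_ideal assms)

lemma ideal_power_decreasing:
  assumes "ideal I R" and "m \<le> n"
  shows "ideal_power R I n \<subseteq> ideal_power R I m"
  using assms(2)
proof (induction rule: dec_induct)
  case (step n)
  then show ?case
    using ideal_prod_inter[OF ideal_ideal_power[OF assms(1)] assms(1), of n]
    unfolding ideal_power_Suc by blast
qed simp

lemma nat_pow_in_ideal_power:
  assumes "ideal I R" and "x \<in> I"
  shows "x [^] n \<in> ideal_power R I n"
proof (induction n)
  case (Suc n)
  then show ?case
    using assms(2) by (simp add: ideal_power_Suc ideal_prod.prod)
qed simp

text \<open>For ideals I and K this is the colon ideal (K : I^k), unfolded one factor at a time so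
  that membership can be proved by induction on k without handling products of k elements.\<close>

primrec iterated_colon :: "'a set \<Rightarrow> 'a set \<Rightarrow> nat \<Rightarrow> 'a set" where
  "iterated_colon I K 0 = K"
| "iterated_colon I K (Suc k) = {e \<in> carrier R. \<forall>a\<in>I. a \<otimes> e \<in> iterated_colon I K k}"

lemma ideal_iterated_colon:
  assumes I: "ideal I R" and K: "ideal K R"
  shows "ideal (iterated_colon I K k) R"
proof (induction k)
  case (Suc k)
  have eq: "{e \<in> carrier R. \<forall>a\<in>I. a \<otimes> e \<in> iterated_colon I K k}
    = carrier R \<inter> (\<Inter>a\<in>I. {e \<in> carrier R. e \<otimes> a \<in> iterated_colon I K k})"
    using ideal.Icarr[OF I] by (auto simp: m_comm)
  have "ideal (\<Inter> (insert (carrier R) ((\<lambda>a. {e \<in> carrier R. e \<otimes> a \<in> iterated_colon I K k}) ` I))) R"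
    by (rule i_Intersect) (use Suc oneideal colon_ideal ideal.Icarr[OF I] in auto)
  then show ?case unfolding iterated_colon.simps eq by simp
qed (simp add: K)

lemma iterated_colon_increasing:
  assumes I: "ideal I R" and K: "ideal K R"
  shows "K \<subseteq> iterated_colon I K k"
proof (induction k)
  case (Suc k)
  then show ?case
    using ideal.Icarr[OF I] ideal.Icarr[OF K] ideal.I_l_closed[OF K] by auto
qed simp

text \<open>For a product i j with i in I^k and j in I, the element j e lies in the k-fold colon, so
  the induction hypothesis applies to j e and i.\<close>

lemma iterated_colon_ideal_power:
  assumes I: "ideal I R" and K: "ideal K R"
    and e: "e \<in> iterated_colon I K k" and y: "y \<in> ideal_power R I k"
  shows "e \<otimes> y \<in> K"
  using e y
proof (induction k arbitrary: e y)
  case 0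
  then show ?case using ideal.I_r_closed[OF K] by simp
next
  case (Suc k)
  have e: "e \<in> carrier R" using Suc.prems(1) by simp
  have carr: "s \<in> carrier R" if "s \<in> ideal_power R I k \<cdot> I" for s
    using that ideal_prod_in_carrier[OF ideal_ideal_power[OF I] I] by blast
  show ?case
    using Suc.prems(2) unfolding ideal_power_Suc
  proof induction
    case (prod i j)
    have i: "i \<in> carrier R" and j: "j \<in> carrier R"
      using prod ideal.Icarr[OF I] ideal.Icarr[OF ideal_ideal_power[OF I]] by auto
    have "(j \<otimes> e) \<otimes> i \<in> K" using Suc.IH[of "j \<otimes> e" i] Suc.prems(1) prod by simp
    then show ?case using e i j by (simp add: m_ac)
  next
    case (sum s t)
    then show ?case
      using e carr additive_subgroup.a_closed[OF ideal.axioms(1)[OF K]] by (simp add: r_distr)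
  qed
qed

text \<open>Pigeonhole: the sum of the exponents drops each time a generator is multiplied in.\<close>

lemma mem_iterated_colon:
  assumes X: "finite X" "X \<subseteq> carrier R" and K: "ideal K R"
    and "e \<in> carrier R" and "\<And>x. x \<in> X \<Longrightarrow> x [^] (\<nu> x :: nat) \<otimes> e \<in> K" and "sum \<nu> X < k"
  shows "e \<in> iterated_colon (Idl X) K k"
  using assms(4-)
proof (induction k arbitrary: e \<nu>)
  case (Suc k)
  note I = genideal_ideal[OF X(2)]
  \<comment> \<open>The multipliers that send e into the k-fold colon form an ideal, so it is enough
    to find the generators among them.\<close>
  define A where "A = {a \<in> carrier R. a \<otimes> e \<in> iterated_colon (Idl X) K k}"
  have "ideal A R"
    unfolding A_def using colon_ideal[OF ideal_iterated_colon[OF I K]] Suc.prems(1) .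
  moreover have "X \<subseteq> A"
  proof
    fix x assume x: "x \<in> X"
    have xR: "x \<in> carrier R" using x X by blast
    have "x \<otimes> e \<in> iterated_colon (Idl X) K k"
    proof (cases "\<nu> x")
      case 0
      then have "e \<in> K" using Suc.prems(1) Suc.prems(2)[OF x] by simp
      then show ?thesis
        using ideal.I_l_closed[OF K _ xR] iterated_colon_increasing[OF I K] by blast
    next
      case (Suc l)
      show ?thesis
      proof (rule Suc.IH[of _ "\<nu>(x := l)"])
        show "x \<otimes> e \<in> carrier R" using xR Suc.prems(1) by simp
        have "sum (\<nu>(x := l)) X < sum \<nu> X"
          by (rule sum_strict_mono_ex1) (use X x Suc in auto)
        then show "sum (\<nu>(x := l)) X < k" using Suc.prems(3) by simp
        fix y assume y: "y \<in> X"
        have yR: "y \<in> carrier R" using y X by blast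
        show "y [^] (\<nu>(x := l)) y \<otimes> (x \<otimes> e) \<in> K"
        proof (cases "y = x")
          case True
          then show ?thesis
            using Suc.prems(2)[OF x] Suc Suc.prems(1) xR by (simp add: m_assoc)
        next
          case False
          then have "x \<otimes> (y [^] \<nu> y \<otimes> e) \<in> K"
            using ideal.I_l_closed[OF K Suc.prems(2)[OF y] xR] by simp
          then show ?thesis using False Suc.prems(1) xR yR by (simp add: m_ac)
        qed
      qed
    qed
    then show "x \<in> A" unfolding A_def using xR by simp
  qed
  ultimately have "Idl X \<subseteq> A" by (rule genideal_minimal)
  then show ?case using Suc.prems(1) unfolding A_def by auto
qed simp

end

text \<open>For a list x_1, ..., x_s these are the ideals (x_1^n, ..., x_s^n). Starting from the
  zero tower makes ordinary exactness the base of the induction on the list.\<close>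

primrec power_tower :: "('a, 'c) ring_scheme \<Rightarrow> 'a list \<Rightarrow> nat \<Rightarrow> 'a set" where
  "power_tower R [] = (\<lambda>n. {\<zero>\<^bsub>R\<^esub>})"
| "power_tower R (x # xs) = add_power R x (power_tower R xs)"

lemma ideal_tower_power_tower:
  assumes "cring R" and "set xs \<subseteq> carrier R"
  shows "ideal_tower R (power_tower R xs)"
  using assms(2)
proof (induction xs)
  case Nil
  interpret cring R by fact
  show ?case by (simp add: ideal_tower_def zeroideal)
next
  case (Cons x xs)
  then show ?case by (simp add: ideal_tower_add_power[OF assms(1)])
qed

lemma power_tower_subset_ideal_power:
  assumes "cring R" and I: "ideal I R" and "set xs \<subseteq> I"
  shows "power_tower R xs n \<subseteq> ideal_power R I n"
  using assms(3)
proof (induction xs)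
  case Nil
  interpret cring R by fact
  show ?case
    using additive_subgroup.zero_closed[OF ideal.axioms(1)[OF ideal_ideal_power[OF I]]] by simp
next
  case (Cons x xs)
  interpret cring R by fact
  interpret In: ideal "ideal_power R I n" R by (rule ideal_ideal_power[OF I])
  show ?case
  proof
    fix k assume "k \<in> power_tower R (x # xs) n"
    then obtain u r where u: "u \<in> power_tower R xs n" and r: "r \<in> carrier R"
      and k: "k = u \<oplus>\<^bsub>R\<^esub> r \<otimes>\<^bsub>R\<^esub> x [^]\<^bsub>R\<^esub> n" unfolding power_tower.simps mem_add_power by blast
    have "r \<otimes>\<^bsub>R\<^esub> x [^]\<^bsub>R\<^esub> n \<in> ideal_power R I n"
      using In.I_l_closed[OF nat_pow_in_ideal_power[OF I] r] Cons.prems by simp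
    then show "k \<in> ideal_power R I n" using u k Cons by auto
  qed
qed

lemma nat_pow_in_power_tower:
  assumes "cring R" and "set xs \<subseteq> carrier R" and "x \<in> set xs"
  shows "x [^]\<^bsub>R\<^esub> n \<in> power_tower R xs n"
  using assms(2,3)
proof (induction xs)
  case (Cons y xs)
  have ideal: "ideal (power_tower R xs n) R"
    using ideal_tower_power_tower[OF assms(1)] Cons.prems unfolding ideal_tower_def by simp
  have "power_tower R xs n \<subseteq> carrier R"
    using ideal ideal.axioms(1) additive_subgroup.a_subset by blast
  then show ?case
    using Cons subset_add_power[OF assms(1), of y "power_tower R xs" n]
      nat_pow_in_add_power[of R y "power_tower R xs" n, OF assms(1) _ ideal] by auto
qed simp

text \<open>With I generated by the entries of \<open>xs\<close>, the ideal generated by their n-th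
  powers lies in I^n. Conversely, a high power of I lies in the ideal of m-th powers by the
  pigeonhole argument.\<close>

lemma pro_exact_ideal_power:
  assumes "cring R" and xs: "set xs \<subseteq> carrier R"
    and ex: "pro_exact (power_tower R xs) L f M g N"
  shows "pro_exact (ideal_power R (Idl\<^bsub>R\<^esub> (set xs))) L f M g N"
proof (rule pro_exact_cofinal[OF ex])
  interpret cring R by fact
  note I = genideal_ideal[OF xs]
  show "\<exists>m. power_tower R xs m \<subseteq> ideal_power R (Idl\<^bsub>R\<^esub> (set xs)) n" for n
    using power_tower_subset_ideal_power[OF assms(1) I genideal_self[OF xs]] by blast
  show "\<exists>k\<ge>n. ideal_power R (Idl\<^bsub>R\<^esub> (set xs)) k \<subseteq> power_tower R xs m" for m n
  proof -
    have K: "ideal (power_tower R xs m) R"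
      using ideal_tower_power_tower[OF assms(1) xs] unfolding ideal_tower_def by simp
    \<comment> \<open>One more than m times the number of distinct generators. Then one lies in the
      k-fold colon, which says that I^k is contained in level m of the tower.\<close>
    define k where "k = Suc (sum (\<lambda>x. m) (set xs))"
    have "\<one>\<^bsub>R\<^esub> \<in> iterated_colon (Idl\<^bsub>R\<^esub> (set xs)) (power_tower R xs m) k"
      by (rule mem_iterated_colon[where \<nu> = "\<lambda>x. m"])
        (use xs K nat_pow_in_power_tower[OF assms(1) xs] in \<open>auto simp: k_def\<close>)
    then have "ideal_power R (Idl\<^bsub>R\<^esub> (set xs)) k \<subseteq> power_tower R xs m"
      using iterated_colon_ideal_power[OF I K] ideal.Icarr[OF ideal_ideal_power[OF I]] by fastforce
    then have "ideal_power R (Idl\<^bsub>R\<^esub> (set xs)) (max n k) \<subseteq> power_tower R xs m"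
      using ideal_power_decreasing[OF I, of k "max n k"] by auto
    then show ?thesis using max.cobounded1 by blast
  qed
qed

section \<open>Pro-exactness of exact complexes of flat modules\<close>

lemma exact_at_comp:
  assumes "exact_at L f M g N" and "x \<in> carrier L"
  shows "g (f x) = \<zero>\<^bsub>N\<^esub>"
  using assms unfolding exact_at_def a_kernel_def' by blast

text \<open>In the zero tower every level of a module is zero, so pro-exactness with m = n is
  exactness itself. This is the base of the inductions on the generators.\<close>

lemma exact_at_imp_pro_exact:
  assumes "module R M" and "module R N" and "f \<in> mod_hom R L M" and "exact_at L f M g N"
  shows "pro_exact (power_tower R []) L f M g N"
  unfolding pro_exact_def
proof
  fix n
  interpret M: module R M by fact
  interpret N: module R N by fact
  have "\<exists>v\<in>carrier L. z \<ominus>\<^bsub>M\<^esub> f v \<in> ideal_smult {\<zero>\<^bsub>R\<^esub>} M"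
    if z: "z \<in> carrier M" and gz: "g z \<in> ideal_smult {\<zero>\<^bsub>R\<^esub>} N" for z
  proof -
    have "z \<in> f ` carrier L"
      using assms(4) z gz unfolding N.ideal_smult_zero exact_at_def a_kernel_def' by simp
    then obtain v where v: "v \<in> carrier L" "z = f v" by blast
    then have "z \<ominus>\<^bsub>M\<^esub> f v = \<zero>\<^bsub>M\<^esub>" using z by (simp add: a_minus_def M.M.r_neg)
    then show ?thesis using v unfolding M.ideal_smult_zero by auto
  qed
  then show "\<exists>m\<ge>n. \<forall>z\<in>carrier M. g z \<in> ideal_smult (power_tower R [] m) N \<longrightarrow>
      (\<exists>v\<in>carrier L. z \<ominus>\<^bsub>M\<^esub> f v \<in> ideal_smult (power_tower R [] n) M)"
    unfolding power_tower.simps by (intro exI[of _ n]) blast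
qed

lemma pro_exact_power_tower_Cons:
  assumes "cring R" "noetherian_ring R"
    and "module R C3" "module R C2" "module R C1" "module R C0"
    and "f \<in> mod_hom R C3 C2" and "g \<in> mod_hom R C2 C1" and "h \<in> mod_hom R C1 C0"
    and "exact_at C2 g C1 h C0" and "module.colon_compatible R C0"
    and "set (x # xs) \<subseteq> carrier R"
    and "pro_exact (power_tower R xs) C3 f C2 g C1" and "pro_exact (power_tower R xs) C2 g C1 h C0"
  shows "pro_exact (power_tower R (x # xs)) C3 f C2 g C1"
  unfolding power_tower.simps
proof (rule pro_exact_add_power[OF assms(1-9) exact_at_comp[OF assms(10)] assms(11) _ _ assms(13,14)])
  show "ideal_tower R (power_tower R xs)"
    by (rule ideal_tower_power_tower[OF assms(1)]) (use assms(12) in simp)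
  show "x \<in> carrier R" using assms(12) by simp
qed

text \<open>Induction on the generators with the degree n left arbitrary, because adjoining a
  generator in degree n uses the shorter list in degrees n and n - 1.\<close>

lemma pro_exact_flat_complex:
  fixes F :: "int \<Rightarrow> ('a, 'f) module"
  assumes R: "cring R" "noetherian_ring R"
    and F: "\<And>n. module R (F n)" "\<And>n. module.colon_compatible R (F n)"
    and d: "\<And>n. d n \<in> mod_hom R (F n) (F (n - 1))"
    and ex: "\<And>n. exact_at (F (n + 1)) (d (n + 1)) (F n) (d n) (F (n - 1))"
    and xs: "set xs \<subseteq> carrier R"
  shows "pro_exact (power_tower R xs) (F (n + 1)) (d (n + 1)) (F n) (d n) (F (n - 1))"
  using xs
proof (induction xs arbitrary: n)
  case Nil
  show ?case using exact_at_imp_pro_exact[OF F(1) F(1) _ ex] d[of "n + 1"] by simp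
next
  case (Cons x xs)
  then have xs: "set xs \<subseteq> carrier R" by simp
  have d': "d (n + 1) \<in> mod_hom R (F (n + 1)) (F n)" using d[of "n + 1"] by simp
  have ex': "exact_at (F n) (d n) (F (n - 1)) (d (n - 1)) (F (n - 1 - 1))"
    using ex[of "n - 1"] by simp
  have IH': "pro_exact (power_tower R xs) (F n) (d n) (F (n - 1)) (d (n - 1)) (F (n - 1 - 1))"
    using Cons.IH[OF xs, of "n - 1"] by simp
  show ?case
    by (rule pro_exact_power_tower_Cons[OF R F(1) F(1) F(1) F(1) d' d d ex' F(2) Cons.prems
          Cons.IH[OF xs] IH'])
qed

text \<open>The spliced complex has terms with two element types and is not given as one family. Its
  degrees are therefore treated from right to left: F_-2, F_-1, P_0, and then all P_(n+1) together.
  Each is an induction on the generators that uses the degree to its right.\<close>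

lemma pro_exact_spliced_resolution:
  fixes F :: "int \<Rightarrow> ('a, 'f) module" and P :: "nat \<Rightarrow> ('a, 'p) module"
  assumes R: "cring R" "noetherian_ring R"
    and F: "\<And>n. module R (F n)" "\<And>n. module.colon_compatible R (F n)"
    and d: "\<And>n. d n \<in> mod_hom R (F n) (F (n - 1))"
    and exF: "\<And>n. exact_at (F (n + 1)) (d (n + 1)) (F n) (d n) (F (n - 1))"
    and P: "\<And>n. module R (P n)" "\<And>n. module.colon_compatible R (P n)"
    and e: "\<And>n. e n \<in> mod_hom R (P (Suc n)) (P n)"
    and exP: "\<And>n. exact_at (P (Suc (Suc n))) (e (Suc n)) (P (Suc n)) (e n) (P n)"
    and \<iota>: "\<iota> \<in> mod_hom R (P 0) (F (- 1))"
    and ex0: "exact_at (P (Suc 0)) (e 0) (P 0) \<iota> (F (- 1))"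
    and ex1: "exact_at (P 0) \<iota> (F (- 1)) (d (- 1)) (F (- 2))"
    and xs: "set xs \<subseteq> carrier R"
  shows "pro_exact (power_tower R xs) (P (Suc 0)) (e 0) (P 0) \<iota> (F (- 1))"
    and "pro_exact (power_tower R xs) (P (Suc (Suc n))) (e (Suc n)) (P (Suc n)) (e n) (P n)"
proof -
  have d1: "d (- 1) \<in> mod_hom R (F (- 1)) (F (- 2))" and d2: "d (- 2) \<in> mod_hom R (F (- 2)) (F (- 3))"
    using d[of "- 1"] d[of "- 2"] by simp_all
  have ex2: "exact_at (F (- 1)) (d (- 1)) (F (- 2)) (d (- 2)) (F (- 3))"
    using exF[of "- 2"] by simp
  \<comment> \<open>At F_-2 the incoming map and all terms further right still belong to F.\<close>
  have px2: "pro_exact (power_tower R xs) (F (- 1)) (d (- 1)) (F (- 2)) (d (- 2)) (F (- 3))"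
    if "set xs \<subseteq> carrier R" for xs
    using pro_exact_flat_complex[where n = "- 2", OF R F d exF that] by simp
  have px1: "pro_exact (power_tower R xs) (P 0) \<iota> (F (- 1)) (d (- 1)) (F (- 2))"
    if "set xs \<subseteq> carrier R" for xs
    using that
  proof (induction xs)
    case Nil
    show ?case by (rule exact_at_imp_pro_exact[OF F(1) F(1) \<iota> ex1])
  next
    case (Cons x xs)
    then have "set xs \<subseteq> carrier R" by simp
    from Cons.IH[OF this] px2[OF this] show ?case
      by (rule pro_exact_power_tower_Cons[OF R P(1) F(1) F(1) F(1) \<iota> d1 d2 ex2 F(2) Cons.prems])
  qed
  have px0: "pro_exact (power_tower R xs) (P (Suc 0)) (e 0) (P 0) \<iota> (F (- 1))"
    if "set xs \<subseteq> carrier R" for xs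
    using that
  proof (induction xs)
    case Nil
    show ?case by (rule exact_at_imp_pro_exact[OF P(1) F(1) e ex0])
  next
    case (Cons x xs)
    then have "set xs \<subseteq> carrier R" by simp
    from Cons.IH[OF this] px1[OF this] show ?case
      by (rule pro_exact_power_tower_Cons[OF R P(1) P(1) F(1) F(1) e \<iota> d1 ex1 F(2) Cons.prems])
  qed
  show "pro_exact (power_tower R xs) (P (Suc 0)) (e 0) (P 0) \<iota> (F (- 1))" using px0 xs .
  show "pro_exact (power_tower R xs) (P (Suc (Suc n))) (e (Suc n)) (P (Suc n)) (e n) (P n)"
    using xs
  proof (induction xs arbitrary: n)
    case Nil
    show ?case by (rule exact_at_imp_pro_exact[OF P(1) P(1) e exP])
  next
    case (Cons x xs)
    then have xs: "set xs \<subseteq> carrier R" by simp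
    note IH = Cons.IH[OF xs]
    \<comment> \<open>For n = 0 the degree to the right is P_0, whose outgoing map is \<iota>, so
      \<open>px0\<close> is used there. Higher up the induction hypothesis covers both
      degrees.\<close>
    show ?case
    proof (cases n)
      case 0
      show ?thesis
        unfolding 0 using IH px0[OF xs]
        by (rule pro_exact_power_tower_Cons[OF R P(1) P(1) P(1) F(1) e e \<iota> ex0 F(2) Cons.prems])
    next
      case (Suc k)
      show ?thesis
        unfolding Suc using IH IH
        by (rule pro_exact_power_tower_Cons[OF R P(1) P(1) P(1) P(1) e e e exP P(2) Cons.prems])
    qed
  qed
qed

section \<open>Cauchy sequences and the Mittag-Leffler argument\<close>

text \<open>Sequences of representatives for elements of the inverse limit of the M/K_n M. Comparing
  consecutive terms is enough once the tower is decreasing.\<close>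

definition adic_cauchy :: "(nat \<Rightarrow> 'a set) \<Rightarrow> ('a, 'm) module \<Rightarrow> (nat \<Rightarrow> 'm) \<Rightarrow> bool" where
  "adic_cauchy K M z \<longleftrightarrow>
     (\<forall>n. z n \<in> carrier M) \<and> (\<forall>n. z (Suc n) \<ominus>\<^bsub>M\<^esub> z n \<in> ideal_smult (K n) M)"

lemma adic_cauchy_diff:
  assumes "module R M" and K: "ideal_tower R K" and z: "adic_cauchy K M z" and "n \<le> m"
  shows "z m \<ominus>\<^bsub>M\<^esub> z n \<in> ideal_smult (K n) M"
  using assms(4)
proof (induction rule: dec_induct)
  case base
  interpret M: module R M by fact
  have "z n \<ominus>\<^bsub>M\<^esub> z n = \<zero>\<^bsub>M\<^esub>" using z by (simp add: adic_cauchy_def a_minus_def M.M.r_neg)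
  then show ?case by (simp add: ideal_smult.zero)
next
  case (step m)
  interpret M: module R M by fact
  have "z (Suc m) \<ominus>\<^bsub>M\<^esub> z m \<in> ideal_smult (K m) M" using z by (simp add: adic_cauchy_def)
  note Suc = ideal_smult_mono[OF ideal_towerD(3)[OF K step(1)] this]
  have zM: "z k \<in> carrier M" for k using z by (simp add: adic_cauchy_def)
  show ?case
    by (rule M.ideal_smult_cong_trans[OF ideal_towerD(2)[OF K] zM zM zM Suc step.IH])
qed

text \<open>Pro-vanishing at \<open>C1\<close> gives approximate preimages of the z n, which may
  fail to be Cauchy. Pro-vanishing at \<open>C2\<close> shows that, along a subsequence, their
  consecutive differences are images under e up to level n. Subtracting the partial sums of these
  images makes the sequence Cauchy.\<close>

lemma adic_cauchy_exact:
  assumes K: "ideal_tower R K"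
    and mods: "module R C3" "module R C2" "module R C1" "module R C0"
    and e: "e \<in> mod_hom R C3 C2" and f: "f \<in> mod_hom R C2 C1"
    and fe: "\<And>x. x \<in> carrier C3 \<Longrightarrow> f (e x) = \<zero>\<^bsub>C1\<^esub>"
    and ex2: "pro_exact K C3 e C2 f C1" and ex1: "pro_exact K C2 f C1 g C0"
    and z: "adic_cauchy K C1 z" and gz: "\<And>n. g (z n) \<in> ideal_smult (K n) C0"
  shows "\<exists>y. adic_cauchy K C2 y \<and> (\<forall>n. z n \<ominus>\<^bsub>C1\<^esub> f (y n) \<in> ideal_smult (K n) C1)"
proof -
  interpret C3: module R C3 by fact
  interpret C2: module R C2 by fact
  interpret C1: module R C1 by fact
  note KR = ideal_towerD(2)[OF K]
  have zC: "z n \<in> carrier C1" for n using z by (simp add: adic_cauchy_def)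
  have "\<exists>v\<in>carrier C2. z n \<ominus>\<^bsub>C1\<^esub> f v \<in> ideal_smult (K n) C1" for n
  proof -
    \<comment> \<open>The preimage is taken for z m rather than z n: g (z m) lies in the deep level
      m that pro-vanishing asks for, and z m is congruent to z n at level n.\<close>
    obtain m where m: "m \<ge> n" and "\<And>z. z \<in> carrier C1 \<Longrightarrow> g z \<in> ideal_smult (K m) C0 \<Longrightarrow>
      \<exists>v\<in>carrier C2. z \<ominus>\<^bsub>C1\<^esub> f v \<in> ideal_smult (K n) C1"
      using pro_exactE[OF ex1, of n] by blast
    then obtain v where v: "v \<in> carrier C2" "z m \<ominus>\<^bsub>C1\<^esub> f v \<in> ideal_smult (K n) C1"
      using zC gz by blast
    have "z n \<ominus>\<^bsub>C1\<^esub> z m \<in> ideal_smult (K n) C1"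
      by (rule C1.ideal_smult_cong_sym[OF ideal_towerD(1)[OF K] zC zC
            adic_cauchy_diff[OF mods(3) K z m]])
    from C1.ideal_smult_cong_trans[OF KR zC zC mod_homD(1)[OF f v(1)] this v(2)] v(1)
    show ?thesis by blast
  qed
  then obtain V where V: "\<And>n. V n \<in> carrier C2"
    "\<And>n. z n \<ominus>\<^bsub>C1\<^esub> f (V n) \<in> ideal_smult (K n) C1" by metis
  have fV: "f (V n) \<in> carrier C1" for n using mod_homD(1)[OF f V(1)] .
  have "\<exists>m. m \<ge> n \<and> (\<forall>x\<in>carrier C2. f x \<in> ideal_smult (K m) C1 \<longrightarrow>
      (\<exists>w\<in>carrier C3. x \<ominus>\<^bsub>C2\<^esub> e w \<in> ideal_smult (K n) C2))" for n
    using ex2 unfolding pro_exact_def by blast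
  then obtain b where b: "\<And>n. b n \<ge> n" "\<And>n x. x \<in> carrier C2 \<Longrightarrow> f x \<in> ideal_smult (K (b n)) C1 \<Longrightarrow>
      \<exists>w\<in>carrier C3. x \<ominus>\<^bsub>C2\<^esub> e w \<in> ideal_smult (K n) C2" by metis
  \<comment> \<open>Partial sums of b make q nondecreasing with q n \<ge> b n. Consecutive images f
    (Y n) then agree to level b n, as the choice of b asks.\<close>
  define q where "q n = (\<Sum>i\<le>n. b i)" for n
  have q: "q n \<ge> b n" "q (Suc n) \<ge> q n" for n unfolding q_def by (simp_all add: member_le_sum)
  define Y where "Y n = V (q n)" for n
  have Y: "Y n \<in> carrier C2" for n unfolding Y_def using V(1) .
  have fY: "f (Y n) \<in> carrier C1" for n unfolding Y_def using fV .
  have "\<exists>w\<in>carrier C3. (Y (Suc n) \<ominus>\<^bsub>C2\<^esub> Y n) \<ominus>\<^bsub>C2\<^esub> e w \<in> ideal_smult (K n) C2" for n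
  proof (rule b(2))
    let ?I = "ideal_smult (K (q n)) C1"
    note trans = C1.ideal_smult_cong_trans[OF KR[of "q n"]]
    note sym = C1.ideal_smult_cong_sym[OF ideal_towerD(1)[OF K], of _ _ "q n"]
    show "Y (Suc n) \<ominus>\<^bsub>C2\<^esub> Y n \<in> carrier C2" using Y by simp
    have "z (q (Suc n)) \<ominus>\<^bsub>C1\<^esub> f (Y (Suc n)) \<in> ?I"
      unfolding Y_def using ideal_smult_mono[OF ideal_towerD(3)[OF K q(2)] V(2)] .
    from sym[OF zC fY this] have "f (Y (Suc n)) \<ominus>\<^bsub>C1\<^esub> z (q (Suc n)) \<in> ?I" .
    from trans[OF fY zC zC this adic_cauchy_diff[OF mods(3) K z q(2)]]
    have "f (Y (Suc n)) \<ominus>\<^bsub>C1\<^esub> z (q n) \<in> ?I" .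
    from trans[OF fY zC fY this, of n] V(2)[of "q n"]
    have "f (Y (Suc n)) \<ominus>\<^bsub>C1\<^esub> f (Y n) \<in> ?I" unfolding Y_def by simp
    from ideal_smult_mono[OF ideal_towerD(3)[OF K q(1)] this]
    show "f (Y (Suc n) \<ominus>\<^bsub>C2\<^esub> Y n) \<in> ideal_smult (K (b n)) C1"
      using mod_hom_diff[OF f mods(2,3) Y Y] by simp
  qed
  then obtain w where w: "\<And>n. w n \<in> carrier C3"
    "\<And>n. (Y (Suc n) \<ominus>\<^bsub>C2\<^esub> Y n) \<ominus>\<^bsub>C2\<^esub> e (w n) \<in> ideal_smult (K n) C2" by metis
  \<comment> \<open>Partial sums of the w n. Since f e = 0, subtracting e (S n) leaves f (Y n)
    unchanged, while each consecutive difference loses e (w n).\<close>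
  define S where "S = rec_nat \<zero>\<^bsub>C3\<^esub> (\<lambda>n s. s \<oplus>\<^bsub>C3\<^esub> w n)"
  have S_Suc: "S (Suc n) = S n \<oplus>\<^bsub>C3\<^esub> w n" for n unfolding S_def by simp
  have S: "S n \<in> carrier C3" for n
    by (induction n) (simp_all add: S_def w(1))
  define y where "y n = Y n \<ominus>\<^bsub>C2\<^esub> e (S n)" for n
  have eS: "e (S n) \<in> carrier C2" and ew: "e (w n) \<in> carrier C2" for n
    using S w(1) by (simp_all add: mod_homD[OF e])
  have "y (Suc n) \<ominus>\<^bsub>C2\<^esub> y n = (Y (Suc n) \<ominus>\<^bsub>C2\<^esub> Y n) \<ominus>\<^bsub>C2\<^esub> e (w n)" for n
    unfolding y_def S_Suc mod_homD(2)[OF e S w(1)] by (rule C2.M.diff_diff_diff[OF Y Y eS ew])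
  then have "adic_cauchy K C2 y"
    unfolding adic_cauchy_def using w(2) Y eS by (simp add: y_def)
  moreover have "z n \<ominus>\<^bsub>C1\<^esub> f (y n) \<in> ideal_smult (K n) C1" for n
  proof -
    have "f (y n) = f (Y n)"
      unfolding y_def mod_hom_diff[OF f mods(2,3) Y eS] fe[OF S] using fY[of n]
      by (simp add: a_minus_def)
    moreover have nq: "n \<le> q n" using b(1)[of n] q(1)[of n] by simp
    have "z n \<ominus>\<^bsub>C1\<^esub> f (Y n) \<in> ideal_smult (K n) C1"
      using C1.ideal_smult_cong_sym[OF ideal_towerD(1)[OF K] zC zC
            adic_cauchy_diff[OF mods(3) K z nq]]
        ideal_smult_mono[OF ideal_towerD(3)[OF K nq] V(2)]
      unfolding Y_def by (rule C1.ideal_smult_cong_trans[OF KR zC zC fV])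
    ultimately show ?thesis by simp
  qed
  ultimately show ?thesis by blast
qed

text \<open>Dependent choice: the next lift is the current one plus a lift, taken inside level n of
  M, of the difference of consecutive terms. Independent lifts of the terms could fail to be
  Cauchy.\<close>

lemma adic_cauchy_lift:
  assumes K: "ideal_tower R K" and mods: "module R M" "module R N"
    and f: "f \<in> mod_hom R M N" and surj: "f ` carrier M = carrier N"
    and y: "adic_cauchy K N y"
  shows "\<exists>x. adic_cauchy K M x \<and> (\<forall>n. f (x n) = y n)"
proof -
  interpret M: module R M by fact
  interpret N: module R N by fact
  have "\<exists>x. \<forall>n. (x n \<in> carrier M \<and> f (x n) = y n) \<and> x (Suc n) \<ominus>\<^bsub>M\<^esub> x n \<in> ideal_smult (K n) M"
  proof (rule dependent_nat_choice)
    show "\<exists>x. x \<in> carrier M \<and> f x = y 0"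
      using surj y unfolding adic_cauchy_def by (metis imageE)
    fix x n assume x: "x \<in> carrier M \<and> f x = y n"
    have "y (Suc n) \<ominus>\<^bsub>N\<^esub> y n \<in> ideal_smult (K n) N" using y by (simp add: adic_cauchy_def)
    then obtain t where t: "t \<in> ideal_smult (K n) M" "f t = y (Suc n) \<ominus>\<^bsub>N\<^esub> y n"
      using mod_hom_ideal_smult_lift[OF f mods ideal_towerD(2)[OF K] surj] by blast
    have tM: "t \<in> carrier M" using M.ideal_smult_carrier[OF ideal_towerD(2)[OF K] t(1)] .
    have yn: "y n \<in> carrier N" "y (Suc n) \<in> carrier N" using y by (simp_all add: adic_cauchy_def)
    have "f (x \<oplus>\<^bsub>M\<^esub> t) = y (Suc n)"
      using x t tM yn by (simp add: mod_homD[OF f] N.M.add_diff_cancel)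
    moreover have "(x \<oplus>\<^bsub>M\<^esub> t) \<ominus>\<^bsub>M\<^esub> x = t"
      using x tM by (simp add: M.M.add_diff_cancel)
    ultimately show "\<exists>x'. (x' \<in> carrier M \<and> f x' = y (Suc n)) \<and> x' \<ominus>\<^bsub>M\<^esub> x \<in> ideal_smult (K n) M"
      using x t(1) tM by (intro exI[of _ "x \<oplus>\<^bsub>M\<^esub> t"]) simp
  qed
  then show ?thesis unfolding adic_cauchy_def by blast
qed

section \<open>Quotients, free modules and tensor products\<close>

lemma quot_module_simps:
  "carrier (quot_module M H) = a_rcosets\<^bsub>M\<^esub> H"
  "\<zero>\<^bsub>quot_module M H\<^esub> = H"
  "X \<oplus>\<^bsub>quot_module M H\<^esub> Y = X <+>\<^bsub>M\<^esub> Y"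
  "r \<odot>\<^bsub>quot_module M H\<^esub> X = H <+>\<^bsub>M\<^esub> ((\<lambda>x. r \<odot>\<^bsub>M\<^esub> x) ` X)"
  by (simp_all add: quot_module_def)

locale quotient = module R M for R (structure) and M :: "('a, 'm) module" (structure) +
  fixes H :: "'m set"
  assumes submod: "submodule H R M"
begin

sublocale abelian_subgroup H M
  using submod M.abelian_group_axioms
  by (intro abelian_subgroupI3 additive_subgroup.intro) (simp_all add: submodule_def)

lemma carrier_quot: "carrier (quot_module M H) = (\<lambda>x. H +>\<^bsub>M\<^esub> x) ` carrier M"
  by (auto simp: quot_module_simps A_RCOSETS_def')

lemma coset_eq_iff:
  assumes "x \<in> carrier M" "y \<in> carrier M"
  shows "H +>\<^bsub>M\<^esub> x = H +>\<^bsub>M\<^esub> y \<longleftrightarrow> x \<ominus>\<^bsub>M\<^esub> y \<in> H"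
  using a_rcos_module[OF assms(2,1)] a_repr_independence'[OF _ assms(2), of x] a_rcos_self[OF assms(1)]
  by (auto simp: a_minus_def)

text \<open>The pointwise multiple of a coset by r may be strictly smaller than a coset. Adding H,
  as \<open>quot_module\<close> does, fills it up.\<close>

lemma coset_smult:
  assumes r: "r \<in> carrier R" and x: "x \<in> carrier M"
  shows "H <+>\<^bsub>M\<^esub> ((\<lambda>x. r \<odot>\<^bsub>M\<^esub> x) ` (H +>\<^bsub>M\<^esub> x)) = H +>\<^bsub>M\<^esub> (r \<odot>\<^bsub>M\<^esub> x)"
proof
  show "H <+>\<^bsub>M\<^esub> ((\<lambda>x. r \<odot>\<^bsub>M\<^esub> x) ` (H +>\<^bsub>M\<^esub> x)) \<subseteq> H +>\<^bsub>M\<^esub> (r \<odot>\<^bsub>M\<^esub> x)"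
  proof
    fix y assume "y \<in> H <+>\<^bsub>M\<^esub> ((\<lambda>x. r \<odot>\<^bsub>M\<^esub> x) ` (H +>\<^bsub>M\<^esub> x))"
    then obtain h h' where h: "h \<in> H" "h' \<in> H" and y: "y = h \<oplus>\<^bsub>M\<^esub> r \<odot>\<^bsub>M\<^esub> (h' \<oplus>\<^bsub>M\<^esub> x)"
      unfolding set_add_def' a_r_coset_def' by auto
    have "y = (h \<oplus>\<^bsub>M\<^esub> r \<odot>\<^bsub>M\<^esub> h') \<oplus>\<^bsub>M\<^esub> r \<odot>\<^bsub>M\<^esub> x"
      using y h r x by (simp add: smult_r_distr M.a_assoc)
    moreover have "h \<oplus>\<^bsub>M\<^esub> r \<odot>\<^bsub>M\<^esub> h' \<in> H"
      using h r submodule.smult_closed[OF submod] by simp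
    ultimately show "y \<in> H +>\<^bsub>M\<^esub> (r \<odot>\<^bsub>M\<^esub> x)" unfolding a_r_coset_def' by blast
  qed
  show "H +>\<^bsub>M\<^esub> (r \<odot>\<^bsub>M\<^esub> x) \<subseteq> H <+>\<^bsub>M\<^esub> ((\<lambda>x. r \<odot>\<^bsub>M\<^esub> x) ` (H +>\<^bsub>M\<^esub> x))"
  proof
    fix y assume "y \<in> H +>\<^bsub>M\<^esub> (r \<odot>\<^bsub>M\<^esub> x)"
    then obtain h where "h \<in> H" "y = h \<oplus>\<^bsub>M\<^esub> r \<odot>\<^bsub>M\<^esub> x" unfolding a_r_coset_def' by blast
    then show "y \<in> H <+>\<^bsub>M\<^esub> ((\<lambda>x. r \<odot>\<^bsub>M\<^esub> x) ` (H +>\<^bsub>M\<^esub> x))"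
      using a_rcos_self[OF x] unfolding set_add_def' by blast
  qed
qed

lemma coset_hom: "(\<lambda>x. H +>\<^bsub>M\<^esub> x) \<in> mod_hom R M (quot_module M H)"
  by (rule mod_homI)
    (simp_all add: quot_module_simps a_rcosetsI[OF a_subset] a_rcos_sum coset_smult)

lemma module_quot: "module R (quot_module M H)"
proof -
  note hom = mod_homD[OF coset_hom]
  have C: "carrier (quot_module M H) = (\<lambda>x. H +>\<^bsub>M\<^esub> x) ` carrier M" by (rule carrier_quot)
  have zero: "\<zero>\<^bsub>quot_module M H\<^esub> = H +>\<^bsub>M\<^esub> \<zero>\<^bsub>M\<^esub>" using a_subset by (simp add: quot_module_simps)
  show ?thesis
  proof (rule moduleI[OF R.cring_axioms abelian_groupI])
    show "\<zero>\<^bsub>quot_module M H\<^esub> \<in> carrier (quot_module M H)" unfolding zero C by blast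
  next
    fix x assume "x \<in> carrier (quot_module M H)"
    then obtain a where a: "a \<in> carrier M" "x = H +>\<^bsub>M\<^esub> a" unfolding C by blast
    then have "(H +>\<^bsub>M\<^esub> (\<ominus>\<^bsub>M\<^esub> a)) \<oplus>\<^bsub>quot_module M H\<^esub> x = \<zero>\<^bsub>quot_module M H\<^esub>"
      unfolding zero by (simp add: hom(2)[symmetric] M.l_neg)
    moreover have "H +>\<^bsub>M\<^esub> (\<ominus>\<^bsub>M\<^esub> a) \<in> carrier (quot_module M H)" unfolding C using a by blast
    ultimately show "\<exists>y\<in>carrier (quot_module M H). y \<oplus>\<^bsub>quot_module M H\<^esub> x = \<zero>\<^bsub>quot_module M H\<^esub>"
      by blast
  qed (auto simp: C zero hom(2,3)[symmetric] M.a_ac smult_l_distr smult_r_distr smult_assoc1)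
qed

end

lemma submodule_kernel:
  assumes f: "f \<in> mod_hom R M N" and "module R M" and "module R N"
  shows "submodule (a_kernel M N f) R M"
proof -
  interpret M: module R M by fact
  interpret N: module R N by fact
  show ?thesis
    unfolding a_kernel_def'
    by (rule M.submoduleI)
      (auto simp: mod_homD[OF f] mod_hom_zero[OF assms] mod_hom_minus[OF assms])
qed

text \<open>The first isomorphism theorem, with the induced map written in the form in which
  \<open>xi\<close> is defined.\<close>

lemma mod_iso_quot_kernel:
  assumes f: "f \<in> mod_hom R M N" and mods: "module R M" "module R N"
    and surj: "f ` carrier M = carrier N"
  shows "(\<lambda>Y. the_elem (f ` Y)) \<in> mod_iso R (quot_module M (a_kernel M N f)) N"
proof -
  interpret M: module R M by fact
  interpret N: module R N by fact
  interpret K: quotient R M "a_kernel M N f"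
    by (intro quotient.intro quotient_axioms.intro mods submodule_kernel[OF f mods])
  let ?Q = "quot_module M (a_kernel M N f)"
  let ?\<phi> = "\<lambda>Y. the_elem (f ` Y)"
  have \<phi>: "?\<phi> (a_kernel M N f +>\<^bsub>M\<^esub> x) = f x" if x: "x \<in> carrier M" for x
  proof -
    have "f y = f x" if y: "y \<in> a_kernel M N f +>\<^bsub>M\<^esub> x" for y
    proof -
      obtain k where "k \<in> carrier M" "f k = \<zero>\<^bsub>N\<^esub>" "y = k \<oplus>\<^bsub>M\<^esub> x"
        using y unfolding a_r_coset_def' a_kernel_def' by blast
      then show ?thesis using x by (simp add: mod_homD[OF f])
    qed
    moreover have "x \<in> a_kernel M N f +>\<^bsub>M\<^esub> x" by (rule K.a_rcos_self[OF x])
    ultimately have "f ` (a_kernel M N f +>\<^bsub>M\<^esub> x) = {f x}" by blast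
    then show ?thesis by simp
  qed
  note C = K.carrier_quot
  note cos = mod_homD(2,3)[OF K.coset_hom, symmetric]
  have "?\<phi> \<in> mod_hom R ?Q N"
    by (rule mod_homI) (auto simp: C cos \<phi> mod_homD[OF f])
  moreover have "inj_on ?\<phi> (carrier ?Q)"
  proof (rule inj_onI)
    fix X Y assume "X \<in> carrier ?Q" "Y \<in> carrier ?Q" and eq: "?\<phi> X = ?\<phi> Y"
    then obtain x y where x: "x \<in> carrier M" "X = a_kernel M N f +>\<^bsub>M\<^esub> x"
      and y: "y \<in> carrier M" "Y = a_kernel M N f +>\<^bsub>M\<^esub> y" unfolding C by blast
    have "f x = f y" using eq \<phi>[OF x(1)] \<phi>[OF y(1)] unfolding x(2) y(2) by simp
    then have "f (x \<ominus>\<^bsub>M\<^esub> y) = \<zero>\<^bsub>N\<^esub>"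
      using mod_hom_diff[OF f mods x(1) y(1)] mod_homD(1)[OF f] x(1) y(1)
      by (simp add: N.M.diff_eq_zero_iff)
    then have "x \<ominus>\<^bsub>M\<^esub> y \<in> a_kernel M N f" using x(1) y(1) unfolding a_kernel_def' by simp
    then show "X = Y" using K.coset_eq_iff[OF x(1) y(1)] unfolding x(2) y(2) by simp
  qed
  moreover have "?\<phi> ` carrier ?Q = carrier N"
    unfolding C image_image surj[symmetric] using \<phi> by (rule image_cong[OF refl])
  ultimately show ?thesis unfolding mod_iso_def bij_betw_def by blast
qed

text \<open>Vanishing homology appears as the module of cycles modulo itself. The single coset is
  also the zero of \<open>quot_module\<close>.\<close>

lemma carrier_quot_carrier:
  assumes "module R M"
  shows "carrier (quot_module M (carrier M)) = {carrier M}"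
proof -
  interpret M: module R M by fact
  interpret Q: quotient R M "carrier M"
    by (intro quotient.intro quotient_axioms.intro assms M.carrier_is_submodule)
  show ?thesis unfolding Q.carrier_quot using Q.a_rcos_const M.M.zero_closed by auto
qed

section \<open>Free modules\<close>

lemma free_module_simps [simp]:
  "\<zero>\<^bsub>free_module R S\<^esub> = (\<lambda>s. \<zero>\<^bsub>R\<^esub>)"
  "u \<oplus>\<^bsub>free_module R S\<^esub> v = (\<lambda>s. u s \<oplus>\<^bsub>R\<^esub> v s)"
  "r \<odot>\<^bsub>free_module R S\<^esub> u = (\<lambda>s. r \<otimes>\<^bsub>R\<^esub> u s)"
  by (simp_all add: free_module_def)

lemma mem_free_module:
  "u \<in> carrier (free_module R S) \<longleftrightarrow> (\<forall>s. u s \<in> carrier R) \<and> {s. u s \<noteq> \<zero>\<^bsub>R\<^esub>} \<subseteq> S \<and>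
     finite {s. u s \<noteq> \<zero>\<^bsub>R\<^esub>}"
  by (auto simp: free_module_def)

context cring
begin

lemma module_free_module: "module R (free_module R S)"
proof -
  have add: "(\<lambda>s. u s \<oplus> v s) \<in> carrier (free_module R S)"
    if "u \<in> carrier (free_module R S)" "v \<in> carrier (free_module R S)" for u v
  proof -
    have "{s. u s \<oplus> v s \<noteq> \<zero>} \<subseteq> {s. u s \<noteq> \<zero>} \<union> {s. v s \<noteq> \<zero>}" by auto
    then show ?thesis using that unfolding mem_free_module
      by (auto intro: finite_subset)
  qed
  have smult: "(\<lambda>s. r \<otimes> u s) \<in> carrier (free_module R S)"
    if "u \<in> carrier (free_module R S)" "r \<in> carrier R" for u r
  proof -
    have "{s. r \<otimes> u s \<noteq> \<zero>} \<subseteq> {s. u s \<noteq> \<zero>}" using that by auto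
    then show ?thesis using that unfolding mem_free_module
      by (auto intro: finite_subset)
  qed
  note carr = mem_free_module[THEN iffD1, THEN conjunct1, THEN spec]
  show ?thesis
  proof (rule moduleI[OF cring_axioms abelian_groupI])
    fix u assume u: "u \<in> carrier (free_module R S)"
    then have "(\<lambda>s. \<ominus> \<one> \<otimes> u s) \<oplus>\<^bsub>free_module R S\<^esub> u = \<zero>\<^bsub>free_module R S\<^esub>"
      using carr[OF u] by (simp add: l_minus l_neg)
    then show "\<exists>v\<in>carrier (free_module R S). v \<oplus>\<^bsub>free_module R S\<^esub> u = \<zero>\<^bsub>free_module R S\<^esub>"
      using smult[OF u, of "\<ominus> \<one>"] by blast
  qed (simp_all add: add smult carr a_ac l_distr r_distr m_assoc, simp add: mem_free_module)
qed

lemma free_gen_closed: "s \<in> S \<Longrightarrow> free_gen R s \<in> carrier (free_module R S)"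
  by (auto simp: mem_free_module free_gen_def)

lemma free_module_induct [consumes 1, case_names zero add]:
  assumes u: "u \<in> carrier (free_module R S)" and zero: "P (\<lambda>s. \<zero>)"
    and add: "\<And>u s r. u \<in> carrier (free_module R S) \<Longrightarrow> s \<in> S \<Longrightarrow> r \<in> carrier R \<Longrightarrow> P u \<Longrightarrow>
      P (r \<odot>\<^bsub>free_module R S\<^esub> free_gen R s \<oplus>\<^bsub>free_module R S\<^esub> u)"
  shows "P u"
proof -
  have "finite {s. u s \<noteq> \<zero>}" using u unfolding mem_free_module by blast
  moreover have "\<lbrakk>A = {s. u s \<noteq> \<zero>}; u \<in> carrier (free_module R S)\<rbrakk> \<Longrightarrow> P u" if "finite A" for A
    using that
  proof (induction A arbitrary: u rule: finite_induct)
    case empty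
    then have "u = (\<lambda>s. \<zero>)" by auto
    then show ?case using zero by simp
  next
    case (insert a A)
    have carr: "u s \<in> carrier R" for s using insert.prems(2) by (simp add: mem_free_module)
    define v where "v = u(a := \<zero>)"
    have supp: "A = {s. v s \<noteq> \<zero>}" using insert.hyps(2) insert.prems(1) unfolding v_def by auto
    have v: "v \<in> carrier (free_module R S)"
      using insert.prems insert.hyps(1) supp carr unfolding mem_free_module by (auto simp: v_def)
    have "u = u a \<odot>\<^bsub>free_module R S\<^esub> free_gen R a \<oplus>\<^bsub>free_module R S\<^esub> v"
      using carr by (auto simp: free_gen_def v_def fun_eq_iff)
    moreover have "a \<in> S" using insert.prems unfolding mem_free_module by blast
    ultimately show ?case using add[OF v _ carr insert.IH[OF supp v]] by metis
  qed
  ultimately show ?thesis using u by blast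
qed

end

text \<open>Passing to a finite superset of the support lets u, v and their sum share one index set,
  which is how additivity is shown.\<close>

lemma free_lift_eq_finsum:
  assumes "module R N" and \<phi>: "\<phi> \<in> S \<rightarrow> carrier N" and u: "u \<in> carrier (free_module R S)"
    and A: "finite A" "{s. u s \<noteq> \<zero>\<^bsub>R\<^esub>} \<subseteq> A" "A \<subseteq> S"
  shows "free_lift R N \<phi> u = (\<Oplus>\<^bsub>N\<^esub>s\<in>A. u s \<odot>\<^bsub>N\<^esub> \<phi> s)"
proof -
  interpret N: module R N by fact
  have carr: "u s \<in> carrier R" for s using u by (simp add: mem_free_module)
  show ?thesis
    unfolding free_lift_def
    by (rule N.M.add.finprod_mono_neutral_cong_left)
      (use A \<phi> carr in \<open>auto simp: Pi_def subset_eq\<close>)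
qed

lemma free_lift_hom:
  assumes "module R N" and \<phi>: "\<phi> \<in> S \<rightarrow> carrier N"
  shows "free_lift R N \<phi> \<in> mod_hom R (free_module R S) N"
proof -
  interpret N: module R N by fact
  interpret F: module R "free_module R S" by (rule N.R.module_free_module)
  note carr = mem_free_module[THEN iffD1, THEN conjunct1, THEN spec]
  have \<phi>': "\<phi> s \<in> carrier N" if "s \<in> S" for s using \<phi> that by blast
  show ?thesis
  proof (rule mod_homI)
    fix u assume u: "u \<in> carrier (free_module R S)"
    then show "free_lift R N \<phi> u \<in> carrier N"
      unfolding free_lift_def using \<phi>' carr[OF u]
      by (intro N.M.finsum_closed) (auto simp: mem_free_module)
    fix r assume r: "r \<in> carrier R"
    let ?A = "{s. u s \<noteq> \<zero>\<^bsub>R\<^esub>}"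
    have A: "finite ?A" "?A \<subseteq> S" using u by (simp_all add: mem_free_module)
    have "free_lift R N \<phi> (r \<odot>\<^bsub>free_module R S\<^esub> u)
      = (\<Oplus>\<^bsub>N\<^esub>s\<in>?A. (r \<odot>\<^bsub>free_module R S\<^esub> u) s \<odot>\<^bsub>N\<^esub> \<phi> s)"
      by (rule free_lift_eq_finsum[OF assms F.smult_closed[OF r u] A(1) _ A(2)]) (use r in auto)
    also have "\<dots> = (\<Oplus>\<^bsub>N\<^esub>s\<in>?A. r \<odot>\<^bsub>N\<^esub> (u s \<odot>\<^bsub>N\<^esub> \<phi> s))"
      using A(2) \<phi>' r carr[OF u] by (intro N.M.finsum_cong') (auto simp: N.smult_assoc1)
    also have "\<dots> = r \<odot>\<^bsub>N\<^esub> free_lift R N \<phi> u"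
      unfolding free_lift_def using A \<phi>' r carr[OF u]
      by (intro N.finsum_smult_ldistr[symmetric]) auto
    finally show "free_lift R N \<phi> (r \<odot>\<^bsub>free_module R S\<^esub> u) = r \<odot>\<^bsub>N\<^esub> free_lift R N \<phi> u" .
  next
    fix u v assume u: "u \<in> carrier (free_module R S)" and v: "v \<in> carrier (free_module R S)"
    let ?A = "{s. u s \<noteq> \<zero>\<^bsub>R\<^esub>} \<union> {s. v s \<noteq> \<zero>\<^bsub>R\<^esub>}"
    have A: "finite ?A" "?A \<subseteq> S" using u v by (simp_all add: mem_free_module)
    have "free_lift R N \<phi> (u \<oplus>\<^bsub>free_module R S\<^esub> v)
      = (\<Oplus>\<^bsub>N\<^esub>s\<in>?A. (u \<oplus>\<^bsub>free_module R S\<^esub> v) s \<odot>\<^bsub>N\<^esub> \<phi> s)"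
      by (rule free_lift_eq_finsum[OF assms F.M.a_closed[OF u v] A(1) _ A(2)]) auto
    also have "\<dots> = (\<Oplus>\<^bsub>N\<^esub>s\<in>?A. u s \<odot>\<^bsub>N\<^esub> \<phi> s \<oplus>\<^bsub>N\<^esub> v s \<odot>\<^bsub>N\<^esub> \<phi> s)"
      using A(2) \<phi>' carr[OF u] carr[OF v]
      by (intro N.M.finsum_cong') (auto simp: N.smult_l_distr)
    also have "\<dots> = (\<Oplus>\<^bsub>N\<^esub>s\<in>?A. u s \<odot>\<^bsub>N\<^esub> \<phi> s) \<oplus>\<^bsub>N\<^esub> (\<Oplus>\<^bsub>N\<^esub>s\<in>?A. v s \<odot>\<^bsub>N\<^esub> \<phi> s)"
      using A(2) \<phi>' carr[OF u] carr[OF v] by (intro N.M.finsum_addf) auto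
    also have "\<dots> = free_lift R N \<phi> u \<oplus>\<^bsub>N\<^esub> free_lift R N \<phi> v"
      using free_lift_eq_finsum[OF assms u A(1) _ A(2)] free_lift_eq_finsum[OF assms v A(1) _ A(2)]
      by simp
    finally show "free_lift R N \<phi> (u \<oplus>\<^bsub>free_module R S\<^esub> v)
      = free_lift R N \<phi> u \<oplus>\<^bsub>N\<^esub> free_lift R N \<phi> v" .
  qed
qed

lemma free_lift_free_gen:
  assumes "module R N" and \<phi>: "\<phi> \<in> S \<rightarrow> carrier N" and s: "s \<in> S"
  shows "free_lift R N \<phi> (free_gen R s) = \<phi> s"
proof -
  interpret N: module R N by fact
  have "free_lift R N \<phi> (free_gen R s) = (\<Oplus>\<^bsub>N\<^esub>t\<in>{s}. free_gen R s t \<odot>\<^bsub>N\<^esub> \<phi> t)"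
    by (rule free_lift_eq_finsum[OF assms(1) \<phi> N.R.free_gen_closed[OF s]])
      (use s in \<open>auto simp: free_gen_def\<close>)
  also have "\<dots> = \<phi> s" using funcset_mem[OF \<phi> s] by (simp add: free_gen_def)
  finally show ?thesis .
qed

section \<open>Bilinear maps and the universal property of the tensor product\<close>

definition bilinear_map ::
  "('a, 'c) ring_scheme \<Rightarrow> ('a, 'm) module \<Rightarrow> ('a, 'n) module \<Rightarrow> ('a, 'l) module
    \<Rightarrow> ('m \<Rightarrow> 'n \<Rightarrow> 'l) \<Rightarrow> bool" where
  "bilinear_map R M N L \<beta> \<longleftrightarrow>
     (\<forall>x\<in>carrier M. \<beta> x \<in> mod_hom R N L) \<and> (\<forall>y\<in>carrier N. (\<lambda>x. \<beta> x y) \<in> mod_hom R M L)"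

lemma bilinear_mapD:
  assumes "bilinear_map R M N L \<beta>"
  shows "x \<in> carrier M \<Longrightarrow> \<beta> x \<in> mod_hom R N L"
    and "y \<in> carrier N \<Longrightarrow> (\<lambda>x. \<beta> x y) \<in> mod_hom R M L"
  using assms by (auto simp: bilinear_map_def)

lemma bilinear_map_simps:
  assumes "bilinear_map R M N L \<beta>"
  shows "x \<in> carrier M \<Longrightarrow> y \<in> carrier N \<Longrightarrow> \<beta> x y \<in> carrier L"
    and "x \<in> carrier M \<Longrightarrow> y \<in> carrier N \<Longrightarrow> y' \<in> carrier N \<Longrightarrow>
      \<beta> x (y \<oplus>\<^bsub>N\<^esub> y') = \<beta> x y \<oplus>\<^bsub>L\<^esub> \<beta> x y'"
    and "x \<in> carrier M \<Longrightarrow> x' \<in> carrier M \<Longrightarrow> y \<in> carrier N \<Longrightarrow>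
      \<beta> (x \<oplus>\<^bsub>M\<^esub> x') y = \<beta> x y \<oplus>\<^bsub>L\<^esub> \<beta> x' y"
    and "r \<in> carrier R \<Longrightarrow> x \<in> carrier M \<Longrightarrow> y \<in> carrier N \<Longrightarrow>
      \<beta> (r \<odot>\<^bsub>M\<^esub> x) y = r \<odot>\<^bsub>L\<^esub> \<beta> x y"
    and "r \<in> carrier R \<Longrightarrow> x \<in> carrier M \<Longrightarrow> y \<in> carrier N \<Longrightarrow>
      \<beta> x (r \<odot>\<^bsub>N\<^esub> y) = r \<odot>\<^bsub>L\<^esub> \<beta> x y"
  using mod_homD[OF bilinear_mapD(1)[OF assms]] mod_homD[OF bilinear_mapD(2)[OF assms]] by simp_all

lemma bilinear_map_comp:
  assumes "bilinear_map R M' N' L \<beta>" and f: "f \<in> mod_hom R M M'" and g: "g \<in> mod_hom R N N'"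
  shows "bilinear_map R M N L (\<lambda>x y. \<beta> (f x) (g y))"
  unfolding bilinear_map_def
  using mod_hom_comp[OF g bilinear_mapD(1)[OF assms(1)]] mod_homD(1)[OF f]
    mod_hom_comp[OF f bilinear_mapD(2)[OF assms(1)]] mod_homD(1)[OF g] by blast

locale module_pair = M: module R M + N: module R N
  for R :: "('a, 'c) ring_scheme" (structure) and M :: "('a, 'm) module" and N :: "('a, 'n) module"
begin

abbreviation "F \<equiv> free_module R (carrier M \<times> carrier N)"

sublocale F: module R F
  by (rule M.R.module_free_module)

lemma gen_closed [simp]:
  "x \<in> carrier M \<Longrightarrow> y \<in> carrier N \<Longrightarrow> free_gen R (x, y) \<in> carrier F"
  using M.R.free_gen_closed[of "(x, y)" "carrier M \<times> carrier N"] by simp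

lemma tensor_relators_carrier: "tensor_relators R M N \<subseteq> carrier F"
  unfolding tensor_relators_def Let_def
  by (auto simp del: free_module_simps intro!: F.M.minus_closed F.M.a_closed F.smult_closed gen_closed)

text \<open>The hull is an intersection of submodules. The whole free module is one of those that
  contain the relators, which keeps the intersection inside the carrier.\<close>

lemma submodule_tensor_rels: "submodule (tensor_rels R M N) R F"
proof -
  let ?C = "{H. submodule H R F \<and> tensor_relators R M N \<subseteq> H}"
  note sub = F.submoduleE
  show ?thesis
    unfolding tensor_rels_def hull_def
  proof (rule F.submoduleI)
    show "\<Inter> ?C \<subseteq> carrier F"
      using F.carrier_is_submodule tensor_relators_carrier by blast
    show "\<zero>\<^bsub>F\<^esub> \<in> \<Inter> ?C"
      using subgroup.one_closed submodule.axioms(1) by fastforce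
  qed (use sub(3-5) in blast)+
qed

sublocale Q: quotient R F "tensor_rels R M N"
  by (intro quotient.intro quotient_axioms.intro F.module_axioms submodule_tensor_rels)

lemma relator_mem: "u \<in> tensor_relators R M N \<Longrightarrow> u \<in> tensor_rels R M N"
  unfolding tensor_rels_def by (rule hull_inc)

lemma module_tensor: "module R (tensor R M N)"
  unfolding tensor_def by (rule Q.module_quot)

lemma coset_hom_tensor: "(\<lambda>u. tensor_rels R M N +>\<^bsub>F\<^esub> u) \<in> mod_hom R F (tensor R M N)"
  unfolding tensor_def by (rule Q.coset_hom)

text \<open>Each of the four laws is one of the four families of relators read in the
  quotient.\<close>

lemma bilinear_pure_tensor: "bilinear_map R M N (tensor R M N) (pure_tensor R M N)"
proof -
  note hom = mod_homD[OF coset_hom_tensor]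
  have eqI: "tensor_rels R M N +>\<^bsub>F\<^esub> u = tensor_rels R M N +>\<^bsub>F\<^esub> v"
    if "u \<in> carrier F" "v \<in> carrier F" "u \<ominus>\<^bsub>F\<^esub> v \<in> tensor_relators R M N" for u v
    using Q.coset_eq_iff[OF that(1,2)] relator_mem[OF that(3)] by simp
  have add_eqI: "tensor_rels R M N +>\<^bsub>F\<^esub> u
      = (tensor_rels R M N +>\<^bsub>F\<^esub> v) \<oplus>\<^bsub>tensor R M N\<^esub> (tensor_rels R M N +>\<^bsub>F\<^esub> w)"
    if "u \<in> carrier F" "v \<in> carrier F" "w \<in> carrier F"
      "u \<ominus>\<^bsub>F\<^esub> (v \<oplus>\<^bsub>F\<^esub> w) \<in> tensor_relators R M N" for u v w
    using eqI[OF that(1) F.M.a_closed[OF that(2,3)] that(4)] hom(2)[OF that(2,3)] by simp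
  have smult_eqI: "tensor_rels R M N +>\<^bsub>F\<^esub> u = r \<odot>\<^bsub>tensor R M N\<^esub> (tensor_rels R M N +>\<^bsub>F\<^esub> v)"
    if "u \<in> carrier F" "v \<in> carrier F" "r \<in> carrier R"
      "u \<ominus>\<^bsub>F\<^esub> (r \<odot>\<^bsub>F\<^esub> v) \<in> tensor_relators R M N" for u v r
    using eqI[OF that(1) F.smult_closed[OF that(3,2)] that(4)] hom(3)[OF that(3,2)] by simp
  note del = free_module_simps
  show ?thesis
    unfolding bilinear_map_def pure_tensor_def
  proof (intro conjI ballI mod_homI)
    fix x y y' assume "x \<in> carrier M" "y \<in> carrier N" "y' \<in> carrier N"
    then show "tensor_rels R M N +>\<^bsub>F\<^esub> free_gen R (x, y \<oplus>\<^bsub>N\<^esub> y') =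
        (tensor_rels R M N +>\<^bsub>F\<^esub> free_gen R (x, y)) \<oplus>\<^bsub>tensor R M N\<^esub>
        (tensor_rels R M N +>\<^bsub>F\<^esub> free_gen R (x, y'))"
      by (intro add_eqI) (auto simp: tensor_relators_def Let_def simp del: del)
  next
    fix x x' y assume "x \<in> carrier M" "x' \<in> carrier M" "y \<in> carrier N"
    then show "tensor_rels R M N +>\<^bsub>F\<^esub> free_gen R (x \<oplus>\<^bsub>M\<^esub> x', y) =
        (tensor_rels R M N +>\<^bsub>F\<^esub> free_gen R (x, y)) \<oplus>\<^bsub>tensor R M N\<^esub>
        (tensor_rels R M N +>\<^bsub>F\<^esub> free_gen R (x', y))"
      by (intro add_eqI) (auto simp: tensor_relators_def Let_def simp del: del)
  next
    fix r x y assume "r \<in> carrier R" "x \<in> carrier M" "y \<in> carrier N"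
    then show "tensor_rels R M N +>\<^bsub>F\<^esub> free_gen R (r \<odot>\<^bsub>M\<^esub> x, y) =
        r \<odot>\<^bsub>tensor R M N\<^esub> (tensor_rels R M N +>\<^bsub>F\<^esub> free_gen R (x, y))"
      by (intro smult_eqI) (auto simp: tensor_relators_def Let_def simp del: del)
  next
    fix r x y assume "x \<in> carrier M" "r \<in> carrier R" "y \<in> carrier N"
    then show "tensor_rels R M N +>\<^bsub>F\<^esub> free_gen R (x, r \<odot>\<^bsub>N\<^esub> y) =
        r \<odot>\<^bsub>tensor R M N\<^esub> (tensor_rels R M N +>\<^bsub>F\<^esub> free_gen R (x, y))"
      by (intro smult_eqI) (auto simp: tensor_relators_def Let_def simp del: del)
  qed (simp_all add: hom(1))
qed

text \<open>A coefficient r is absorbed into the first factor of a pure tensor, so pure tensors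
  generate additively and the induction has no case for scalars.\<close>

lemma tensor_induct [consumes 1, case_names zero pure add]:
  assumes "t \<in> carrier (tensor R M N)" and "P \<zero>\<^bsub>tensor R M N\<^esub>"
    and pure: "\<And>x y. x \<in> carrier M \<Longrightarrow> y \<in> carrier N \<Longrightarrow> P (pure_tensor R M N x y)"
    and add: "\<And>s t. s \<in> carrier (tensor R M N) \<Longrightarrow> t \<in> carrier (tensor R M N) \<Longrightarrow>
      P s \<Longrightarrow> P t \<Longrightarrow> P (s \<oplus>\<^bsub>tensor R M N\<^esub> t)"
  shows "P t"
proof -
  note hom = mod_homD[OF coset_hom_tensor]
  obtain u where u: "u \<in> carrier F" and t: "t = tensor_rels R M N +>\<^bsub>F\<^esub> u"
    using assms(1) Q.carrier_quot unfolding tensor_def by auto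
  from u have "P (tensor_rels R M N +>\<^bsub>F\<^esub> u)"
  proof (induction rule: M.R.free_module_induct)
    case zero
    have "tensor_rels R M N +>\<^bsub>F\<^esub> \<zero>\<^bsub>F\<^esub> = \<zero>\<^bsub>tensor R M N\<^esub>"
      using mod_hom_zero[OF coset_hom_tensor F.module_axioms module_tensor] .
    then show ?case using assms(2) by simp
  next
    case (add u s r)
    obtain x y where s: "s = (x, y)" and xy: "x \<in> carrier M" "y \<in> carrier N" using add(2) by blast
    have "tensor_rels R M N +>\<^bsub>F\<^esub> (r \<odot>\<^bsub>F\<^esub> free_gen R s) = pure_tensor R M N (r \<odot>\<^bsub>M\<^esub> x) y"
      using xy add(3) hom(3)[OF add(3) gen_closed[OF xy]] bilinear_map_simps(4)[OF bilinear_pure_tensor add(3) xy]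
      unfolding s pure_tensor_def by simp
    then have "P (tensor_rels R M N +>\<^bsub>F\<^esub> (r \<odot>\<^bsub>F\<^esub> free_gen R s))"
      using pure[of "r \<odot>\<^bsub>M\<^esub> x" y] xy add(3) by simp
    moreover have "r \<odot>\<^bsub>F\<^esub> free_gen R s \<in> carrier F"
      using add(3) xy unfolding s by (intro F.smult_closed gen_closed)
    ultimately show ?case
      using hom(2)[of "r \<odot>\<^bsub>F\<^esub> free_gen R s" u] add(1,4) assms(4) hom(1) by metis
  qed
  then show ?thesis using t by simp
qed

end

text \<open>The linear map induced by a bilinear \<beta>, in a form of which
  \<open>tensor_map\<close> is an instance.\<close>

definition tensor_lift ::
  "('a, 'c) ring_scheme \<Rightarrow> ('a, 'l) module \<Rightarrow> ('m \<Rightarrow> 'n \<Rightarrow> 'l) \<Rightarrow> ('m \<times> 'n \<Rightarrow> 'a) set \<Rightarrow> 'l" where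
  "tensor_lift R L \<beta> Y = the_elem (free_lift R L (\<lambda>(x, y). \<beta> x y) ` Y)"

lemma tensor_map_eq_tensor_lift:
  "tensor_map R M N M' N' f g
    = tensor_lift R (tensor R M' N') (\<lambda>x y. pure_tensor R M' N' (f x) (g y))"
  by (simp add: fun_eq_iff tensor_map_def tensor_lift_def)

locale bilinear = module_pair R M N + L: module R L
  for R :: "('a, 'c) ring_scheme" (structure) and M :: "('a, 'm) module" and N :: "('a, 'n) module"
    and L :: "('a, 'l) module" +
  fixes \<beta> :: "'m \<Rightarrow> 'n \<Rightarrow> 'l"
  assumes bilinear: "bilinear_map R M N L \<beta>"
begin

abbreviation "\<beta>F \<equiv> free_lift R L (\<lambda>(x, y). \<beta> x y)"

lemma \<beta>_Pi: "(\<lambda>(x, y). \<beta> x y) \<in> carrier M \<times> carrier N \<rightarrow> carrier L"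
  using bilinear_map_simps(1)[OF bilinear] by auto

lemma \<beta>F_hom: "\<beta>F \<in> mod_hom R F L"
  by (rule free_lift_hom[OF L.module_axioms \<beta>_Pi])

lemma \<beta>F_gen: "x \<in> carrier M \<Longrightarrow> y \<in> carrier N \<Longrightarrow> \<beta>F (free_gen R (x, y)) = \<beta> x y"
  using free_lift_free_gen[OF L.module_axioms \<beta>_Pi, of "(x, y)"] by simp

text \<open>The kernel of \<open>\<beta>F\<close> is a submodule, and bilinearity puts the relators
  into it; hence it contains their hull. So \<open>\<beta>F\<close> is constant on cosets.\<close>

lemma \<beta>F_tensor_rels:
  assumes "u \<in> tensor_rels R M N"
  shows "\<beta>F u = \<zero>\<^bsub>L\<^esub>"
proof -
  let ?K = "{u \<in> carrier F. \<beta>F u = \<zero>\<^bsub>L\<^esub>}"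
  note hom = mod_homD[OF \<beta>F_hom]
  note minus = mod_hom_minus[OF \<beta>F_hom F.module_axioms L.module_axioms]
  note diff = mod_hom_diff[OF \<beta>F_hom F.module_axioms L.module_axioms]
  have "submodule ?K R F"
  proof (rule F.submoduleI)
    show "\<zero>\<^bsub>F\<^esub> \<in> ?K"
      using mod_hom_zero[OF \<beta>F_hom F.module_axioms L.module_axioms] F.M.zero_closed by blast
  qed (auto simp: hom minus simp del: free_module_simps)
  moreover have "tensor_relators R M N \<subseteq> ?K"
  proof
    fix u assume u: "u \<in> tensor_relators R M N"
    moreover have "\<beta>F u = \<zero>\<^bsub>L\<^esub>"
      using u unfolding tensor_relators_def Let_def
      by (auto simp: diff hom \<beta>F_gen bilinear_map_simps[OF bilinear] L.M.r_neg a_minus_def[of L]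
          simp del: free_module_simps)
    ultimately show "u \<in> ?K" using tensor_relators_carrier by blast
  qed
  ultimately have "tensor_rels R M N \<subseteq> ?K"
    unfolding tensor_rels_def by (rule hull_minimal[rotated])
  then show ?thesis using assms by blast
qed

lemma tensor_lift_coset:
  assumes u: "u \<in> carrier F"
  shows "tensor_lift R L \<beta> (tensor_rels R M N +>\<^bsub>F\<^esub> u) = \<beta>F u"
proof -
  have "\<beta>F v = \<beta>F u" if v: "v \<in> tensor_rels R M N +>\<^bsub>F\<^esub> u" for v
  proof -
    obtain h where h: "h \<in> tensor_rels R M N" "v = h \<oplus>\<^bsub>F\<^esub> u"
      using v unfolding a_r_coset_def' by blast
    then have "h \<in> carrier F" using F.submoduleE(1)[OF submodule_tensor_rels] by blast
    then show ?thesis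
      using h(2) mod_homD[OF \<beta>F_hom] \<beta>F_tensor_rels[OF h(1)] u by (simp del: free_module_simps)
  qed
  moreover have "u \<in> tensor_rels R M N +>\<^bsub>F\<^esub> u" using Q.a_rcos_self[OF u] .
  ultimately have "\<beta>F ` (tensor_rels R M N +>\<^bsub>F\<^esub> u) = {\<beta>F u}" by blast
  then show ?thesis unfolding tensor_lift_def by simp
qed

lemma tensor_lift_pure:
  assumes "x \<in> carrier M" and "y \<in> carrier N"
  shows "tensor_lift R L \<beta> (pure_tensor R M N x y) = \<beta> x y"
  using assms unfolding pure_tensor_def by (simp add: tensor_lift_coset \<beta>F_gen)

lemma tensor_lift_hom: "tensor_lift R L \<beta> \<in> mod_hom R (tensor R M N) L"
proof -
  have C: "carrier (tensor R M N) = (\<lambda>u. tensor_rels R M N +>\<^bsub>F\<^esub> u) ` carrier F"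
    unfolding tensor_def by (rule Q.carrier_quot)
  show ?thesis
    by (rule mod_homI)
      (auto simp: C mod_homD(2,3)[OF coset_hom_tensor, symmetric] tensor_lift_coset mod_homD[OF \<beta>F_hom]
        simp del: free_module_simps)
qed

end

lemma bilinear_tensor_map:
  assumes "module R M" "module R N" "module R M'" "module R N'"
    and f: "f \<in> mod_hom R M M'" and g: "g \<in> mod_hom R N N'"
  shows "bilinear R M N (tensor R M' N') (\<lambda>x y. pure_tensor R M' N' (f x) (g y))"
proof -
  interpret MN: module_pair R M N using assms by (simp add: module_pair_def)
  interpret MN': module_pair R M' N' using assms by (simp add: module_pair_def)
  show ?thesis
    using MN'.module_tensor bilinear_map_comp[OF MN'.bilinear_pure_tensor f g]
    by (intro bilinear.intro MN.module_pair_axioms bilinear_axioms.intro)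
qed

lemma tensor_map_pure:
  assumes "module R M" "module R N" "module R M'" "module R N'"
    and "f \<in> mod_hom R M M'" and "g \<in> mod_hom R N N'"
    and "x \<in> carrier M" and "y \<in> carrier N"
  shows "tensor_map R M N M' N' f g (pure_tensor R M N x y) = pure_tensor R M' N' (f x) (g y)"
  unfolding tensor_map_eq_tensor_lift
  using bilinear.tensor_lift_pure[OF bilinear_tensor_map[OF assms(1-6)] assms(7,8)] .

lemma tensor_map_hom:
  assumes "module R M" "module R N" "module R M'" "module R N'"
    and "f \<in> mod_hom R M M'" and "g \<in> mod_hom R N N'"
  shows "tensor_map R M N M' N' f g \<in> mod_hom R (tensor R M N) (tensor R M' N')"
  unfolding tensor_map_eq_tensor_lift
  using bilinear.tensor_lift_hom[OF bilinear_tensor_map[OF assms]] .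

section \<open>Reduction modulo an ideal\<close>

lemma regular_module_simps [simp]:
  "carrier (regular_module R) = carrier R"
  "\<zero>\<^bsub>regular_module R\<^esub> = \<zero>\<^bsub>R\<^esub>"
  "add (regular_module R) = add R"
  "smult (regular_module R) = monoid.mult R"
  by (simp_all add: regular_module_def)

lemma (in cring) module_regular_module: "module R (regular_module R)"
  by (rule moduleI[OF cring_axioms abelian_groupI])
    (auto simp: a_ac l_distr r_distr m_assoc intro: exI[of _ "\<ominus> x" for x] bexI[of _ "\<ominus> x" for x] l_neg)

lemma (in cring) submodule_ideal:
  assumes "ideal J R"
  shows "submodule J R (regular_module R)"
proof -
  interpret J: ideal J R by fact
  interpret reg: module R "regular_module R" by (rule module_regular_module)
  have minus: "\<ominus>\<^bsub>regular_module R\<^esub> a = \<ominus> a" if "a \<in> carrier R" for a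
    using reg.M.minus_equality[of "\<ominus> a" a] that by (simp add: l_neg)
  show ?thesis
    by (rule reg.submoduleI) (auto simp: minus J.I_l_closed J.Icarr)
qed

lemma coset_regular_module [simp]: "J +>\<^bsub>regular_module R\<^esub> r = J +>\<^bsub>R\<^esub> r"
  by (simp add: a_r_coset_def')

section \<open>Comparison of R/J \<otimes> M with M/J M\<close>

locale module_mod_ideal = module R M for R (structure) and M :: "('a, 'm) module" (structure) +
  fixes J :: "'a set"
  assumes ideal_J: "ideal J R"
begin

abbreviation "RJ \<equiv> quot_module (regular_module R) J"

text \<open>The canonical map x to 1 \<otimes> x. It is shown to be surjective with kernel J M, so
  that computations in R/J \<otimes> M can be done with representatives in M.\<close>

definition red :: "'m \<Rightarrow> ('a set \<times> 'm \<Rightarrow> 'a) set" where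
  "red x = pure_tensor R RJ M (J +> \<one>) x"

lemma J_sub: "J \<subseteq> carrier R"
  using ideal_J ideal.axioms(1) additive_subgroup.a_subset by blast

sublocale RJ: quotient R "regular_module R" J
  by (intro quotient.intro quotient_axioms.intro module_regular_module submodule_ideal ideal_J)

sublocale T: module_pair R RJ M
  by (intro module_pair.intro RJ.module_quot module_axioms)

sublocale JM: quotient R M "ideal_smult J M"
  by (intro quotient.intro quotient_axioms.intro module_axioms submodule_ideal_smult ideal_J)

lemma RJ_carrier: "carrier RJ = (\<lambda>r. J +> r) ` carrier R"
  using RJ.carrier_quot by simp

lemma coset_in_RJ [simp]: "r \<in> carrier R \<Longrightarrow> J +> r \<in> carrier RJ"
  unfolding RJ_carrier by blast

lemma red_hom: "red \<in> mod_hom R M (tensor R RJ M)"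
  unfolding red_def using bilinear_mapD(1)[OF T.bilinear_pure_tensor coset_in_RJ[OF R.one_closed]] .

lemma pure_tensor_eq_red:
  assumes "r \<in> carrier R" and "x \<in> carrier M"
  shows "pure_tensor R RJ M (J +> r) x = red (r \<odot>\<^bsub>M\<^esub> x)"
proof -
  note simps = bilinear_map_simps[OF T.bilinear_pure_tensor]
  have "J +> r = r \<odot>\<^bsub>RJ\<^esub> (J +> \<one>)"
    using mod_homD(3)[OF RJ.coset_hom, of r \<one>] assms(1) by simp
  then show ?thesis
    unfolding red_def using assms simps(4)[OF assms(1), of "J +> \<one>" x] simps(5)[OF assms(1), of "J +> \<one>" x]
    by simp
qed

lemma red_surj: "red ` carrier M = carrier (tensor R RJ M)"
proof
  show "red ` carrier M \<subseteq> carrier (tensor R RJ M)" using mod_homD(1)[OF red_hom] by blast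
  show "carrier (tensor R RJ M) \<subseteq> red ` carrier M"
  proof
    fix t assume "t \<in> carrier (tensor R RJ M)"
    then show "t \<in> red ` carrier M"
    proof (induction rule: T.tensor_induct)
      case zero
      then show ?case
        using mod_hom_zero[OF red_hom module_axioms T.module_tensor] M.zero_closed by (metis imageI)
    next
      case (pure Y x)
      then obtain r where r: "r \<in> carrier R" "Y = J +> r" unfolding RJ_carrier by blast
      then show ?case using pure_tensor_eq_red pure(2) by simp
    next
      case (add s t)
      then obtain x y where "x \<in> carrier M" "y \<in> carrier M" "s = red x" "t = red y" by blast
      then show ?case using mod_homD(2)[OF red_hom, of x y] by (metis M.a_closed imageI)
    qed
  qed
qed

text \<open>The bilinear map that sends (r + J, x) to the class of r x in M/J M. Its lift to the
  tensor product detects the kernel of \<open>red\<close>. The chosen representative does not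
  matter, since another choice changes r x by an element of J M.\<close>

definition eval_coset :: "'a set \<Rightarrow> 'm \<Rightarrow> 'm set" where
  "eval_coset Y x = ideal_smult J M +>\<^bsub>M\<^esub> ((SOME r. r \<in> Y) \<odot>\<^bsub>M\<^esub> x)"

lemma eval_coset:
  assumes r: "r \<in> carrier R" and x: "x \<in> carrier M"
  shows "eval_coset (J +> r) x = ideal_smult J M +>\<^bsub>M\<^esub> (r \<odot>\<^bsub>M\<^esub> x)"
proof -
  define s where "s = (SOME r'. r' \<in> J +> r)"
  have "r \<in> J +> r" using RJ.a_rcos_self[of r] r by simp
  then have "s \<in> J +> r" unfolding s_def by (rule someI)
  then obtain j where j: "j \<in> J" "s = j \<oplus> r" unfolding a_r_coset_def' by blast
  have jR: "j \<in> carrier R" using j(1) J_sub by blast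
  have "s \<odot>\<^bsub>M\<^esub> x \<ominus>\<^bsub>M\<^esub> r \<odot>\<^bsub>M\<^esub> x = j \<odot>\<^bsub>M\<^esub> x"
    using jR r x unfolding j(2) by (simp add: smult_l_distr a_minus_def M.a_assoc M.r_neg)
  then have "s \<odot>\<^bsub>M\<^esub> x \<ominus>\<^bsub>M\<^esub> r \<odot>\<^bsub>M\<^esub> x \<in> ideal_smult J M"
    using smult_in_ideal_smult[OF J_sub j(1) x] by simp
  moreover have "s \<in> carrier R" using j(2) jR r by simp
  ultimately show ?thesis
    using JM.coset_eq_iff[of "s \<odot>\<^bsub>M\<^esub> x" "r \<odot>\<^bsub>M\<^esub> x"] r x unfolding eval_coset_def s_def by simp
qed

lemma bilinear_eval_coset: "bilinear R RJ M (quot_module M (ideal_smult J M)) eval_coset"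
proof (intro bilinear.intro T.module_pair_axioms JM.module_quot bilinear_axioms.intro)
  note cos = mod_homD(2,3)[OF JM.coset_hom, symmetric]
  note RJ_cos = mod_homD(2,3)[OF RJ.coset_hom, symmetric, simplified]
  show "bilinear_map R RJ M (quot_module M (ideal_smult J M)) eval_coset"
    unfolding bilinear_map_def RJ_carrier
  proof (safe, goal_cases)
    case (1 _ r)
    then show ?case
      by (intro mod_homI)
        (simp_all add: eval_coset cos smult_r_distr smult_assoc1[symmetric] R.m_comm
          mod_homD(1)[OF JM.coset_hom])
  next
    case (2 x)
    then show ?case
      by (intro mod_homI)
        (auto simp: eval_coset RJ_carrier RJ_cos cos smult_l_distr smult_assoc1
          mod_homD(1)[OF JM.coset_hom])
  qed
qed

text \<open>The lift of \<open>eval_coset\<close> sends 1 \<otimes> x to the class of x, so x lies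
  in J M if \<open>red x\<close> vanishes. Conversely 1 \<otimes> j c = (j + J) \<otimes> c vanishes
  for j in J.\<close>

lemma red_eq_zero_iff:
  assumes x: "x \<in> carrier M"
  shows "red x = \<zero>\<^bsub>tensor R RJ M\<^esub> \<longleftrightarrow> x \<in> ideal_smult J M"
proof
  interpret B: bilinear R RJ M "quot_module M (ideal_smult J M)" eval_coset
    by (rule bilinear_eval_coset)
  assume "red x = \<zero>\<^bsub>tensor R RJ M\<^esub>"
  then have "tensor_lift R (quot_module M (ideal_smult J M)) eval_coset (red x) = ideal_smult J M"
    using mod_hom_zero[OF B.tensor_lift_hom T.module_tensor JM.module_quot] by (simp add: quot_module_simps)
  then have "ideal_smult J M +>\<^bsub>M\<^esub> x = ideal_smult J M"
    unfolding red_def using B.tensor_lift_pure[OF coset_in_RJ[OF R.one_closed] x] eval_coset[OF _ x, of \<one>] x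
    by simp
  then show "x \<in> ideal_smult J M" using JM.a_rcos_self[OF x] by simp
next
  assume "x \<in> ideal_smult J M"
  then show "red x = \<zero>\<^bsub>tensor R RJ M\<^esub>"
  proof induction
    case zero
    then show ?case by (rule mod_hom_zero[OF red_hom module_axioms T.module_tensor])
  next
    case (add j c x)
    have jR: "j \<in> carrier R" using add(1) J_sub by blast
    have xM: "x \<in> carrier M" using add(3) ideal_smult_carrier[OF J_sub] by blast
    have "\<zero> \<in> J" by (rule additive_subgroup.zero_closed[OF ideal.axioms(1)[OF ideal_J]])
    \<comment> \<open>The zero coset is written as a zero multiple so that bilinearity turns the
      tensor into zero.\<close>
    then have "J +> j = \<zero> \<odot>\<^bsub>RJ\<^esub> (J +> j)"
      using mod_homD(3)[OF RJ.coset_hom, of \<zero> j] add(1) jR by (simp add: RJ.a_rcos_const[simplified])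
    then have "pure_tensor R RJ M (J +> j) c = \<zero> \<odot>\<^bsub>tensor R RJ M\<^esub> pure_tensor R RJ M (J +> j) c"
      using bilinear_map_simps(4)[OF T.bilinear_pure_tensor R.zero_closed coset_in_RJ[OF jR] add(2)]
      by simp
    also have "\<dots> = \<zero>\<^bsub>tensor R RJ M\<^esub>"
      using bilinear_map_simps(1)[OF T.bilinear_pure_tensor coset_in_RJ[OF jR] add(2)]
        module.smult_l_null[OF T.module_tensor] by blast
    finally have "red (j \<odot>\<^bsub>M\<^esub> c) = \<zero>\<^bsub>tensor R RJ M\<^esub>"
      using pure_tensor_eq_red[OF jR add(2)] by simp
    then show ?case
      using mod_homD(2)[OF red_hom, of "j \<odot>\<^bsub>M\<^esub> c" x] add.IH jR add(2) xM
        abelian_monoid.l_zero[OF abelian_group.axioms(1)[OF module.axioms(2)[OF T.module_tensor]]]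
        abelian_monoid.zero_closed[OF abelian_group.axioms(1)[OF module.axioms(2)[OF T.module_tensor]]]
      by simp
  qed
qed

lemma red_eq_iff:
  assumes x: "x \<in> carrier M" and y: "y \<in> carrier M"
  shows "red x = red y \<longleftrightarrow> x \<ominus>\<^bsub>M\<^esub> y \<in> ideal_smult J M"
proof -
  interpret TM: module R "tensor R RJ M" by (rule T.module_tensor)
  have "red x = red y \<longleftrightarrow> red x \<ominus>\<^bsub>tensor R RJ M\<^esub> red y = \<zero>\<^bsub>tensor R RJ M\<^esub>"
    using mod_homD(1)[OF red_hom] x y by (simp add: TM.M.diff_eq_zero_iff)
  also have "\<dots> \<longleftrightarrow> red (x \<ominus>\<^bsub>M\<^esub> y) = \<zero>\<^bsub>tensor R RJ M\<^esub>"
    using mod_hom_diff[OF red_hom module_axioms T.module_tensor x y] by simp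
  also have "\<dots> \<longleftrightarrow> x \<ominus>\<^bsub>M\<^esub> y \<in> ideal_smult J M" using x y by (intro red_eq_zero_iff) simp
  finally show ?thesis .
qed

end

lemma tensor_map_id_red:
  assumes "module R M" and "module R N" and J: "ideal J R" and f: "f \<in> mod_hom R M N"
    and x: "x \<in> carrier M"
  shows "tensor_map R (quot_module (regular_module R) J) M (quot_module (regular_module R) J) N id f
    (module_mod_ideal.red R M J x) = module_mod_ideal.red R N J (f x)"
proof -
  interpret M: module_mod_ideal R M J
    using assms by (intro module_mod_ideal.intro module_mod_ideal_axioms.intro)
  interpret N: module_mod_ideal R N J
    using assms by (intro module_mod_ideal.intro module_mod_ideal_axioms.intro)
  have id: "id \<in> mod_hom R M.RJ M.RJ" by (rule mod_homI) simp_all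
  show ?thesis
    unfolding M.red_def N.red_def
    using tensor_map_pure[OF M.RJ.module_quot assms(1) M.RJ.module_quot assms(2) id f _ x]
      M.coset_in_RJ[OF M.R.one_closed] by simp
qed

text \<open>The map R/J \<rightarrow> R/K takes the coset of one to the coset of one. The inclusion
  of J in K is used for K + (J + r) = K + r.\<close>

lemma tensor_map_transition_red:
  assumes "module R M" and J: "ideal J R" and K: "ideal K R" and "J \<subseteq> K" and x: "x \<in> carrier M"
  shows "tensor_map R (quot_module (regular_module R) J) M (quot_module (regular_module R) K) M
    (\<lambda>Y. K <+>\<^bsub>R\<^esub> Y) id (module_mod_ideal.red R M J x) = module_mod_ideal.red R M K x"
proof -
  interpret J: module_mod_ideal R M J
    using assms by (intro module_mod_ideal.intro module_mod_ideal_axioms.intro)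
  interpret K: module_mod_ideal R M K
    using assms by (intro module_mod_ideal.intro module_mod_ideal_axioms.intro)
  interpret K_ideal: ideal K R by fact
  have cos: "K <+>\<^bsub>R\<^esub> (J +>\<^bsub>R\<^esub> r) = K +>\<^bsub>R\<^esub> r" if r: "r \<in> carrier R" for r
  proof
    show "K <+>\<^bsub>R\<^esub> (J +>\<^bsub>R\<^esub> r) \<subseteq> K +>\<^bsub>R\<^esub> r"
    proof
      fix y assume "y \<in> K <+>\<^bsub>R\<^esub> (J +>\<^bsub>R\<^esub> r)"
      then obtain k j where k: "k \<in> K" and j: "j \<in> J" and y: "y = k \<oplus>\<^bsub>R\<^esub> (j \<oplus>\<^bsub>R\<^esub> r)"
        unfolding set_add_def' a_r_coset_def' by blast
      have "y = (k \<oplus>\<^bsub>R\<^esub> j) \<oplus>\<^bsub>R\<^esub> r"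
        using y r K_ideal.Icarr[OF k] K_ideal.Icarr[OF subsetD[OF assms(4) j]]
        by (simp add: J.R.a_assoc)
      moreover have "k \<oplus>\<^bsub>R\<^esub> j \<in> K" using k j assms(4) by blast
      ultimately show "y \<in> K +>\<^bsub>R\<^esub> r" unfolding a_r_coset_def' by blast
    qed
    show "K +>\<^bsub>R\<^esub> r \<subseteq> K <+>\<^bsub>R\<^esub> (J +>\<^bsub>R\<^esub> r)"
    proof
      fix y assume "y \<in> K +>\<^bsub>R\<^esub> r"
      then obtain k where "k \<in> K" "y = k \<oplus>\<^bsub>R\<^esub> r" unfolding a_r_coset_def' by blast
      moreover have "r \<in> J +>\<^bsub>R\<^esub> r" using J.RJ.a_rcos_self[of r] r by simp
      ultimately show "y \<in> K <+>\<^bsub>R\<^esub> (J +>\<^bsub>R\<^esub> r)" unfolding set_add_def' by blast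
    qed
  qed
  have hom: "(\<lambda>Y. K <+>\<^bsub>R\<^esub> Y) \<in> mod_hom R J.RJ K.RJ"
  proof (rule mod_homI)
    fix Y assume "Y \<in> carrier J.RJ"
    then obtain y where y: "y \<in> carrier R" "Y = J +>\<^bsub>R\<^esub> y" unfolding J.RJ_carrier by blast
    then show "K <+>\<^bsub>R\<^esub> Y \<in> carrier K.RJ" using cos by simp
    fix Z assume "Z \<in> carrier J.RJ"
    then obtain z where z: "z \<in> carrier R" "Z = J +>\<^bsub>R\<^esub> z" unfolding J.RJ_carrier by blast
    show "K <+>\<^bsub>R\<^esub> (Y \<oplus>\<^bsub>J.RJ\<^esub> Z) = (K <+>\<^bsub>R\<^esub> Y) \<oplus>\<^bsub>K.RJ\<^esub> (K <+>\<^bsub>R\<^esub> Z)"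
      using y(1) z(1) mod_homD(2)[OF J.RJ.coset_hom, of y z, symmetric]
        mod_homD(2)[OF K.RJ.coset_hom, of y z, symmetric]
      unfolding y(2) z(2) by (simp add: cos)
  next
    fix r Y assume r: "r \<in> carrier R" and "Y \<in> carrier J.RJ"
    then obtain y where y: "y \<in> carrier R" "Y = J +>\<^bsub>R\<^esub> y" unfolding J.RJ_carrier by blast
    show "K <+>\<^bsub>R\<^esub> (r \<odot>\<^bsub>J.RJ\<^esub> Y) = r \<odot>\<^bsub>K.RJ\<^esub> (K <+>\<^bsub>R\<^esub> Y)"
      using y(1) r mod_homD(3)[OF J.RJ.coset_hom r, of y, symmetric]
        mod_homD(3)[OF K.RJ.coset_hom r, of y, symmetric]
      unfolding y(2) by (simp add: cos)
  qed
  have id: "id \<in> mod_hom R M M" by (rule mod_homI) simp_all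
  show ?thesis
    unfolding J.red_def K.red_def
    using tensor_map_pure[OF J.RJ.module_quot assms(1) K.RJ.module_quot assms(1) hom id _ x]
      J.coset_in_RJ[OF J.R.one_closed] cos[OF J.R.one_closed] by simp
qed

section \<open>Projective and flat modules\<close>

lemma (in module) finsum_ideal_smult:
  assumes K: "K \<subseteq> carrier R" and "finite A" and "\<And>s. s \<in> A \<Longrightarrow> k s \<in> K" and "\<phi> \<in> A \<rightarrow> carrier M"
  shows "(\<Oplus>\<^bsub>M\<^esub>s\<in>A. k s \<odot>\<^bsub>M\<^esub> \<phi> s) \<in> ideal_smult K M"
  using assms(2-)
proof (induction A rule: finite_induct)
  case empty
  then show ?case by (simp add: ideal_smult.zero)
next
  case (insert a A)
  have "k s \<odot>\<^bsub>M\<^esub> \<phi> s \<in> carrier M" if "s \<in> insert a A" for s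
    using insert.prems K that by (intro smult_closed) auto
  then have "(\<Oplus>\<^bsub>M\<^esub>s\<in>insert a A. k s \<odot>\<^bsub>M\<^esub> \<phi> s)
      = k a \<odot>\<^bsub>M\<^esub> \<phi> a \<oplus>\<^bsub>M\<^esub> (\<Oplus>\<^bsub>M\<^esub>s\<in>A. k s \<odot>\<^bsub>M\<^esub> \<phi> s)"
    using insert.hyps by (intro M.finsum_insert) auto
  then show ?case using insert by (auto intro: ideal_smult.add)
qed

text \<open>Lifting the identity embeds P by h as a summand of the free module on its carrier. If x
  w lies in J P, every coordinate of h w lies in (J : x), and w is the combination of elements of P
  with these coordinates as coefficients.\<close>

lemma projective_module_colon_compatible:
  fixes P :: "('a, 'p) module"
  assumes "projective_module R P"
  shows "module R P" and "module.colon_compatible R P"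
proof -
  show P: "module R P" using assms by (simp add: projective_module_def)
  interpret P: module R P by fact
  let ?A = "free_module R (carrier P)"
  let ?f = "free_lift R P (\<lambda>x. x)"
  interpret A: module R ?A by (rule P.R.module_free_module)
  have f: "?f \<in> mod_hom R ?A P" by (rule free_lift_hom[OF P]) simp
  have gen: "?f (free_gen R x) = x" if "x \<in> carrier P" for x
    using free_lift_free_gen[OF P _ that, of "\<lambda>x. x"] by simp
  have "?f ` carrier ?A = carrier P"
  proof
    show "carrier P \<subseteq> ?f ` carrier ?A" using gen P.R.free_gen_closed by (metis image_eqI subsetI)
  qed (use mod_homD(1)[OF f] in blast)
  moreover have "(\<lambda>x. x) \<in> mod_hom R P P" by (rule mod_homI) simp_all
  ultimately obtain h where h: "h \<in> mod_hom R P ?A" and fh: "\<And>x. x \<in> carrier P \<Longrightarrow> ?f (h x) = x"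
    using assms f P A.module_axioms unfolding projective_module_def by metis
  have coord: "u s \<in> J" if "ideal J R" "u \<in> ideal_smult J ?A" for J u s
    using that(2)
  proof induction
    case zero
    then show ?case using additive_subgroup.zero_closed[OF ideal.axioms(1)[OF that(1)]] by simp
  next
    case (add j c u)
    have "c s \<in> carrier R" using add(2) by (simp add: mem_free_module)
    then show ?case
      using add(1) add.IH ideal.I_r_closed[OF that(1)]
        additive_subgroup.a_closed[OF ideal.axioms(1)[OF that(1)]] by simp
  qed
  show "P.colon_compatible"
    unfolding P.colon_compatible_def
  proof (intro allI impI)
    fix J x w assume J: "ideal J R" and x: "x \<in> carrier R" and w: "w \<in> carrier P"
      and xw: "x \<odot>\<^bsub>P\<^esub> w \<in> ideal_smult J P"
    let ?K = "{r \<in> carrier R. r \<otimes>\<^bsub>R\<^esub> x \<in> J}"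
    have hw: "h w \<in> carrier ?A" using mod_homD(1)[OF h w] .
    have JR: "J \<subseteq> carrier R" using ideal.Icarr[OF J] by blast
    have "h (x \<odot>\<^bsub>P\<^esub> w) \<in> ideal_smult J ?A"
      by (rule mod_hom_ideal_smult[OF h P A.module_axioms JR xw])
    then have "x \<otimes>\<^bsub>R\<^esub> h w s \<in> J" for s
      using coord[OF J] mod_homD(3)[OF h x w] by simp
    then have K: "h w s \<in> ?K" for s
      using hw x by (simp add: mem_free_module P.R.m_comm)
    have "?f (h w) \<in> ideal_smult ?K P"
      unfolding free_lift_def
      by (rule P.finsum_ideal_smult) (use K hw in \<open>auto simp: mem_free_module\<close>)
    then show "w \<in> ideal_smult ?K P" using fh[OF w] by simp
  qed
qed

text \<open>Flatness is applied to the inclusion of the ideal \<open>A = J + (x)\<close> into \<open>R\<close>: if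
  \<open>x w = \<Sum> j\<^sub>i c\<^sub>i\<close>, then \<open>x \<otimes> w = \<Sum> j\<^sub>i \<otimes> c\<^sub>i\<close> already holds in \<open>A \<otimes> M\<close>, and the
  bilinear map \<open>(j + r x, c) \<mapsto> r c\<close> from \<open>A \<times> M\<close> to \<open>M/(J : x)M\<close> sends the two sides to
  \<open>w\<close> and \<open>0\<close>.\<close>

lemma flat_module_colon_compatible:
  fixes M :: "('a, 'm) module"
  assumes "flat_module R M"
  shows "module R M" and "module.colon_compatible R M"
proof -
  show M: "module R M" using assms by (simp add: flat_module_def)
  interpret M: module R M by fact
  show "M.colon_compatible"
    unfolding M.colon_compatible_def
  proof (intro allI impI)
    fix J x w assume J: "ideal J R" and x: "x \<in> carrier R" and w: "w \<in> carrier M"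
      and xw: "x \<odot>\<^bsub>M\<^esub> w \<in> ideal_smult J M"
    interpret J: ideal J R by fact
    let ?K = "{r \<in> carrier R. r \<otimes>\<^bsub>R\<^esub> x \<in> J}"
    define A where "A = J <+>\<^bsub>R\<^esub> PIdl\<^bsub>R\<^esub> x"
    have A_ideal: "ideal A R" unfolding A_def by (intro M.R.add_ideals J M.R.cgenideal_ideal x)
    have mem_A: "a \<in> A \<longleftrightarrow> (\<exists>j\<in>J. \<exists>r\<in>carrier R. a = j \<oplus>\<^bsub>R\<^esub> r \<otimes>\<^bsub>R\<^esub> x)" for a
      unfolding A_def set_add_def' cgenideal_def by auto
    let ?B = "regular_module R"
    let ?A = "?B\<lparr>carrier := A\<rparr>"
    interpret B: module R ?B by (rule M.R.module_regular_module)
    interpret A: module R ?A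
      by (rule submodule.submodule_is_module[OF M.R.submodule_ideal[OF A_ideal] B.module_axioms])
    have A_sub: "A \<subseteq> carrier R" using ideal.Icarr[OF A_ideal] by blast
    have inc: "(\<lambda>a. a) \<in> mod_hom R ?A ?B" by (rule mod_homI) (use A_sub in auto)
    interpret K: quotient R M "ideal_smult ?K M"
      by (intro quotient.intro quotient_axioms.intro M M.submodule_ideal_smult M.R.colon_ideal J x)
    interpret AM: module_pair R ?A M by (intro module_pair.intro A.module_axioms M)
    interpret BM: module_pair R ?B M by (intro module_pair.intro B.module_axioms M)
    have K_sub: "?K \<subseteq> carrier R" by blast
    let ?cls = "\<lambda>y. ideal_smult ?K M +>\<^bsub>M\<^esub> y"
    let ?L = "quot_module M (ideal_smult ?K M)"
    \<comment> \<open>An element a = j + r x determines r only modulo (J : x), so the class of r c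
      modulo (J : x) M is independent of the choice.\<close>
    define \<beta> where "\<beta> a c = ?cls ((SOME r. r \<in> carrier R \<and> a \<ominus>\<^bsub>R\<^esub> r \<otimes>\<^bsub>R\<^esub> x \<in> J) \<odot>\<^bsub>M\<^esub> c)" for a c
    have \<beta>: "\<beta> a c = ?cls (r \<odot>\<^bsub>M\<^esub> c)"
      if r: "r \<in> carrier R" and a: "a \<in> carrier R" and ar: "a \<ominus>\<^bsub>R\<^esub> r \<otimes>\<^bsub>R\<^esub> x \<in> J" and c: "c \<in> carrier M"
      for a r c
    proof -
      define s where "s = (SOME r. r \<in> carrier R \<and> a \<ominus>\<^bsub>R\<^esub> r \<otimes>\<^bsub>R\<^esub> x \<in> J)"
      have "s \<in> carrier R \<and> a \<ominus>\<^bsub>R\<^esub> s \<otimes>\<^bsub>R\<^esub> x \<in> J"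
        unfolding s_def by (rule someI[of _ r]) (use r ar in simp)
      then have s: "s \<in> carrier R" and as: "a \<ominus>\<^bsub>R\<^esub> s \<otimes>\<^bsub>R\<^esub> x \<in> J" by auto
      have "(a \<ominus>\<^bsub>R\<^esub> r \<otimes>\<^bsub>R\<^esub> x) \<ominus>\<^bsub>R\<^esub> (a \<ominus>\<^bsub>R\<^esub> s \<otimes>\<^bsub>R\<^esub> x) \<in> J"
        using ar as by (simp add: a_minus_def)
      moreover have "(a \<ominus>\<^bsub>R\<^esub> r \<otimes>\<^bsub>R\<^esub> x) \<ominus>\<^bsub>R\<^esub> (a \<ominus>\<^bsub>R\<^esub> s \<otimes>\<^bsub>R\<^esub> x) = (s \<ominus>\<^bsub>R\<^esub> r) \<otimes>\<^bsub>R\<^esub> x"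
        using a r s x by algebra
      ultimately have "s \<ominus>\<^bsub>R\<^esub> r \<in> ?K" using r s by simp
      then have "(s \<ominus>\<^bsub>R\<^esub> r) \<odot>\<^bsub>M\<^esub> c \<in> ideal_smult ?K M"
        by (rule M.smult_in_ideal_smult[OF K_sub _ c])
      moreover have "(s \<ominus>\<^bsub>R\<^esub> r) \<odot>\<^bsub>M\<^esub> c = s \<odot>\<^bsub>M\<^esub> c \<ominus>\<^bsub>M\<^esub> r \<odot>\<^bsub>M\<^esub> c"
        using r s c by (simp add: a_minus_def M.smult_l_distr M.smult_l_minus)
      ultimately show ?thesis
        using K.coset_eq_iff[of "s \<odot>\<^bsub>M\<^esub> c" "r \<odot>\<^bsub>M\<^esub> c"] r s c unfolding \<beta>_def s_def by simp
    qed
    have rep: "\<exists>r\<in>carrier R. a \<ominus>\<^bsub>R\<^esub> r \<otimes>\<^bsub>R\<^esub> x \<in> J" if aA: "a \<in> A" for a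
    proof -
      obtain j r where j: "j \<in> J" and r: "r \<in> carrier R" and a: "a = j \<oplus>\<^bsub>R\<^esub> r \<otimes>\<^bsub>R\<^esub> x"
        using aA unfolding mem_A by blast
      have "a \<ominus>\<^bsub>R\<^esub> r \<otimes>\<^bsub>R\<^esub> x = j"
        using a r x J.Icarr[OF j] by (simp add: a_minus_def M.R.a_assoc M.R.r_neg)
      then show ?thesis using j r by auto
    qed
    note cls = mod_homD[OF K.coset_hom]
    have "bilinear_map R ?A M ?L \<beta>"
      unfolding bilinear_map_def
    proof (intro conjI ballI)
      fix a assume "a \<in> carrier ?A"
      then have aA: "a \<in> A" and a: "a \<in> carrier R" using A_sub by auto
      obtain r where r: "r \<in> carrier R" "a \<ominus>\<^bsub>R\<^esub> r \<otimes>\<^bsub>R\<^esub> x \<in> J" using rep[OF aA] by blast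
      show "\<beta> a \<in> mod_hom R M ?L"
        by (intro mod_homI)
          (simp_all add: \<beta>[OF r(1) a r(2)] r(1) cls(2,3)[symmetric] cls(1) M.smult_r_distr
            M.smult_assoc1[symmetric] M.R.m_comm)
    next
      fix c assume c: "c \<in> carrier M"
      show "(\<lambda>a. \<beta> a c) \<in> mod_hom R ?A ?L"
      proof (rule mod_homI)
        fix a assume "a \<in> carrier ?A"
        then have aA: "a \<in> A" and a: "a \<in> carrier R" using A_sub by auto
        obtain r where r: "r \<in> carrier R" "a \<ominus>\<^bsub>R\<^esub> r \<otimes>\<^bsub>R\<^esub> x \<in> J" using rep[OF aA] by blast
        show "\<beta> a c \<in> carrier ?L" using \<beta>[OF r(1) a r(2) c] cls(1) r(1) c by simp
        {
          fix b assume "b \<in> carrier ?A"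
          then have bA: "b \<in> A" and b: "b \<in> carrier R" using A_sub by auto
          obtain s where s: "s \<in> carrier R" "b \<ominus>\<^bsub>R\<^esub> s \<otimes>\<^bsub>R\<^esub> x \<in> J" using rep[OF bA] by blast
          have "(a \<ominus>\<^bsub>R\<^esub> r \<otimes>\<^bsub>R\<^esub> x) \<oplus>\<^bsub>R\<^esub> (b \<ominus>\<^bsub>R\<^esub> s \<otimes>\<^bsub>R\<^esub> x) \<in> J" using r s by simp
          moreover have "(a \<ominus>\<^bsub>R\<^esub> r \<otimes>\<^bsub>R\<^esub> x) \<oplus>\<^bsub>R\<^esub> (b \<ominus>\<^bsub>R\<^esub> s \<otimes>\<^bsub>R\<^esub> x)
            = (a \<oplus>\<^bsub>R\<^esub> b) \<ominus>\<^bsub>R\<^esub> (r \<oplus>\<^bsub>R\<^esub> s) \<otimes>\<^bsub>R\<^esub> x"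
            using a b r(1) s(1) x by algebra
          ultimately have "\<beta> (a \<oplus>\<^bsub>R\<^esub> b) c = ?cls ((r \<oplus>\<^bsub>R\<^esub> s) \<odot>\<^bsub>M\<^esub> c)"
            using a b r(1) s(1) c by (intro \<beta>) simp_all
          then show "\<beta> (a \<oplus>\<^bsub>?A\<^esub> b) c = \<beta> a c \<oplus>\<^bsub>?L\<^esub> \<beta> b c"
            using \<beta>[OF r(1) a r(2) c] \<beta>[OF s(1) b s(2) c] r(1) s(1) c
            by (simp add: cls(2)[symmetric] M.smult_l_distr)
        }
        fix t assume t: "t \<in> carrier R"
        have "t \<otimes>\<^bsub>R\<^esub> (a \<ominus>\<^bsub>R\<^esub> r \<otimes>\<^bsub>R\<^esub> x) \<in> J" using J.I_l_closed[OF r(2) t] .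
        moreover have "t \<otimes>\<^bsub>R\<^esub> (a \<ominus>\<^bsub>R\<^esub> r \<otimes>\<^bsub>R\<^esub> x) = t \<otimes>\<^bsub>R\<^esub> a \<ominus>\<^bsub>R\<^esub> (t \<otimes>\<^bsub>R\<^esub> r) \<otimes>\<^bsub>R\<^esub> x"
          using a r(1) x t by algebra
        ultimately have "\<beta> (t \<otimes>\<^bsub>R\<^esub> a) c = ?cls ((t \<otimes>\<^bsub>R\<^esub> r) \<odot>\<^bsub>M\<^esub> c)"
          using a r(1) t c by (intro \<beta>) simp_all
        then show "\<beta> (t \<odot>\<^bsub>?A\<^esub> a) c = t \<odot>\<^bsub>?L\<^esub> \<beta> a c"
          using \<beta>[OF r(1) a r(2) c] r(1) c t by (simp add: cls(3)[symmetric] M.smult_assoc1)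
      qed
    qed
    then interpret L: bilinear R ?A M ?L \<beta>
      by (intro bilinear.intro AM.module_pair_axioms K.module_quot bilinear_axioms.intro)
    let ?i = "tensor_map R ?A M ?B M (\<lambda>a. a) id"
    have id: "id \<in> mod_hom R M M" by (rule mod_homI) simp_all
    note i_pure = tensor_map_pure[OF A.module_axioms M B.module_axioms M inc id]
    note i_hom = mod_homD[OF tensor_map_hom[OF A.module_axioms M B.module_axioms M inc id]]
    note pureA = bilinear_map_simps[OF AM.bilinear_pure_tensor]
    note pureB = bilinear_map_simps[OF BM.bilinear_pure_tensor]
    have i_pure': "?i (pure_tensor R ?A M a c) = pure_tensor R ?B M \<one>\<^bsub>R\<^esub> (a \<odot>\<^bsub>M\<^esub> c)"
      if a: "a \<in> A" and c: "c \<in> carrier M" for a c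
    proof -
      have aR: "a \<in> carrier R" using a A_sub by blast
      have "?i (pure_tensor R ?A M a c) = pure_tensor R ?B M (a \<odot>\<^bsub>?B\<^esub> \<one>\<^bsub>R\<^esub>) c"
        using i_pure[of a c] a c aR by simp
      also have "\<dots> = pure_tensor R ?B M \<one>\<^bsub>R\<^esub> (a \<odot>\<^bsub>M\<^esub> c)"
        using pureB(4)[OF aR _ c, of "\<one>\<^bsub>R\<^esub>"] pureB(5)[OF aR _ c, of "\<one>\<^bsub>R\<^esub>"] by simp
      finally show ?thesis .
    qed
    have J_A: "j \<in> A" if "j \<in> J" for j
    proof -
      have "j = j \<oplus>\<^bsub>R\<^esub> \<zero>\<^bsub>R\<^esub> \<otimes>\<^bsub>R\<^esub> x" using J.Icarr[OF that] x by simp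
      then show ?thesis unfolding mem_A using that M.R.zero_closed by blast
    qed
    \<comment> \<open>The witness t is the sum of the j_i \<otimes> c_i in A \<otimes> M for y the
      sum of the j_i c_i. Its image in R \<otimes> M is 1 \<otimes> y, and the lift of \<beta> kills
      it because each j_i admits r = 0.\<close>
    have lifts: "\<exists>t\<in>carrier (tensor R ?A M). ?i t = pure_tensor R ?B M \<one>\<^bsub>R\<^esub> y \<and>
        tensor_lift R ?L \<beta> t = \<zero>\<^bsub>?L\<^esub>" if "y \<in> ideal_smult J M" for y
      using that
    proof induction
      case zero
      interpret TA: module R "tensor R ?A M" by (rule AM.module_tensor)
      have "?i \<zero>\<^bsub>tensor R ?A M\<^esub> = \<zero>\<^bsub>tensor R ?B M\<^esub>"
        by (rule mod_hom_zero[OF tensor_map_hom[OF A.module_axioms M B.module_axioms M inc id]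
              AM.module_tensor BM.module_tensor])
      moreover have "pure_tensor R ?B M \<one>\<^bsub>R\<^esub> \<zero>\<^bsub>M\<^esub> = \<zero>\<^bsub>tensor R ?B M\<^esub>"
        by (rule mod_hom_zero[OF bilinear_mapD(1)[OF BM.bilinear_pure_tensor] M BM.module_tensor]) simp
      moreover have "tensor_lift R ?L \<beta> \<zero>\<^bsub>tensor R ?A M\<^esub> = \<zero>\<^bsub>?L\<^esub>"
        by (rule mod_hom_zero[OF L.tensor_lift_hom AM.module_tensor K.module_quot])
      ultimately show ?case
        by (intro bexI[of _ "\<zero>\<^bsub>tensor R ?A M\<^esub>"] conjI TA.M.zero_closed) (simp_all only:)
    next
      case (add j c y)
      have jA: "j \<in> A" and jR: "j \<in> carrier R" using J_A J.Icarr add(1) by auto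
      have y: "y \<in> carrier M" using M.ideal_smult_carrier[OF J.a_subset] add(3) .
      obtain t where t: "t \<in> carrier (tensor R ?A M)" "?i t = pure_tensor R ?B M \<one>\<^bsub>R\<^esub> y"
        "tensor_lift R ?L \<beta> t = \<zero>\<^bsub>?L\<^esub>" using add.IH by blast
      interpret TA: module R "tensor R ?A M" by (rule AM.module_tensor)
      interpret L': module R ?L by (rule K.module_quot)
      have p: "pure_tensor R ?A M j c \<in> carrier (tensor R ?A M)"
        using pureA(1)[of j c] jA add(2) by simp
      have "\<beta> j c = ?cls (\<zero>\<^bsub>R\<^esub> \<odot>\<^bsub>M\<^esub> c)"
        by (rule \<beta>) (use jR add x in \<open>simp_all add: a_minus_def\<close>)
      then have "tensor_lift R ?L \<beta> (pure_tensor R ?A M j c) = \<zero>\<^bsub>?L\<^esub>"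
        using L.tensor_lift_pure[of j c] jA add(2) mod_hom_zero[OF K.coset_hom M K.module_quot] by simp
      then have "tensor_lift R ?L \<beta> (pure_tensor R ?A M j c \<oplus>\<^bsub>tensor R ?A M\<^esub> t) = \<zero>\<^bsub>?L\<^esub>"
        using mod_homD(2)[OF L.tensor_lift_hom p t(1)] t(3) by simp
      moreover have "?i (pure_tensor R ?A M j c \<oplus>\<^bsub>tensor R ?A M\<^esub> t)
          = pure_tensor R ?B M \<one>\<^bsub>R\<^esub> (j \<odot>\<^bsub>M\<^esub> c \<oplus>\<^bsub>M\<^esub> y)"
        using i_hom(2)[OF p t(1)] i_pure'[OF jA add(2)] t(2) pureB(2)[of "\<one>\<^bsub>R\<^esub>" "j \<odot>\<^bsub>M\<^esub> c" y] jR add(2) y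
        by simp
      ultimately show ?case using TA.M.a_closed[OF p t(1)] by blast
    qed
    obtain t where t: "t \<in> carrier (tensor R ?A M)"
      "?i t = pure_tensor R ?B M \<one>\<^bsub>R\<^esub> (x \<odot>\<^bsub>M\<^esub> w)" "tensor_lift R ?L \<beta> t = \<zero>\<^bsub>?L\<^esub>"
      using lifts[OF xw] by blast
    have "x = \<zero>\<^bsub>R\<^esub> \<oplus>\<^bsub>R\<^esub> \<one>\<^bsub>R\<^esub> \<otimes>\<^bsub>R\<^esub> x" using x by simp
    then have xA: "x \<in> A" unfolding mem_A using J.zero_closed M.R.one_closed by blast
    \<comment> \<open>Flatness makes t equal to x \<otimes> w in A \<otimes> M, since both have
      image 1 \<otimes> x w in R \<otimes> M.\<close>
    have "inj_on ?i (carrier (tensor R ?A M))"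
      using assms inc A.module_axioms B.module_axioms unfolding flat_module_def by simp
    moreover have "?i t = ?i (pure_tensor R ?A M x w)" using t(2) i_pure'[OF xA w] by simp
    ultimately have "t = pure_tensor R ?A M x w"
      using t(1) pureA(1)[of x w] xA w by (auto dest: inj_onD)
    then have "\<beta> x w = \<zero>\<^bsub>?L\<^esub>" using t(3) L.tensor_lift_pure[of x w] xA w by simp
    \<comment> \<open>For a = x the choice r = 1 is available, so the value zero of \<beta> is the
      class of w.\<close>
    moreover have "\<beta> x w = ?cls (\<one>\<^bsub>R\<^esub> \<odot>\<^bsub>M\<^esub> w)"
      by (rule \<beta>) (use x w J.zero_closed in \<open>simp_all add: a_minus_def M.R.r_neg\<close>)
    ultimately have "?cls w = ideal_smult ?K M" using w by (simp add: quot_module_simps)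
    then show "w \<in> ideal_smult ?K M" using K.a_rcos_self[OF w] by simp
  qed
qed

section \<open>Completions\<close>

lemma inverse_limit_simps:
  "carrier (inverse_limit M p) = {x. (\<forall>n. x n \<in> carrier (M n)) \<and> (\<forall>n. p n (x (Suc n)) = x n)}"
  "\<zero>\<^bsub>inverse_limit M p\<^esub> = (\<lambda>n. \<zero>\<^bsub>M n\<^esub>)"
  "x \<oplus>\<^bsub>inverse_limit M p\<^esub> y = (\<lambda>n. x n \<oplus>\<^bsub>M n\<^esub> y n)"
  "r \<odot>\<^bsub>inverse_limit M p\<^esub> x = (\<lambda>n. r \<odot>\<^bsub>M n\<^esub> x n)"
  by (simp_all add: inverse_limit_def)

lemma module_inverse_limit:
  assumes "cring R" and M: "\<And>n. module R (M n)"
    and p: "\<And>n. p n \<in> mod_hom R (M (Suc n)) (M n)"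
  shows "module R (inverse_limit M p)"
proof -
  interpret M: module R "M n" for n by (rule M)
  note simps = inverse_limit_simps mod_homD[OF p]
  show ?thesis
  proof (rule moduleI[OF assms(1) abelian_groupI])
    fix x assume x: "x \<in> carrier (inverse_limit M p)"
    show "\<exists>y\<in>carrier (inverse_limit M p). y \<oplus>\<^bsub>inverse_limit M p\<^esub> x = \<zero>\<^bsub>inverse_limit M p\<^esub>"
      using x mod_hom_minus[OF p M M]
      by (intro bexI[of _ "\<lambda>n. \<ominus>\<^bsub>M n\<^esub> x n"]) (simp_all add: simps M.M.l_neg)
  qed (auto simp: simps mod_hom_zero[OF p M M] M.M.a_ac M.smult_l_distr M.smult_r_distr
      M.smult_assoc1)
qed

lemma ideal_tower_ideal_power:
  assumes "cring R" and "ideal I R"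
  shows "ideal_tower R (ideal_power R I)"
proof -
  interpret cring R by fact
  show ?thesis
    unfolding ideal_tower_def using ideal_ideal_power ideal_power_decreasing assms(2) by blast
qed

section \<open>Elements of the completion as limits of Cauchy sequences\<close>

definition adic_limit ::
  "('a, 'c) ring_scheme \<Rightarrow> 'a set \<Rightarrow> ('a, 'm) module \<Rightarrow> (nat \<Rightarrow> 'm)
    \<Rightarrow> (nat \<Rightarrow> ('a set \<times> 'm \<Rightarrow> 'a) set)" where
  "adic_limit R I M z = (\<lambda>n. module_mod_ideal.red R M (ideal_power R I n) (z n))"

locale adic_module = module R M for R (structure) and M :: "('a, 'm) module" (structure) +
  fixes I :: "'a set"
  assumes ideal_I: "ideal I R"
begin

sublocale lev: module_mod_ideal R M "ideal_power R I n" for n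
  by (intro module_mod_ideal.intro module_axioms module_mod_ideal_axioms.intro
      R.ideal_ideal_power ideal_I)

abbreviation "level n \<equiv> tensor R (mod_power R I n) M"

abbreviation "transition n \<equiv> tensor_map R (mod_power R I (Suc n)) M (mod_power R I n) M
  (\<lambda>Y. ideal_power R I n <+> Y) id"

lemma red_hom': "module_mod_ideal.red R M (ideal_power R I n) \<in> mod_hom R M (level n)"
  unfolding mod_power_def by (rule lev.red_hom)

lemma red_surj': "lev.red n ` carrier M = carrier (level n)"
  unfolding mod_power_def by (rule lev.red_surj)

lemma module_level: "module R (level n)"
  unfolding mod_power_def by (rule lev.T.module_tensor)

lemma transition_red:
  "x \<in> carrier M \<Longrightarrow> transition n (lev.red (Suc n) x) = lev.red n x"
  unfolding mod_power_def
  by (intro tensor_map_transition_red module_axioms R.ideal_ideal_power ideal_I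
      R.ideal_power_decreasing) simp_all

lemma transition_hom: "transition n \<in> mod_hom R (level (Suc n)) (level n)"
proof (rule mod_homI)
  note hom = mod_homD(2,3)[OF red_hom', symmetric]
  fix x assume "x \<in> carrier (level (Suc n))"
  then obtain a where a: "a \<in> carrier M" "x = lev.red (Suc n) a" unfolding red_surj'[symmetric] by blast
  show "transition n x \<in> carrier (level n)"
    unfolding a(2) transition_red[OF a(1)] by (rule mod_homD(1)[OF red_hom' a(1)])
  fix y assume "y \<in> carrier (level (Suc n))"
  then obtain b where b: "b \<in> carrier M" "y = lev.red (Suc n) b" unfolding red_surj'[symmetric] by blast
  show "transition n (x \<oplus>\<^bsub>level (Suc n)\<^esub> y) = transition n x \<oplus>\<^bsub>level n\<^esub> transition n y"
    unfolding a(2) b(2) hom(1)[OF a(1) b(1)] transition_red[OF a(1)] transition_red[OF b(1)]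
    by (rule transition_red[OF M.a_closed[OF a(1) b(1)]])
next
  note hom = mod_homD(2,3)[OF red_hom', symmetric]
  fix r x assume r: "r \<in> carrier R" and "x \<in> carrier (level (Suc n))"
  then obtain a where a: "a \<in> carrier M" "x = lev.red (Suc n) a" unfolding red_surj'[symmetric] by blast
  show "transition n (r \<odot>\<^bsub>level (Suc n)\<^esub> x) = r \<odot>\<^bsub>level n\<^esub> transition n x"
    unfolding a(2) hom(2)[OF r a(1)] transition_red[OF a(1)]
    by (rule transition_red[OF smult_closed[OF r a(1)]])
qed

lemma module_completion: "module R (completion R I M)"
  unfolding completion_def
  by (rule module_inverse_limit) (rule R.cring_axioms module_level transition_hom)+

text \<open>Each component has a representative in M. On representatives, compatibility with the
  transition maps is the congruence of consecutive terms.\<close>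

lemma carrier_completion:
  "carrier (completion R I M) = adic_limit R I M ` {z. adic_cauchy (ideal_power R I) M z}"
proof
  have iff: "lev.red n x = lev.red n y \<longleftrightarrow> x \<ominus>\<^bsub>M\<^esub> y \<in> ideal_smult (ideal_power R I n) M"
    if "x \<in> carrier M" "y \<in> carrier M" for n x y using lev.red_eq_iff that .
  show "adic_limit R I M ` {z. adic_cauchy (ideal_power R I) M z} \<subseteq> carrier (completion R I M)"
  proof
    fix x assume "x \<in> adic_limit R I M ` {z. adic_cauchy (ideal_power R I) M z}"
    then obtain z where x: "x = (\<lambda>n. lev.red n (z n))" and z: "\<And>n. z n \<in> carrier M"
      and diff: "\<And>n. z (Suc n) \<ominus>\<^bsub>M\<^esub> z n \<in> ideal_smult (ideal_power R I n) M"
      unfolding adic_limit_def adic_cauchy_def by blast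
    have "transition n (x (Suc n)) = x n" for n
      unfolding x transition_red[OF z] using iff[OF z z] diff by blast
    moreover have "x n \<in> carrier (level n)" for n
      unfolding x by (rule mod_homD(1)[OF red_hom' z])
    ultimately show "x \<in> carrier (completion R I M)"
      unfolding completion_def inverse_limit_simps by blast
  qed
  show "carrier (completion R I M) \<subseteq> adic_limit R I M ` {z. adic_cauchy (ideal_power R I) M z}"
  proof
    fix x assume "x \<in> carrier (completion R I M)"
    then have x: "x n \<in> carrier (level n)" and px: "transition n (x (Suc n)) = x n" for n
      unfolding completion_def inverse_limit_simps by auto
    have "\<exists>a. a \<in> carrier M \<and> x n = lev.red n a" for n
      using x[of n] unfolding red_surj'[symmetric] by blast
    then obtain z where z: "\<And>n. z n \<in> carrier M" "\<And>n. x n = lev.red n (z n)" by metis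
    have "lev.red n (z (Suc n)) = lev.red n (z n)" for n
      using px[of n] unfolding z(2) transition_red[OF z(1)] .
    then have "adic_cauchy (ideal_power R I) M z" unfolding adic_cauchy_def using iff z(1) by blast
    moreover have "x = adic_limit R I M z" unfolding adic_limit_def using z(2) by blast
    ultimately show "x \<in> adic_limit R I M ` {z. adic_cauchy (ideal_power R I) M z}" by blast
  qed
qed

lemma adic_limit_eq_iff:
  assumes "\<And>n. y n \<in> carrier M" and "\<And>n. z n \<in> carrier M"
  shows "adic_limit R I M y = adic_limit R I M z
    \<longleftrightarrow> (\<forall>n. y n \<ominus>\<^bsub>M\<^esub> z n \<in> ideal_smult (ideal_power R I n) M)"
  unfolding adic_limit_def fun_eq_iff using lev.red_eq_iff[OF assms] by blast

lemma adic_limit_eq_zero_iff: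
  assumes "\<And>n. z n \<in> carrier M"
  shows "adic_limit R I M z = \<zero>\<^bsub>completion R I M\<^esub>
    \<longleftrightarrow> (\<forall>n. z n \<in> ideal_smult (ideal_power R I n) M)"
  unfolding adic_limit_def completion_def inverse_limit_simps fun_eq_iff mod_power_def
  using lev.red_eq_zero_iff[OF assms] by blast

end

section \<open>Completed homomorphisms: kernels, exactness and surjectivity\<close>

lemma completion_map_adic_limit:
  assumes "module R M" and "module R N" and I: "ideal I R" and f: "f \<in> mod_hom R M N"
    and z: "\<And>n. z n \<in> carrier M"
  shows "completion_map R I M N f (adic_limit R I M z) = adic_limit R I N (\<lambda>n. f (z n))"
proof -
  interpret M: module R M by fact
  show ?thesis
    unfolding completion_map_def adic_limit_def mod_power_def
    using tensor_map_id_red[OF assms(1,2) M.R.ideal_ideal_power[OF I] f z] by blast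
qed

lemma adic_cauchy_image:
  assumes "cring R" "ideal I R" and mods: "module R M" "module R N" and f: "f \<in> mod_hom R M N"
    and z: "adic_cauchy (ideal_power R I) M z"
  shows "adic_cauchy (ideal_power R I) N (\<lambda>n. f (z n))"
proof -
  have zM: "z n \<in> carrier M" for n using z by (simp add: adic_cauchy_def)
  have "z (Suc n) \<ominus>\<^bsub>M\<^esub> z n \<in> ideal_smult (ideal_power R I n) M" for n
    using z by (simp add: adic_cauchy_def)
  from mod_hom_ideal_smult[OF f mods ideal_towerD(2)[OF ideal_tower_ideal_power[OF assms(1,2)]] this]
  show ?thesis
    unfolding adic_cauchy_def using mod_hom_diff[OF f mods zM zM] mod_homD(1)[OF f zM] by simp
qed

lemma completion_map_hom:
  assumes "cring R" and mods: "module R M" "module R N" and I: "ideal I R" and f: "f \<in> mod_hom R M N"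
  shows "completion_map R I M N f \<in> mod_hom R (completion R I M) (completion R I N)"
proof -
  interpret M: adic_module R M I using assms by (intro adic_module.intro adic_module_axioms.intro)
  interpret N: adic_module R N I using assms by (intro adic_module.intro adic_module_axioms.intro)
  have id: "id \<in> mod_hom R (mod_power R I n) (mod_power R I n)" for n by (rule mod_homI) simp_all
  have level: "tensor_map R (mod_power R I n) M (mod_power R I n) N id f
      \<in> mod_hom R (M.level n) (N.level n)" for n
    using tensor_map_hom[OF M.lev.RJ.module_quot mods(1) M.lev.RJ.module_quot mods(2) _ f] id
    unfolding mod_power_def .
  show ?thesis
  proof (rule mod_homI)
    fix x assume "x \<in> carrier (completion R I M)"
    then obtain z where z: "adic_cauchy (ideal_power R I) M z" "x = adic_limit R I M z"
      unfolding M.carrier_completion by blast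
    then have "completion_map R I M N f x = adic_limit R I N (\<lambda>n. f (z n))"
      using completion_map_adic_limit[OF mods I f] by (simp add: adic_cauchy_def)
    then show "completion_map R I M N f x \<in> carrier (completion R I N)"
      unfolding N.carrier_completion using adic_cauchy_image[OF assms(1) I mods f z(1)] by blast
  qed (auto simp: completion_def inverse_limit_simps completion_map_def mod_homD[OF level])
qed

text \<open>The Mittag-Leffler argument read in the completion. The hypothesis is a congruence for g
  (z n) and not membership in the kernel of a completed g, because in degree zero g is the composite
  P_0 \<rightarrow> Q \<rightarrow> F_-1 while the kernel of interest belongs to P_0 \<rightarrow>
  Q.\<close>

lemma completion_map_exact:
  assumes "cring R" and I: "ideal I R"
    and mods: "module R C3" "module R C2" "module R C1" "module R C0"
    and e: "e \<in> mod_hom R C3 C2" and f: "f \<in> mod_hom R C2 C1"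
    and fe: "\<And>x. x \<in> carrier C3 \<Longrightarrow> f (e x) = \<zero>\<^bsub>C1\<^esub>"
    and ex2: "pro_exact (ideal_power R I) C3 e C2 f C1"
    and ex1: "pro_exact (ideal_power R I) C2 f C1 g C0"
    and z: "adic_cauchy (ideal_power R I) C1 z"
    and gz: "\<And>n. g (z n) \<in> ideal_smult (ideal_power R I n) C0"
  shows "adic_limit R I C1 z \<in> completion_map R I C2 C1 f ` carrier (completion R I C2)"
proof -
  interpret C2: adic_module R C2 I using assms by (intro adic_module.intro adic_module_axioms.intro)
  interpret C1: adic_module R C1 I using assms by (intro adic_module.intro adic_module_axioms.intro)
  obtain y where y: "adic_cauchy (ideal_power R I) C2 y"
    and zy: "\<And>n. z n \<ominus>\<^bsub>C1\<^esub> f (y n) \<in> ideal_smult (ideal_power R I n) C1"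
    using adic_cauchy_exact[OF ideal_tower_ideal_power[OF assms(1,2)] mods e f fe ex2 ex1 z gz] by blast
  have yC: "y n \<in> carrier C2" and zC: "z n \<in> carrier C1" for n
    using y z by (simp_all add: adic_cauchy_def)
  have "adic_limit R I C1 z = adic_limit R I C1 (\<lambda>n. f (y n))"
    using C1.adic_limit_eq_iff[of z "\<lambda>n. f (y n)"] zC mod_homD(1)[OF f yC] zy by blast
  also have "\<dots> = completion_map R I C2 C1 f (adic_limit R I C2 y)"
    using completion_map_adic_limit[OF mods(2,3) I f yC] by simp
  finally show ?thesis using y unfolding C2.carrier_completion by blast
qed

lemma kernel_completion_map:
  assumes "cring R" and mods: "module R M" "module R N" and I: "ideal I R" and f: "f \<in> mod_hom R M N"
  shows "a_kernel (completion R I M) (completion R I N) (completion_map R I M N f)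
    = adic_limit R I M ` {z. adic_cauchy (ideal_power R I) M z \<and>
        (\<forall>n. f (z n) \<in> ideal_smult (ideal_power R I n) N)}"
proof -
  interpret M: adic_module R M I using assms by (intro adic_module.intro adic_module_axioms.intro)
  interpret N: adic_module R N I using assms by (intro adic_module.intro adic_module_axioms.intro)
  have "completion_map R I M N f (adic_limit R I M z) = \<zero>\<^bsub>completion R I N\<^esub>
      \<longleftrightarrow> (\<forall>n. f (z n) \<in> ideal_smult (ideal_power R I n) N)"
    if "adic_cauchy (ideal_power R I) M z" for z
  proof -
    have z: "z n \<in> carrier M" for n using that by (simp add: adic_cauchy_def)
    show ?thesis
      unfolding completion_map_adic_limit[OF mods I f z]
      by (rule N.adic_limit_eq_zero_iff) (rule mod_homD(1)[OF f z])
  qed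
  then show ?thesis unfolding a_kernel_def' M.carrier_completion by auto
qed

lemma image_completion_map_subset_kernel:
  assumes "cring R" and mods: "module R L" "module R M" "module R N" and I: "ideal I R"
    and f: "f \<in> mod_hom R L M" and g: "g \<in> mod_hom R M N"
    and gf: "\<And>x. x \<in> carrier L \<Longrightarrow> g (f x) = \<zero>\<^bsub>N\<^esub>"
  shows "completion_map R I L M f ` carrier (completion R I L)
    \<subseteq> a_kernel (completion R I M) (completion R I N) (completion_map R I M N g)"
proof
  interpret L: adic_module R L I using assms by (intro adic_module.intro adic_module_axioms.intro)
  fix x assume "x \<in> completion_map R I L M f ` carrier (completion R I L)"
  then obtain y where y: "adic_cauchy (ideal_power R I) L y"
    and x: "x = completion_map R I L M f (adic_limit R I L y)" unfolding L.carrier_completion by blast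
  have yL: "y n \<in> carrier L" for n using y by (simp add: adic_cauchy_def)
  have "x = adic_limit R I M (\<lambda>n. f (y n))"
    unfolding x by (rule completion_map_adic_limit[OF mods(1,2) I f yL])
  moreover have "adic_cauchy (ideal_power R I) M (\<lambda>n. f (y n))"
    by (rule adic_cauchy_image[OF assms(1) I mods(1,2) f y])
  moreover have "g (f (y n)) \<in> ideal_smult (ideal_power R I n) N" for n
    unfolding gf[OF yL] by (rule ideal_smult.zero)
  ultimately show "x \<in> a_kernel (completion R I M) (completion R I N) (completion_map R I M N g)"
    unfolding kernel_completion_map[OF assms(1) mods(2,3) I g] by blast
qed

lemma completion_map_surj:
  assumes "cring R" and mods: "module R M" "module R N" and I: "ideal I R" and f: "f \<in> mod_hom R M N"
    and surj: "f ` carrier M = carrier N"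
  shows "completion_map R I M N f ` carrier (completion R I M) = carrier (completion R I N)"
proof
  interpret M: adic_module R M I using assms by (intro adic_module.intro adic_module_axioms.intro)
  interpret N: adic_module R N I using assms by (intro adic_module.intro adic_module_axioms.intro)
  show "completion_map R I M N f ` carrier (completion R I M) \<subseteq> carrier (completion R I N)"
    using mod_homD(1)[OF completion_map_hom[OF assms(1-5)]] by blast
  show "carrier (completion R I N) \<subseteq> completion_map R I M N f ` carrier (completion R I M)"
  proof
    fix y assume "y \<in> carrier (completion R I N)"
    then obtain z where z: "adic_cauchy (ideal_power R I) N z" and y: "y = adic_limit R I N z"
      unfolding N.carrier_completion by blast
    obtain x where x: "adic_cauchy (ideal_power R I) M x" and fx: "\<And>n. f (x n) = z n"
      using adic_cauchy_lift[OF ideal_tower_ideal_power[OF assms(1) I] mods f surj z] by blast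
    have xM: "x n \<in> carrier M" for n using x by (simp add: adic_cauchy_def)
    have "completion_map R I M N f (adic_limit R I M x) = y"
      using completion_map_adic_limit[OF mods I f xM] unfolding fx y .
    then show "y \<in> completion_map R I M N f ` carrier (completion R I M)"
      using x unfolding M.carrier_completion by blast
  qed
qed

section \<open>Local homology of a Gorenstein flat module\<close>

theorem lemma2p2:
  fixes R :: "('a, 'c) ring_scheme"
    and \<aa> :: "'a set"
    and Q :: "('a, 'q) module"
    and P :: "nat \<Rightarrow> ('a, 'p) module"
    and d :: "nat \<Rightarrow> 'p \<Rightarrow> 'p"
    and \<epsilon> :: "'p \<Rightarrow> 'q"
  assumes "cring R" and "noetherian_ring R"
    and "ideal \<aa> R"
    and "gorenstein_flat TYPE('f) R Q"
    and "projective_resolution R P d \<epsilon> Q"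
  shows "(\<forall>i>0. carrier (local_homology R \<aa> P d i) = {\<zero>\<^bsub>local_homology R \<aa> P d i\<^esub>}) \<and>
    xi R \<aa> P \<epsilon> Q \<in> mod_iso R (local_homology R \<aa> P d 0) (completion R \<aa> Q)"
proof -
  note R = assms(1,2) and I = assms(3)
  have Q: "module R Q" and d: "\<And>n. d n \<in> mod_hom R (P (Suc n)) (P n)"
    and proj: "\<And>n. projective_module R (P n)"
    and exP: "\<And>n. exact_at (P (Suc (Suc n))) (d (Suc n)) (P (Suc n)) (d n) (P n)"
    and \<epsilon>: "\<epsilon> \<in> mod_hom R (P 0) Q" and ex\<epsilon>: "exact_at (P (Suc 0)) (d 0) (P 0) \<epsilon> Q"
    and \<epsilon>_surj: "\<epsilon> ` carrier (P 0) = carrier Q"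
    using assms(5) unfolding projective_resolution_def by blast+
  note P = projective_module_colon_compatible[OF proj]
  obtain F :: "int \<Rightarrow> ('a, 'f) module" and D \<theta> where flat: "\<And>n. flat_module R (F n)"
    and D: "\<And>n. D n \<in> mod_hom R (F n) (F (n - 1))"
    and exF: "\<And>n. exact_at (F (n + 1)) (D (n + 1)) (F n) (D n) (F (n - 1))"
    and \<theta>_iso: "\<theta> \<in> mod_iso R Q ((F (- 1))\<lparr>carrier := D 0 ` carrier (F 0)\<rparr>)"
    using assms(4) unfolding gorenstein_flat_def by blast
  note F = flat_module_colon_compatible[OF flat]
  have D0: "D 0 ` carrier (F 0) = a_kernel (F (- 1)) (F (- 2)) (D (- 1))"
    using exF[of "- 1"] by (simp add: exact_at_def)
  have \<theta>: "\<theta> \<in> mod_hom R Q (F (- 1))" and \<theta>_inj: "inj_on \<theta> (carrier Q)"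
    and \<theta>_image: "\<theta> ` carrier Q = D 0 ` carrier (F 0)"
  proof -
    have "\<theta> \<in> mod_hom R Q ((F (- 1))\<lparr>carrier := D 0 ` carrier (F 0)\<rparr>)"
      and bij: "bij_betw \<theta> (carrier Q) (D 0 ` carrier (F 0))"
      using \<theta>_iso by (simp_all add: mod_iso_def)
    note hom = mod_homD[OF this(1)]
    show "\<theta> \<in> mod_hom R Q (F (- 1))"
    proof (rule mod_homI)
      fix x assume "x \<in> carrier Q"
      then have "\<theta> x \<in> D 0 ` carrier (F 0)" using hom(1) by simp
      then show "\<theta> x \<in> carrier (F (- 1))" unfolding D0 a_kernel_def' by blast
    qed (use hom(2,3) in simp_all)
    show "inj_on \<theta> (carrier Q)" "\<theta> ` carrier Q = D 0 ` carrier (F 0)"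
      using bij by (simp_all add: bij_betw_def)
  qed
  \<comment> \<open>The splice of the resolution with the right half of F. As \<theta> is injective
    with image the kernel of \<open>D (- 1)\<close>, and \<epsilon> is onto, the spliced complex is
    exact at P_0 and at F_-1.\<close>
  let ?\<iota> = "\<lambda>x. \<theta> (\<epsilon> x)"
  have \<iota>: "?\<iota> \<in> mod_hom R (P 0) (F (- 1))" by (rule mod_hom_comp[OF \<epsilon> \<theta>])
  have \<theta>_zero: "\<theta> y = \<zero>\<^bsub>F (- 1)\<^esub> \<longleftrightarrow> y = \<zero>\<^bsub>Q\<^esub>" if "y \<in> carrier Q" for y
  proof -
    interpret Q: module R Q by (rule Q)
    show ?thesis using mod_hom_zero[OF \<theta> Q F(1)] inj_onD[OF \<theta>_inj _ that Q.M.zero_closed] by auto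
  qed
  have ex0: "exact_at (P (Suc 0)) (d 0) (P 0) ?\<iota> (F (- 1))"
    using ex\<epsilon> mod_homD(1)[OF \<epsilon>] \<theta>_zero unfolding exact_at_def a_kernel_def' by auto
  have ex1: "exact_at (P 0) ?\<iota> (F (- 1)) (D (- 1)) (F (- 2))"
    unfolding exact_at_def using \<theta>_image \<epsilon>_surj D0 by (simp flip: image_image)
  obtain xs where xs: "set xs \<subseteq> carrier R" and \<aa>: "\<aa> = Idl\<^bsub>R\<^esub> (set xs)"
    using noetherian_ring.finetely_gen[OF R(2) I] finite_list by metis
  note spliced = pro_exact_spliced_resolution[OF R F D exF P d exP \<iota> ex0 ex1 xs]
  have px0: "pro_exact (ideal_power R \<aa>) (P (Suc 0)) (d 0) (P 0) ?\<iota> (F (- 1))"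
    unfolding \<aa> by (rule pro_exact_ideal_power[OF R(1) xs spliced(1)])
  have px: "pro_exact (ideal_power R \<aa>) (P (Suc (Suc n))) (d (Suc n)) (P (Suc n)) (d n) (P n)" for n
    unfolding \<aa> by (rule pro_exact_ideal_power[OF R(1) xs spliced(2)])
  have dd: "d n (d (Suc n) x) = \<zero>\<^bsub>P n\<^esub>" if "x \<in> carrier (P (Suc (Suc n)))" for n x
    using exact_at_comp[OF exP that] .
  have C: "module R (completion R \<aa> (P n))" for n
    by (intro adic_module.module_completion adic_module.intro adic_module_axioms.intro P(1) I)
  let ?\<Lambda>d = "\<lambda>n. completion_map R \<aa> (P (Suc n)) (P n) (d n)"
  note \<Lambda>d = completion_map_hom[OF R(1) P(1) P(1) I d]
  have "carrier (local_homology R \<aa> P d i) = {\<zero>\<^bsub>local_homology R \<aa> P d i\<^esub>}" if "i > 0" for i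
  proof -
    obtain k where i: "i = Suc k" using \<open>i > 0\<close> by (cases i) auto
    let ?H = "a_kernel (completion R \<aa> (P (Suc k))) (completion R \<aa> (P k)) (?\<Lambda>d k)"
    \<comment> \<open>Pro-exactness at P_(k+2) and at P_(k+1) gives exactness of the completed
      complex at P_(k+1).\<close>
    have "?\<Lambda>d (Suc k) ` carrier (completion R \<aa> (P (Suc (Suc k)))) = ?H"
    proof
      show "?\<Lambda>d (Suc k) ` carrier (completion R \<aa> (P (Suc (Suc k)))) \<subseteq> ?H"
        by (rule image_completion_map_subset_kernel[OF R(1) P(1) P(1) P(1) I d d dd])
      show "?H \<subseteq> ?\<Lambda>d (Suc k) ` carrier (completion R \<aa> (P (Suc (Suc k))))"
        unfolding kernel_completion_map[OF R(1) P(1) P(1) I d]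
        using completion_map_exact[OF R(1) I P(1) P(1) P(1) P(1) d d dd px px] by blast
    qed
    then have "local_homology R \<aa> P d i
        = quot_module ((completion R \<aa> (P (Suc k)))\<lparr>carrier := ?H\<rparr>) ?H"
      unfolding local_homology_def homology_def cycles_def i by simp
    moreover have "module R ((completion R \<aa> (P (Suc k)))\<lparr>carrier := ?H\<rparr>)"
      by (rule submodule.submodule_is_module[OF submodule_kernel[OF \<Lambda>d C C] C])
    ultimately show ?thesis using carrier_quot_carrier by (fastforce simp: quot_module_simps)
  qed
  moreover have "xi R \<aa> P \<epsilon> Q \<in> mod_iso R (local_homology R \<aa> P d 0) (completion R \<aa> Q)"
  proof -
    let ?\<Lambda>\<epsilon> = "completion_map R \<aa> (P 0) Q \<epsilon>"
    let ?K = "a_kernel (completion R \<aa> (P 0)) (completion R \<aa> Q) ?\<Lambda>\<epsilon>"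
    have "?\<Lambda>d 0 ` carrier (completion R \<aa> (P (Suc 0))) = ?K"
    proof
      show "?\<Lambda>d 0 ` carrier (completion R \<aa> (P (Suc 0))) \<subseteq> ?K"
        by (rule image_completion_map_subset_kernel[OF R(1) P(1) P(1) Q I d \<epsilon> exact_at_comp[OF ex\<epsilon>]])
      show "?K \<subseteq> ?\<Lambda>d 0 ` carrier (completion R \<aa> (P (Suc 0)))"
      proof
        fix x assume "x \<in> ?K"
        then obtain z where x: "x = adic_limit R \<aa> (P 0) z"
          and z: "adic_cauchy (ideal_power R \<aa>) (P 0) z"
          and \<epsilon>z: "\<And>n. \<epsilon> (z n) \<in> ideal_smult (ideal_power R \<aa> n) Q"
          unfolding kernel_completion_map[OF R(1) P(1) Q I \<epsilon>] by blast
        \<comment> \<open>Pro-exactness at P_0 is known with F_-1 on the right, not with Q. The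
          homomorphism \<theta> carries the congruences from Q to F_-1.\<close>
        have \<iota>z: "\<theta> (\<epsilon> (z n)) \<in> ideal_smult (ideal_power R \<aa> n) (F (- 1))" for n
          by (rule mod_hom_ideal_smult[OF \<theta> Q F(1)
                ideal_towerD(2)[OF ideal_tower_ideal_power[OF R(1) I]] \<epsilon>z])
        show "x \<in> ?\<Lambda>d 0 ` carrier (completion R \<aa> (P (Suc 0)))"
          unfolding x
          by (rule completion_map_exact[OF R(1) I P(1) P(1) P(1) F(1) d d dd px px0 z])
            (assumption, rule \<iota>z)
      qed
    qed
    \<comment> \<open>In degree zero the cycles are the whole completion of P_0. The homology is
      thus its quotient by the kernel of the completed \<epsilon>, and \<open>xi\<close> is the map
      of the first isomorphism theorem.\<close>
    then have "local_homology R \<aa> P d 0 = quot_module (completion R \<aa> (P 0)) ?K"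
      unfolding local_homology_def homology_def cycles_def by simp
    moreover have "module R (completion R \<aa> Q)"
      by (intro adic_module.module_completion adic_module.intro adic_module_axioms.intro Q I)
    ultimately show ?thesis
      using mod_iso_quot_kernel[OF completion_map_hom[OF R(1) P(1) Q I \<epsilon>] C _
          completion_map_surj[OF R(1) P(1) Q I \<epsilon> \<epsilon>_surj]]
      unfolding xi_def[abs_def] by simp
  qed
  ultimately show ?thesis by blast
qed

end
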